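(* Let $\Omega\subset\mathbb{R}^N$ be a bounded domain satisfying the interior sphere condition, let $p_1>1$, and let $f,g:\mathbb{R}\to\mathbb{R}^+$ be nondecreasing on $\mathbb{R}^+$ and locally Lipschitz continuous on $\mathbb{R}$. Let $(u,v)\in C^1_0(\overline{\Omega})\times C^1_0(\overline{\Omega})$ be a weak solution of $$\begin{cases}-\Delta_{p_1}u=f(v)&\text{in }\Omega,\quad u>0\ \text{in }\Omega,\\ -\Delta v=g(u)&\text{in }\Omega,\quad v>0\ \text{in }\Omega.\end{cases}$$ Then, for any direction $\nu\in\mathbb{R}^N$ ($|\nu|=1$) and for any $\lambda$ in the interval $(a(\nu),\lambda_1(\nu)]$, $$u(x)\le u(x_\lambda^\nu)\quad\text{and}\quad v(x)\le v(x_\lambda^\nu)\qquad\forall x\in\Omega_\lambda^\nu.$$ Moreover, $$\frac{\partial v}{\partial\nu}>0\quad\text{in }\Omega_\lambda^\nu\qquad\forall\lambda<\lambda_1(\nu).$$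
   Context: $\mathbb{R}^+=[0,\infty)$. $\Delta_p u=\mathrm{div}(|\nabla u|^{p-2}\nabla u)$, so $\Delta_2=\Delta$. $C^1_0(\overline\Omega)$ is the set of $C^1(\overline\Omega)$ functions vanishing on $\partial\Omega$. A pair $(u,v)$ is a weak solution of $-\Delta_{p_1}u=f(v)$, $-\Delta_{p_2}v=g(u)$ in $\Omega$ (here $p_2=2$) if for all $\varphi\in C_c^\infty(\Omega)$: $\int_\Omega|\nabla u|^{p_1-2}\nabla u\cdot\nabla\varphi\,dx=\int_\Omega f(v)\varphi\,dx$ and $\int_\Omega|\nabla v|^{p_2-2}\nabla v\cdot\nabla\varphi\,dx=\int_\Omega g(u)\varphi\,dx$. For a direction $\nu\in\mathbb{R}^N$, $|\nu|=1$, let $a(\nu)=\inf_{x\in\Omega}x\cdot\nu$, and for $\lambda\ge a(\nu)$ let $\Omega_\lambda^\nu=\{x\in\Omega: x\cdot\nu<\lambda\}$ and $T_\lambda^\nu=\{x\in\mathbb{R}^N: x\cdot\nu=\lambda\}$. Let $R_\lambda^\nu$ be the reflection with respect to the hyperplane $T_\lambda^\nu$, $x_\lambda^\nu=R_\lambda^\nu(x)=x+2(\lambda-x\cdot\nu)\nu$, and $(\Omega_\lambda^\nu)'=R_\lambda^\nu(\Omega_\lambda^\nu)$. Let $\Lambda_1(\nu)$ be the set of $\mu>a(\nu)$ such that for all $\lambda\in(a(\nu),\mu)$ both of the following hold: (1) $(\Omega_\lambda^\nu)'$ is not internally tangent to $\partial\Omega$ at some point $p\notin T_\lambda^\nu$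 (i.e. there is no point $p\notin T_\lambda^\nu$ at which $(\Omega_\lambda^\nu)'$ is internally tangent to $\partial\Omega$; internally tangent at $p$ means $(\Omega_\lambda^\nu)'\subset\Omega$ and $p\in\partial(\Omega_\lambda^\nu)'\cap\partial\Omega$); (2) $\nu(x)\cdot\nu\neq0$ for all $x\in\partial\Omega\cap T_\lambda^\nu$, where $\nu(x)$ is the inward unit normal to $\partial\Omega$ at $x$. Then $\lambda_1(\nu)=\sup\Lambda_1(\nu)$. $\partial/\partial\nu$ denotes the directional derivative in direction $\nu$. *)

theory Defs
  imports "HOL-Analysis.Analysis"
begin

section \<open>Domains and function spaces\<close>

definition bounded_domain :: "'a::euclidean_space set \<Rightarrow> bool" where
  "bounded_domain \<Omega> \<longleftrightarrow> open \<Omega> \<and> connected \<Omega> \<and> \<Omega> \<noteq> {} \<and> bounded \<Omega>"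

text \<open>The radius of the touching ball may depend on the boundary point.\<close>

definition interior_sphere_condition :: "'a::euclidean_space set \<Rightarrow> bool" where
  "interior_sphere_condition \<Omega> \<longleftrightarrow>
     (\<forall>x\<in>frontier \<Omega>. \<exists>c r. 0 < r \<and> ball c r \<subseteq> \<Omega> \<and> x \<in> sphere c r)"

definition locally_lipschitz :: "(real \<Rightarrow> real) \<Rightarrow> bool" where
  "locally_lipschitz f \<longleftrightarrow> (\<forall>s. \<exists>e>0. \<exists>L. L-lipschitz_on (cball s e) f)"

text \<open>Functions on \<open>\<Omega>\<close> or its closure are represented by total functions whose values elsewhere
  are irrelevant. \<open>C\<^sup>1\<close> up to the boundary means: \<open>C\<^sup>1\<close> in \<open>\<Omega>\<close>, with \<open>u\<close> and its gradient having
  continuous extensions to the closure; the extension of \<open>u\<close> is \<open>u\<close> itself, that of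
  the gradient is \<open>G\<close>.\<close>

definition C1_closure :: "'a::euclidean_space set \<Rightarrow> ('a \<Rightarrow> real) set" where
  "C1_closure \<Omega> = {u. continuous_on (closure \<Omega>) u \<and>
     (\<exists>G. continuous_on (closure \<Omega>) G \<and> (\<forall>x\<in>\<Omega>. GDERIV u x :> G x))}"

definition C1_0 :: "'a::euclidean_space set \<Rightarrow> ('a \<Rightarrow> real) set" where
  "C1_0 \<Omega> = {u \<in> C1_closure \<Omega>. \<forall>x\<in>frontier \<Omega>. u x = 0}"

primrec C_k :: "nat \<Rightarrow> ('a::euclidean_space \<Rightarrow> real) \<Rightarrow> bool" where
  "C_k 0 \<phi> \<longleftrightarrow> continuous_on UNIV \<phi>"
| "C_k (Suc k) \<phi> \<longleftrightarrow> (\<forall>x. \<phi> differentiable at x) \<and>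
     (\<forall>i\<in>Basis. C_k k (\<lambda>x. frechet_derivative \<phi> (at x) i))"

text \<open>Elements of \<open>C\<^sub>c\<^sup>\<infinity>(\<Omega>)\<close>, extended by zero to the whole space.\<close>

definition test_functions :: "'a::euclidean_space set \<Rightarrow> ('a \<Rightarrow> real) set" where
  "test_functions \<Omega> = {\<phi>. (\<forall>k. C_k k \<phi>) \<and>
     compact (closure {x. \<phi> x \<noteq> 0}) \<and> closure {x. \<phi> x \<noteq> 0} \<subseteq> \<Omega>}"


section \<open>Weak solutions\<close>

definition gradient :: "('a::euclidean_space \<Rightarrow> real) \<Rightarrow> 'a \<Rightarrow> 'a" where
  "gradient u x = (THE D. GDERIV u x :> D)"

lemma gradient_eq:
  assumes "GDERIV u x :> D"
  shows "gradient u x = D"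
  unfolding gradient_def
proof (rule the_equality[where P = "\<lambda>D. GDERIV u x :> D", OF assms])
  fix E assume "GDERIV u x :> E"
  then have "(\<lambda>h. inner h E) = (\<lambda>h. inner h D)"
    using assms unfolding gderiv_def by (rule has_derivative_unique)
  then have "inner h E = inner h D" for h
    by meson
  then show "E = D"
    by (metis inner_commute vector_eq_rdot)
qed

text \<open>Since \<open>0 powr a = 0\<close> for every \<open>a\<close>, the flux is \<open>0\<close> where the gradient vanishes, which is the
  right value for every \<open>p > 1\<close>.\<close>

definition p_flux :: "real \<Rightarrow> 'a::euclidean_space \<Rightarrow> 'a" where
  "p_flux p z = norm z powr (p - 2) *\<^sub>R z"

definition weak_solution ::
  "'a::euclidean_space set \<Rightarrow> real \<Rightarrow> real \<Rightarrow> (real \<Rightarrow> real) \<Rightarrow> (real \<Rightarrow> real) \<Rightarrow>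
    ('a \<Rightarrow> real) \<Rightarrow> ('a \<Rightarrow> real) \<Rightarrow> bool" where
  "weak_solution \<Omega> p1 p2 f g u v \<longleftrightarrow> (\<forall>\<phi>\<in>test_functions \<Omega>.
     (LINT x:\<Omega>|lborel. p_flux p1 (gradient u x) \<bullet> gradient \<phi> x) = (LINT x:\<Omega>|lborel. f (v x) * \<phi> x) \<and>
     (LINT x:\<Omega>|lborel. p_flux p2 (gradient v x) \<bullet> gradient \<phi> x) = (LINT x:\<Omega>|lborel. g (u x) * \<phi> x))"

definition directional_derivative :: "('a::euclidean_space \<Rightarrow> real) \<Rightarrow> 'a \<Rightarrow> 'a \<Rightarrow> real" where
  "directional_derivative v \<nu> x = deriv (\<lambda>t. v (x + t *\<^sub>R \<nu>)) 0"


section \<open>Moving planes\<close>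

definition a_inf :: "'a::euclidean_space set \<Rightarrow> 'a \<Rightarrow> real" where
  "a_inf \<Omega> \<nu> = (INF x\<in>\<Omega>. x \<bullet> \<nu>)"

definition cap :: "'a::euclidean_space set \<Rightarrow> 'a \<Rightarrow> real \<Rightarrow> 'a set" where
  "cap \<Omega> \<nu> l = {x \<in> \<Omega>. x \<bullet> \<nu> < l}"

definition hyperplane :: "'a::euclidean_space \<Rightarrow> real \<Rightarrow> 'a set" where
  "hyperplane \<nu> l = {x. x \<bullet> \<nu> = l}"

definition reflection :: "'a::euclidean_space \<Rightarrow> real \<Rightarrow> 'a \<Rightarrow> 'a" where
  "reflection \<nu> l x = x + (2 * (l - x \<bullet> \<nu>)) *\<^sub>R \<nu>"

definition reflected_cap :: "'a::euclidean_space set \<Rightarrow> 'a \<Rightarrow> real \<Rightarrow> 'a set" where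
  "reflected_cap \<Omega> \<nu> l = reflection \<nu> l ` cap \<Omega> \<nu> l"

definition internally_tangent_at :: "'a::euclidean_space set \<Rightarrow> 'a set \<Rightarrow> 'a \<Rightarrow> bool" where
  "internally_tangent_at A \<Omega> p \<longleftrightarrow> A \<subseteq> \<Omega> \<and> p \<in> frontier A \<inter> frontier \<Omega>"

text \<open>\<open>n\<close> is the inward unit normal to the boundary of \<open>\<Omega>\<close> at \<open>x\<close>: to first order at \<open>x\<close>, the set
  \<open>\<Omega>\<close> is the half-space \<open>{y. (y - x) \<bullet> n > 0}\<close>. For a \<open>C\<^sup>1\<close> boundary this is the classical normal; at a
  boundary point without tangent hyperplane there is no such \<open>n\<close>.\<close>

definition inward_unit_normal :: "'a::euclidean_space set \<Rightarrow> 'a \<Rightarrow> 'a \<Rightarrow> bool" where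
  "inward_unit_normal \<Omega> x n \<longleftrightarrow> norm n = 1 \<and>
     (\<forall>e>0. \<exists>d>0. \<forall>y\<in>ball x d.
        ((y - x) \<bullet> n > e * norm (y - x) \<longrightarrow> y \<in> \<Omega>) \<and>
        ((y - x) \<bullet> n < - (e * norm (y - x)) \<longrightarrow> y \<notin> \<Omega>))"

lemma inward_unit_normal_unique:
  assumes n: "inward_unit_normal \<Omega> x n" and m: "inward_unit_normal \<Omega> x m"
  shows "n = m"
proof (rule ccontr)
  assume "n \<noteq> m"
  define w where "w = n - m"
  have w: "norm w > 0"
    using \<open>n \<noteq> m\<close> by (simp add: w_def)
  have nn: "n \<bullet> n = 1" and mm: "m \<bullet> m = 1"
    using n m by (simp_all add: inward_unit_normal_def dot_square_norm)
  have sq: "(norm w)\<^sup>2 = 2 - 2 * (n \<bullet> m)"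
    unfolding power2_norm_eq_inner w_def
    by (simp add: inner_diff_left inner_diff_right nn mm inner_commute)
  have wn: "w \<bullet> n = (norm w)\<^sup>2 / 2"
    unfolding sq by (simp add: w_def inner_diff_left nn inner_commute[of m n])
  have wm: "w \<bullet> m = - ((norm w)\<^sup>2 / 2)"
    unfolding sq by (simp add: w_def inner_diff_left mm field_simps)
  define e where "e = norm w / 4"
  have e: "e > 0"
    using w by (simp add: e_def)
  obtain d1 where d1: "d1 > 0" "\<And>y. y \<in> ball x d1 \<Longrightarrow> (y - x) \<bullet> n > e * norm (y - x) \<Longrightarrow> y \<in> \<Omega>"
    using n e unfolding inward_unit_normal_def by meson
  obtain d2 where d2: "d2 > 0" "\<And>y. y \<in> ball x d2 \<Longrightarrow> (y - x) \<bullet> m < - (e * norm (y - x)) \<Longrightarrow> y \<notin> \<Omega>"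
    using m e unfolding inward_unit_normal_def by meson
  define s where "s = min d1 d2 / (2 * norm w)"
  have s: "s > 0"
    using d1(1) d2(1) w by (simp add: s_def)
  have sw: "s * norm w = min d1 d2 / 2"
    using w by (simp add: s_def)
  define y where "y = x + s *\<^sub>R w"
  have nrm: "norm (y - x) = s * norm w"
    using s by (simp add: y_def)
  have y1: "y \<in> ball x d1" and y2: "y \<in> ball x d2"
    using nrm sw d1(1) d2(1) by (auto simp: dist_norm norm_minus_commute)
  have pos: "s * (norm w)\<^sup>2 > 0"
    using s w by simp
  have en: "e * norm (y - x) = s * (norm w)\<^sup>2 / 4"
    by (simp add: nrm e_def power2_eq_square)
  have "(y - x) \<bullet> n = s * (norm w)\<^sup>2 / 2"
    by (simp add: y_def wn)
  then have "y \<in> \<Omega>"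
    using d1(2)[OF y1] en pos by linarith
  moreover have "(y - x) \<bullet> m = - (s * (norm w)\<^sup>2 / 2)"
    by (simp add: y_def wm)
  then have "y \<notin> \<Omega>"
    using d2(2)[OF y2] en pos by linarith
  ultimately show False
    by simp
qed

definition Lambda1 :: "'a::euclidean_space set \<Rightarrow> 'a \<Rightarrow> real set" where
  "Lambda1 \<Omega> \<nu> = {\<mu>. a_inf \<Omega> \<nu> < \<mu> \<and> (\<forall>l. a_inf \<Omega> \<nu> < l \<and> l < \<mu> \<longrightarrow>
     (\<nexists>p. p \<notin> hyperplane \<nu> l \<and> internally_tangent_at (reflected_cap \<Omega> \<nu> l) \<Omega> p) \<and>
     (\<forall>x\<in>frontier \<Omega> \<inter> hyperplane \<nu> l. \<exists>n. inward_unit_normal \<Omega> x n \<and> n \<bullet> \<nu> \<noteq> 0))}"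

text \<open>The supremum is taken in the extended reals, so that it is \<open>-\<infinity>\<close>, and not an unspecified real
  number, should the set be empty.\<close>

definition lambda1 :: "'a::euclidean_space set \<Rightarrow> 'a \<Rightarrow> ereal" where
  "lambda1 \<Omega> \<nu> = (SUP \<mu>\<in>Lambda1 \<Omega> \<nu>. ereal \<mu>)"

end

theory Submission
  imports Defs "HOL-Real_Asymp.Real_Asymp"
begin

text \<open>
  The moving plane method needs no small-domain comparison principle here. If \<open>v \<le> v\<^sub>\<lambda>\<close> in a cap, then
  \<open>f(v) \<le> f(v\<^sub>\<lambda>)\<close>, so the weak comparison principle for the \<open>p\<close>-Laplacian gives \<open>u \<le> u\<^sub>\<lambda>\<close>, for every
  \<open>p > 1\<close>; hence \<open>v\<^sub>\<lambda> - v\<close> is superharmonic, and the strong maximum principle and the Hopf lemma give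
  \<open>v < v\<^sub>\<lambda>\<close> in the cap and \<open>\<partial>v/\<partial>\<nu> > 0\<close> on the hyperplane inside the domain. By compactness \<open>v \<le> v\<^sub>\<lambda>\<close>
  then persists for slightly larger \<open>\<lambda>\<close>, so only the semilinear equation has to be controlled near
  the boundary.

  No regularity of the boundary is assumed beyond the interior sphere condition. However, the Hopf
  lemma shows that the gradient of \<open>v\<close> does not vanish on the boundary, and since \<open>v\<close> is positive
  inside and \<open>0\<close> on the boundary, the domain is then locally invariant under translations in the
  directions in which \<open>v\<close> increases. This replaces the smoothness of the boundary throughout.
\<close>

section \<open>Smooth bump functions\<close>

text \<open>Tangency, as used in \<open>Lambda1\<close>, presupposes that the reflected cap lies in
  the domain. That it does lie there has to be proved, by the same continuation as the inequality
  for \<open>v\<close>: take the infimum \<open>b\<close> of the failing levels and a limit point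
  \<open>x\<close> of failing points. If \<open>x\<close> is strictly below the plane at level
  \<open>b\<close>, the relation at \<open>b\<close> holds strictly there. If \<open>x\<close> is on
  that plane, \<open>v\<close> increases near \<open>x\<close> in direction \<nu>, and a point just
  below a nearby plane and its mirror image are the ends of a short segment in that direction. The
  start of the procedure is the case \<open>b = a_inf \<Omega> \<nu>\<close>.

  The test functions in the comparison principle are squares of positive parts, hence only C^1,
  whereas weak solutions are tested with smooth functions; mollification bridges this gap. All
  functions integrated have compact support in the whole space, so integration by parts reduces to
  translation invariance of Lebesgue measure. Caps may be disconnected; strictness in them is
  obtained from a lowest zero.\<close>

lemma C_k_imp_continuous: "C_k k \<phi> \<Longrightarrow> continuous_on UNIV \<phi>"
  by (cases k) (auto simp: differentiable_imp_continuous_on differentiable_on_def)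

lemma C_k_SucD: "C_k (Suc k) \<phi> \<Longrightarrow> C_k k \<phi>"
proof (induction k arbitrary: \<phi>)
  case 0
  then show ?case
    using C_k_imp_continuous[of "Suc 0" \<phi>] by simp
next
  case (Suc k)
  then show ?case by (metis C_k.simps(2))
qed

lemma C_k_SucI:
  assumes "\<And>x. (\<phi> has_derivative \<phi>' x) (at x)"
    and "\<And>i. i \<in> Basis \<Longrightarrow> C_k k (\<lambda>x. \<phi>' x i)"
  shows "C_k (Suc k) \<phi>"
proof -
  have "frechet_derivative \<phi> (at x) = \<phi>' x" for x
    using assms(1) frechet_derivative_at by metis
  then show ?thesis
    using assms by (auto simp: differentiable_def)
qed

lemma C_k_SucE:
  assumes "C_k (Suc k) \<phi>"
  obtains \<phi>' where "\<And>x. (\<phi> has_derivative \<phi>' x) (at x)"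
    "\<And>i. i \<in> Basis \<Longrightarrow> C_k k (\<lambda>x. \<phi>' x i)"
  using assms that[of "\<lambda>x. frechet_derivative \<phi> (at x)"]
  by (auto simp: frechet_derivative_works)

lemma C_k_const: "C_k k (\<lambda>x::'a::euclidean_space. c)"
proof (induction k arbitrary: c)
  case (Suc k)
  show ?case by (rule C_k_SucI[where \<phi>' = "\<lambda>x h. 0"]) (use Suc in auto)
qed auto

lemma C_k_add:
  fixes \<phi> \<psi> :: "'a::euclidean_space \<Rightarrow> real"
  assumes "C_k k \<phi>" "C_k k \<psi>"
  shows "C_k k (\<lambda>x. \<phi> x + \<psi> x)"
  using assms
proof (induction k arbitrary: \<phi> \<psi>)
  case 0
  then show ?case by (auto intro: continuous_intros)
next
  case (Suc k)
  obtain \<phi>' where p: "\<And>x. (\<phi> has_derivative \<phi>' x) (at x)" "\<And>i. i \<in> Basis \<Longrightarrow> C_k k (\<lambda>x. \<phi>' x i)"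
    using Suc.prems(1) by (rule C_k_SucE) (rule that)
  obtain \<psi>' where q: "\<And>x. (\<psi> has_derivative \<psi>' x) (at x)" "\<And>i. i \<in> Basis \<Longrightarrow> C_k k (\<lambda>x. \<psi>' x i)"
    using Suc.prems(2) by (rule C_k_SucE) (rule that)
  show ?case
  proof (rule C_k_SucI)
    show "((\<lambda>x. \<phi> x + \<psi> x) has_derivative (\<lambda>h. \<phi>' x h + \<psi>' x h)) (at x)" for x
      by (intro has_derivative_add p q)
  qed (use p(2) q(2) Suc.IH in blast)
qed

lemma C_k_mult:
  fixes \<phi> \<psi> :: "'a::euclidean_space \<Rightarrow> real"
  assumes "C_k k \<phi>" "C_k k \<psi>"
  shows "C_k k (\<lambda>x. \<phi> x * \<psi> x)"
  using assms
proof (induction k arbitrary: \<phi> \<psi>)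
  case 0
  then show ?case by (auto intro: continuous_intros)
next
  case (Suc k)
  obtain \<phi>' where p: "\<And>x. (\<phi> has_derivative \<phi>' x) (at x)" "\<And>i. i \<in> Basis \<Longrightarrow> C_k k (\<lambda>x. \<phi>' x i)"
    using Suc.prems(1) by (rule C_k_SucE) (rule that)
  obtain \<psi>' where q: "\<And>x. (\<psi> has_derivative \<psi>' x) (at x)" "\<And>i. i \<in> Basis \<Longrightarrow> C_k k (\<lambda>x. \<psi>' x i)"
    using Suc.prems(2) by (rule C_k_SucE) (rule that)
  show ?case
  proof (rule C_k_SucI)
    show "((\<lambda>x. \<phi> x * \<psi> x) has_derivative (\<lambda>h. \<phi> x * \<psi>' x h + \<phi>' x h * \<psi> x)) (at x)" for x
      by (intro has_derivative_mult p q)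
    show "C_k k (\<lambda>x. \<phi> x * \<psi>' x i + \<phi>' x i * \<psi> x)" if "i \<in> Basis" for i
      using p(2) q(2) Suc.IH Suc.prems C_k_SucD that by (intro C_k_add) blast+
  qed
qed

lemma C_k_inner_left: "C_k k (\<lambda>x::'a::euclidean_space. x \<bullet> a)"
proof (cases k)
  case (Suc m)
  show ?thesis unfolding Suc
    by (rule C_k_SucI[where \<phi>' = "\<lambda>x h. h \<bullet> a"]) (auto intro!: derivative_eq_intros C_k_const)
qed (auto intro!: continuous_intros)

lemma C_k_inner_self: "C_k k (\<lambda>x::'a::euclidean_space. x \<bullet> x)"
proof (cases k)
  case (Suc m)
  show ?thesis unfolding Suc
  proof (rule C_k_SucI[where \<phi>' = "\<lambda>x h. 2 * (x \<bullet> h)"])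
    show "((\<lambda>x. x \<bullet> x) has_derivative (\<lambda>h. 2 * (x \<bullet> h))) (at x)" for x :: 'a
      by (auto intro!: derivative_eq_intros simp: inner_commute)
  qed (intro C_k_mult C_k_const C_k_inner_left)
qed (auto intro!: continuous_intros)

text \<open>The factor \<open>1 / t ^ m\<close> makes the family closed under differentiation: the
  derivative of member \<open>m\<close> is a combination of members \<open>m + 1\<close> and
  \<open>m + 2\<close>. Smoothness of all orders then follows by induction over the whole
  family.\<close>

definition flat_exp :: "nat \<Rightarrow> real \<Rightarrow> real" where
  "flat_exp m t = (if 0 < t then exp (- 1 / t) / t ^ m else 0)"

lemma flat_exp_nonneg: "0 \<le> flat_exp m t"
  by (simp add: flat_exp_def)

lemma flat_exp_lim: "((\<lambda>t. exp (- 1 / t) / t ^ m) \<longlongrightarrow> 0) (at_right (0::real))"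
  by real_asymp

lemma DERIV_flat_exp:
  "(flat_exp m has_real_derivative - real m * flat_exp (Suc m) t + flat_exp (Suc (Suc m)) t) (at t)"
proof (cases "t = 0")
  case True
  \<comment> \<open>For \<open>h > 0\<close> the difference quotient at 0 is
    \<open>exp (- 1 / h) / h ^ Suc m\<close>; for \<open>h < 0\<close> it is 0.\<close>
  have "((\<lambda>h. flat_exp m h / h) \<longlongrightarrow> 0) (at_right 0)"
  proof (rule Lim_transform_eventually)
    show "((\<lambda>t. exp (- 1 / t) / t ^ Suc m) \<longlongrightarrow> 0) (at_right (0::real))"
      by (rule flat_exp_lim)
    show "\<forall>\<^sub>F h in at_right 0. exp (- 1 / h) / h ^ Suc m = flat_exp m h / h"
      by (auto simp: eventually_at_filter flat_exp_def)
  qed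
  moreover have "((\<lambda>h. flat_exp m h / h) \<longlongrightarrow> 0) (at_left 0)"
    by (rule Lim_transform_eventually[OF tendsto_const])
      (auto simp: eventually_at_filter flat_exp_def)
  ultimately have "((\<lambda>h. flat_exp m h / h) \<longlongrightarrow> 0) (at 0)"
    by (simp add: filterlim_split_at)
  then show ?thesis
    using True by (simp add: DERIV_def flat_exp_def)
next
  case False
  show ?thesis
  proof (cases "0 < t")
    case True
    have "((\<lambda>t. exp (- 1 / t) / t ^ m) has_real_derivative
        - real m * flat_exp (Suc m) t + flat_exp (Suc (Suc m)) t) (at t)"
    proof -
      have *: "real m * t ^ (m - Suc 0) = real m * t ^ m / t"
        using True by (cases m) auto
      have "((\<lambda>t. exp (- 1 / t) / t ^ m) has_real_derivative
        (exp (- 1 / t) * (1 / t\<^sup>2) * t ^ m - exp (- 1 / t) * (real m * t ^ (m - Suc 0))) / (t ^ m * t ^ m)) (at t)"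
        using True by (auto intro!: derivative_eq_intros simp: power2_eq_square)
      moreover have "(exp (- 1 / t) * (1 / t\<^sup>2) * t ^ m - exp (- 1 / t) * (real m * t ^ (m - Suc 0))) / (t ^ m * t ^ m)
        = - real m * flat_exp (Suc m) t + flat_exp (Suc (Suc m)) t"
        unfolding * using True by (simp add: flat_exp_def field_simps power2_eq_square)
      ultimately show ?thesis by simp
    qed
    then show ?thesis
      by (rule has_field_derivative_transform_within_open[where S = "{0<..}"])
        (use True in \<open>auto simp: flat_exp_def\<close>)
  next
    case neg: False
    have "((\<lambda>t. 0) has_real_derivative 0) (at t)" by simp
    then have "(flat_exp m has_real_derivative 0) (at t)"
      by (rule has_field_derivative_transform_within_open[where S = "{..<0}"])
        (use neg False in \<open>auto simp: flat_exp_def\<close>)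
    then show ?thesis using neg by (simp add: flat_exp_def)
  qed
qed

lemma C_k_flat_exp_compose:
  fixes s :: "'a::euclidean_space \<Rightarrow> real"
  assumes "C_k k s"
  shows "C_k k (\<lambda>x. flat_exp m (s x))"
  using assms
proof (induction k arbitrary: m)
  case 0
  have "continuous_on UNIV (flat_exp m)"
    using DERIV_flat_exp by (meson DERIV_isCont continuous_at_imp_continuous_on)
  then show ?case
    using 0 by (auto intro: continuous_on_compose2)
next
  case (Suc k)
  obtain s' where s': "\<And>x. (s has_derivative s' x) (at x)" "\<And>i. i \<in> Basis \<Longrightarrow> C_k k (\<lambda>x. s' x i)"
    using Suc.prems by (rule C_k_SucE) (rule that)
  have s: "C_k k s" using Suc.prems by (rule C_k_SucD)
  show ?case
  proof (rule C_k_SucI)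
    show "((\<lambda>x. flat_exp m (s x)) has_derivative
      (\<lambda>h. (- real m * flat_exp (Suc m) (s x) + flat_exp (Suc (Suc m)) (s x)) * s' x h)) (at x)" for x
      using has_derivative_compose[OF s'(1) DERIV_flat_exp[unfolded has_field_derivative_def]] by auto
  qed (intro C_k_mult C_k_add C_k_const Suc.IH s s'(2))
qed

section \<open>Calculus with compact supports\<close>

text \<open>The gradient \<open>D\<close> is a parameter, so that integrands refer to it directly.
  Both functions live on the whole space and vanish off a compact subset of \<open>U\<close>, so
  restricting an integral to \<open>U\<close> changes nothing.\<close>

definition C1c :: "'a::euclidean_space set \<Rightarrow> ('a \<Rightarrow> real) \<Rightarrow> ('a \<Rightarrow> 'a) \<Rightarrow> bool" where
  "C1c U \<phi> D \<longleftrightarrow> (\<forall>x. GDERIV \<phi> x :> D x) \<and> continuous_on UNIV D \<and>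
     (\<exists>K. compact K \<and> K \<subseteq> U \<and> (\<forall>x. x \<notin> K \<longrightarrow> \<phi> x = 0))"

lemma GDERIV_imp_continuous: "(\<And>x. x \<in> S \<Longrightarrow> GDERIV \<phi> x :> D x) \<Longrightarrow> continuous_on S \<phi>"
  unfolding gderiv_def by (meson continuous_at_imp_continuous_on has_derivative_continuous)

lemma GDERIV_zero_outside:
  fixes \<phi> :: "'a::euclidean_space \<Rightarrow> real"
  assumes "closed K" "x \<notin> K" "\<forall>x. x \<notin> K \<longrightarrow> \<phi> x = 0" "GDERIV \<phi> x :> d"
  shows "d = 0"
proof -
  have "GDERIV \<phi> x :> 0"
    unfolding gderiv_def inner_zero_right
    by (rule has_derivative_transform_within_open[where f = "\<lambda>x. 0" and s = "- K"]) (use assms in auto)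
  then show ?thesis using assms(4) gradient_eq by metis
qed

lemma C1cE:
  assumes "C1c U \<phi> D"
  obtains K where "compact K" "K \<subseteq> U" "\<And>x. x \<notin> K \<Longrightarrow> \<phi> x = 0" "\<And>x. x \<notin> K \<Longrightarrow> D x = 0"
proof -
  obtain K where K: "compact K" "K \<subseteq> U" "\<forall>x. x \<notin> K \<longrightarrow> \<phi> x = 0"
    using assms unfolding C1c_def by blast
  moreover have "D x = 0" if "x \<notin> K" for x
    using GDERIV_zero_outside[OF compact_imp_closed[OF K(1)] that K(3)] assms unfolding C1c_def by blast
  ultimately show ?thesis using that by blast
qed

lemma C1cD:
  assumes "C1c U \<phi> D"
  shows "GDERIV \<phi> x :> D x" "continuous_on UNIV D" "continuous_on UNIV \<phi>"
  using assms GDERIV_imp_continuous unfolding C1c_def by blast+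

lemma C1c_mono: "C1c U \<phi> D \<Longrightarrow> U \<subseteq> V \<Longrightarrow> C1c V \<phi> D"
  unfolding C1c_def by blast

lemma gderiv_mvt:
  fixes \<phi> :: "'a::euclidean_space \<Rightarrow> real"
  assumes "\<And>s. 0 < s \<Longrightarrow> s < 1 \<Longrightarrow> GDERIV \<phi> (x + s *\<^sub>R h) :> D (x + s *\<^sub>R h)"
    and "continuous_on {0..1} (\<lambda>s. \<phi> (x + s *\<^sub>R h))"
  shows "\<exists>s. 0 < s \<and> s < 1 \<and> \<phi> (x + h) - \<phi> x = h \<bullet> D (x + s *\<^sub>R h)"
proof -
  have der: "((\<lambda>s. \<phi> (x + s *\<^sub>R h)) has_real_derivative h \<bullet> D (x + s *\<^sub>R h)) (at s)" if "0 < s" "s < 1" for s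
  proof -
    have 1: "((\<lambda>s. x + s *\<^sub>R h) has_derivative (\<lambda>s. s *\<^sub>R h)) (at s)"
      by (auto intro!: derivative_eq_intros)
    have "((\<lambda>s. \<phi> (x + s *\<^sub>R h)) has_derivative (\<lambda>t. (t *\<^sub>R h) \<bullet> D (x + s *\<^sub>R h))) (at s)"
      using has_derivative_compose[OF 1 assms(1)[OF that, unfolded gderiv_def]] .
    then show ?thesis
      unfolding has_field_derivative_def
      by (rule has_derivative_eq_rhs) (simp add: fun_eq_iff)
  qed
  then obtain l z where z: "0 < z" "z < 1" "((\<lambda>s. \<phi> (x + s *\<^sub>R h)) has_real_derivative l) (at z)"
      "\<phi> (x + 1 *\<^sub>R h) - \<phi> (x + 0 *\<^sub>R h) = (1 - 0) * l"
    using der MVT[of 0 1 "\<lambda>s. \<phi> (x + s *\<^sub>R h)"] assms(2) by (auto simp: real_differentiable_def)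
  moreover have "l = h \<bullet> D (x + z *\<^sub>R h)"
    using der[OF z(1,2)] z(3) DERIV_unique by blast
  ultimately show ?thesis
    by (intro exI[of _ z]) simp
qed

text \<open>Uniform continuity on compact sets applies to the closed unit neighbourhood
  \<open>L\<close> of \<open>K\<close>; two points at distance less than 1 either both lie in
  \<open>L\<close> or both lie outside \<open>K\<close>, where \<open>f\<close> vanishes.\<close>

lemma uniformly_continuous_compact_support:
  fixes f :: "'a::euclidean_space \<Rightarrow> 'b::real_normed_vector"
  assumes "continuous_on UNIV f" "compact K" "\<And>x. x \<notin> K \<Longrightarrow> f x = 0"
  shows "uniformly_continuous_on UNIV f"
proof -
  define L where "L = (\<lambda>(x,y). x + y) ` (K \<times> cball (0::'a) 1)"
  have "compact L"
    unfolding L_def using assms(2)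
    by (intro compact_continuous_image compact_Times) (auto intro!: continuous_intros simp: case_prod_unfold)
  then have uc: "uniformly_continuous_on L f"
    by (intro compact_uniformly_continuous continuous_on_subset[OF assms(1)]) auto
  have L: "y \<in> L" if "x \<in> K" "dist x y \<le> 1" for x y
  proof -
    have "y = x + (y - x)" "y - x \<in> cball 0 1"
      using that by (auto simp: dist_norm norm_minus_commute)
    then show ?thesis unfolding L_def using that by force
  qed
  show ?thesis
    unfolding uniformly_continuous_on_def
  proof (intro allI impI)
    fix e :: real assume "0 < e"
    obtain d where d: "0 < d" "\<And>x y. x \<in> L \<Longrightarrow> y \<in> L \<Longrightarrow> dist y x < d \<Longrightarrow> dist (f y) (f x) < e"
      using uc \<open>0 < e\<close> unfolding uniformly_continuous_on_def by metis
    show "\<exists>d>0. \<forall>x\<in>UNIV. \<forall>x'\<in>UNIV. dist x' x < d \<longrightarrow> dist (f x') (f x) < e"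
    proof (intro exI[of _ "min d 1"] conjI ballI impI)
      fix x y :: 'a assume xy: "dist y x < min d 1"
      consider "x \<notin> K" "y \<notin> K" | "x \<in> L" "y \<in> L"
        using L[of x y] L[of x x] L[of y x] L[of y y] xy by (auto simp: dist_commute)
      then show "dist (f y) (f x) < e"
        using assms(3) d xy \<open>0 < e\<close> by cases auto
    qed (use d in auto)
  qed
qed

text \<open>The mean value theorem turns the remainder into
  \<open>h \<bullet> (D (x + s *\<^sub>R h) - D x)\<close>. A bound independent of \<open>x\<close>
  is what permits differentiation under the integral sign for translations and convolutions.\<close>

lemma gderiv_uniform:
  fixes \<phi> :: "'a::euclidean_space \<Rightarrow> real"
  assumes "\<And>x. GDERIV \<phi> x :> D x" "uniformly_continuous_on UNIV D" "0 < e"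
  shows "\<exists>d>0. \<forall>x h. norm h < d \<longrightarrow> \<bar>\<phi> (x + h) - \<phi> x - h \<bullet> D x\<bar> \<le> e * norm h"
proof -
  obtain d where d: "0 < d" "\<And>x y. dist y x < d \<Longrightarrow> dist (D y) (D x) < e"
    using assms(2,3) unfolding uniformly_continuous_on_def by (metis UNIV_I)
  have "\<bar>\<phi> (x + h) - \<phi> x - h \<bullet> D x\<bar> \<le> e * norm h" if "norm h < d" for x h
  proof -
    have "continuous_on {0..1} (\<lambda>s. \<phi> (x + s *\<^sub>R h))"
      by (rule continuous_on_compose2[OF GDERIV_imp_continuous[of UNIV \<phi> D, OF assms(1)]])
        (intro continuous_intros, simp)
    then obtain s where s: "0 < s" "s < 1" "\<phi> (x + h) - \<phi> x = h \<bullet> D (x + s *\<^sub>R h)"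
      using gderiv_mvt[of \<phi> x h D, OF assms(1)] by blast
    have "norm (s *\<^sub>R h) < d"
      using s(1,2) that mult_left_le_one_le[of "norm h" s] by auto
    then have "norm (D (x + s *\<^sub>R h) - D x) \<le> e"
      using d(2)[of "x + s *\<^sub>R h" x] by (simp add: dist_norm)
    then have "norm h * norm (D (x + s *\<^sub>R h) - D x) \<le> e * norm h"
      using mult_right_mono[OF _ norm_ge_zero[of h]] by (metis mult.commute)
    moreover have "\<bar>h \<bullet> (D (x + s *\<^sub>R h) - D x)\<bar> \<le> norm h * norm (D (x + s *\<^sub>R h) - D x)"
      by (rule Cauchy_Schwarz_ineq2)
    ultimately show ?thesis
      by (simp add: s(3) inner_diff_right)
  qed
  then show ?thesis using d by blast
qed

lemma integrable_compact_support:
  fixes f :: "'a::euclidean_space \<Rightarrow> 'b::{banach, second_countable_topology}"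
  assumes "compact K" "continuous_on K f" "\<And>x. x \<notin> K \<Longrightarrow> f x = 0"
  shows "integrable lborel f"
proof -
  have "(\<lambda>x. indicator K x *\<^sub>R f x) = f"
    using assms(3) by (auto simp: indicator_def)
  then show ?thesis using borel_integrable_compact[OF assms(1,2)] by simp
qed

lemma integral_shift:
  fixes f :: "'a::euclidean_space \<Rightarrow> 'b::{banach, second_countable_topology}"
  assumes "f \<in> borel_measurable borel"
  shows "(\<integral>x. f (a + x) \<partial>lborel) = (\<integral>x. f x \<partial>lborel)"
proof -
  have "(\<integral>x. f x \<partial>lborel) = (\<integral>x. f x \<partial>distr lborel borel ((+) a))"
    by (simp add: lborel_distr_plus)
  also have "\<dots> = (\<integral>x. f (a + x) \<partial>lborel)"
    using assms by (intro integral_distr) auto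
  finally show ?thesis by simp
qed

lemma integral_reflect:
  fixes f :: "'a::euclidean_space \<Rightarrow> real"
  assumes "f \<in> borel_measurable borel"
  shows "(\<integral>x. f (a - x) \<partial>lborel) = (\<integral>x. f x \<partial>lborel)"
proof -
  have "(lborel :: 'a measure) = distr lborel borel (\<lambda>x. a + (- 1) *\<^sub>R x)"
    using lborel_affine[of "- 1" a] by (simp add: density_1)
  then have "(\<integral>x. f x \<partial>lborel) = (\<integral>x. f x \<partial>distr lborel borel (\<lambda>x. a + (- 1) *\<^sub>R x))"
    by simp
  also have "\<dots> = (\<integral>x. f (a - x) \<partial>lborel)"
    using assms by (subst integral_distr) auto
  finally show ?thesis by simp
qed

lemma compact_plus_cball:
  fixes K :: "'a::euclidean_space set"
  assumes "compact K"
  shows "compact {x + y |x y. x \<in> K \<and> y \<in> cball 0 r}"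
  using compact_sums[OF assms compact_cball[of 0 r]] by (simp add: Bex_def)

lemma integral_gderiv_eq_0:
  fixes \<phi> :: "'a::euclidean_space \<Rightarrow> real"
  assumes "C1c UNIV \<phi> D"
  shows "(\<integral>x. D x \<bullet> a \<partial>lborel) = 0"
  \<comment> \<open>differentiate the translation-invariant quantity \<open>\<integral>\<phi>(x + t a) dx\<close> at \<open>t = 0\<close>\<close>
proof -
  obtain K where K: "compact K" "\<And>x. x \<notin> K \<Longrightarrow> \<phi> x = 0" "\<And>x. x \<notin> K \<Longrightarrow> D x = 0"
    using C1cE[OF assms] by metis
  note \<phi> = C1cD[OF assms]
  \<comment> \<open>\<open>L\<close> contains the supports of all translates with
    \<open>0 \<le> t \<le> 1\<close>, so the error terms are integrated over one set of finite
    measure.\<close>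
  define L where "L = {x + y |x y. x \<in> K \<and> y \<in> cball 0 (norm a)}"
  have L: "compact L" unfolding L_def by (rule compact_plus_cball[OF K(1)])
  have KL: "x \<in> L" if "x + t *\<^sub>R a \<in> K" "0 \<le> t" "t \<le> 1" for x t
  proof -
    have "x = (x + t *\<^sub>R a) + (- t *\<^sub>R a)" "norm (- t *\<^sub>R a) \<le> norm a"
      using that mult_left_le_one_le[of "norm a" t] by auto
    then show ?thesis unfolding L_def using that(1) by (metis (mono_tags, lifting) mem_Collect_eq mem_cball_0)
  qed
  have uc: "uniformly_continuous_on UNIV D"
    using uniformly_continuous_compact_support[OF \<phi>(2) K(1)] K(3) by blast
  have int\<phi>: "integrable lborel (\<lambda>x. \<phi> (x + t *\<^sub>R a))" if "0 \<le> t" "t \<le> 1" for t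
    by (rule integrable_compact_support[OF L])
      (use K KL that in \<open>auto intro!: continuous_on_compose2[OF \<phi>(3)] continuous_intros\<close>)
  have intD: "integrable lborel (\<lambda>x. D x \<bullet> a)"
    by (rule integrable_compact_support[OF K(1)])
      (use K in \<open>auto intro!: continuous_intros continuous_on_subset[OF \<phi>(2)]\<close>)
  define M where "M = measure lborel L * norm a + 1"
  have "M > 0" unfolding M_def by (simp add: add_nonneg_pos)
  have bound: "\<bar>\<integral>x. D x \<bullet> a \<partial>lborel\<bar> \<le> e" if e: "e > 0" for e
  proof -
    obtain d where d: "0 < d" "\<And>x h. norm h < d \<Longrightarrow> \<bar>\<phi> (x + h) - \<phi> x - h \<bullet> D x\<bar> \<le> e / M * norm h"
      using gderiv_uniform[OF \<phi>(1) uc divide_pos_pos[OF e \<open>M > 0\<close>]] by blast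
    define t where "t = min 1 (d / (2 * (norm a + 1)))"
    have na: "norm a + 1 > 0" by (simp add: add_nonneg_pos)
    have t: "0 < t" "t \<le> 1" using d(1) na by (auto simp: t_def)
    have "t * norm a \<le> d / (2 * (norm a + 1)) * norm a"
      by (intro mult_right_mono) (auto simp: t_def)
    also have "\<dots> < d" using d(1) na by (simp add: divide_simps)
    finally have td: "norm (t *\<^sub>R a) < d" using t by simp
    have "t * (\<integral>x. D x \<bullet> a \<partial>lborel) = - (\<integral>x. \<phi> (x + t *\<^sub>R a) - \<phi> x - t *\<^sub>R a \<bullet> D x \<partial>lborel)"
    proof -
      have "(\<integral>x. \<phi> (x + t *\<^sub>R a) \<partial>lborel) = (\<integral>x. \<phi> x \<partial>lborel)"
        using integral_shift[of \<phi> "t *\<^sub>R a"] \<phi>(3) by (simp add: add.commute borel_measurable_continuous_onI)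
      moreover have "integrable lborel (\<lambda>x. t *\<^sub>R a \<bullet> D x)"
        using intD by (simp add: inner_commute)
      ultimately show ?thesis
        using int\<phi>[of t] int\<phi>[of 0] t intD by (simp add: inner_commute)
    qed
    then have "t * \<bar>\<integral>x. D x \<bullet> a \<partial>lborel\<bar> = \<bar>\<integral>x. \<phi> (x + t *\<^sub>R a) - \<phi> x - t *\<^sub>R a \<bullet> D x \<partial>lborel\<bar>"
      using t by (metis abs_minus abs_mult abs_of_pos)
    also have "\<dots> \<le> (\<integral>x. indicator L x * (e / M * norm (t *\<^sub>R a)) \<partial>lborel)"
    proof (rule order_trans[OF integral_abs_bound], rule integral_mono)
      show "integrable lborel (\<lambda>x. indicat_real L x * (e / M * norm (t *\<^sub>R a)))"
        using L by (intro integrable_mult_left integrable_real_indicator)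
          (use L emeasure_bounded_finite[OF compact_imp_bounded[OF L]] in \<open>auto simp: compact_imp_closed less_top\<close>)
      show "integrable lborel (\<lambda>x. \<bar>\<phi> (x + t *\<^sub>R a) - \<phi> x - t *\<^sub>R a \<bullet> D x\<bar>)"
        using int\<phi>[of t] int\<phi>[of 0] t intD by (auto simp: inner_commute intro!: integrable_abs Bochner_Integration.integrable_diff)
      show "\<bar>\<phi> (x + t *\<^sub>R a) - \<phi> x - t *\<^sub>R a \<bullet> D x\<bar> \<le> indicator L x * (e / M * norm (t *\<^sub>R a))" for x
      proof (cases "x \<in> L")
        case True then show ?thesis using d(2)[OF td, of x] by simp
      next
        case False
        then have "x \<notin> K" "x + t *\<^sub>R a \<notin> K" using KL[of x 0] KL[of x t] t by auto
        then show ?thesis using K False by simp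
      qed
    qed
    also have "\<dots> = measure lborel L * (e / M * norm (t *\<^sub>R a))"
      by simp
    also have "\<dots> = t * (e / M * (measure lborel L * norm a))" using t by simp
    also have "\<dots> \<le> t * (e / M * M)"
    proof (rule mult_left_mono[OF mult_left_mono])
      show "measure lborel L * norm a \<le> M" by (simp add: M_def)
    qed (use t e \<open>M > 0\<close> in auto)
    also have "\<dots> = t * e" using \<open>M > 0\<close> by simp
    finally show ?thesis using t(1) by simp
  qed
  show ?thesis
  proof (rule ccontr)
    assume "(\<integral>x. D x \<bullet> a \<partial>lborel) \<noteq> 0"
    then show False using bound[of "\<bar>\<integral>x. D x \<bullet> a \<partial>lborel\<bar> / 2"] by linarith
  qed
qed

text \<open>The integral only forces \<open>f\<close> to vanish almost everywhere. Continuity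
  upgrades this on \<open>U\<close>: the points of \<open>U\<close> with
  \<open>f x \<noteq> 0\<close> form an open null set, hence an empty one.\<close>

lemma continuous_integral_eq_0:
  fixes f :: "'a::euclidean_space \<Rightarrow> real"
  assumes "open U" "continuous_on U f" "integrable lborel f" "\<And>x. 0 \<le> f x" "(\<integral>x. f x \<partial>lborel) \<le> 0" "x \<in> U"
  shows "f x = 0"
proof (rule ccontr)
  assume "f x \<noteq> 0"
  have "(\<integral>x. f x \<partial>lborel) = 0"
    using assms(4,5) by (intro antisym Bochner_Integration.integral_nonneg) auto
  then have "AE x in lborel. f x = 0"
    using integral_nonneg_eq_0_iff_AE[OF assms(3)] assms(4) by simp
  then obtain N where N: "{x. f x \<noteq> 0} \<subseteq> N" "N \<in> null_sets lborel"
    unfolding eventually_ae_filter by auto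
  define V where "V = {y \<in> U. f y \<in> - {0}}"
  have "open V"
    unfolding V_def using continuous_open_preimage[OF assms(2,1) open_Compl[OF closed_singleton[of 0]]]
    by (simp add: vimage_def Int_def)
  moreover have "negligible V"
    using N null_sets_completionI negligible_iff_null_sets negligible_subset[of N V] by (auto simp: V_def)
  moreover have "x \<in> V" using \<open>f x \<noteq> 0\<close> assms(6) by (simp add: V_def)
  ultimately show False using open_not_negligible by blast
qed

section \<open>Mollification\<close>

text \<open>Vector values are allowed so that a function and its gradient are mollified by the same
  operation.\<close>

definition conv :: "('a::euclidean_space \<Rightarrow> real) \<Rightarrow> ('a \<Rightarrow> 'b::euclidean_space) \<Rightarrow> 'a \<Rightarrow> 'b" where
  "conv \<rho> \<phi> x = (\<integral>y. \<rho> (x - y) *\<^sub>R \<phi> y \<partial>lborel)"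

lemma conv_integrable:
  fixes \<rho> :: "'a::euclidean_space \<Rightarrow> real" and \<phi> :: "'a \<Rightarrow> 'b::euclidean_space"
  assumes "continuous_on UNIV \<rho>" "continuous_on UNIV \<phi>" "compact L" "\<And>x. x \<notin> L \<Longrightarrow> \<phi> x = 0"
  shows "integrable lborel (\<lambda>y. \<rho> (x - y) *\<^sub>R \<phi> y)"
  using assms
  by (intro integrable_compact_support[of L])
    (auto intro!: continuous_intros continuous_on_compose2[of UNIV \<rho>] intro: continuous_on_subset)

text \<open>The derivative falls on the kernel: the uniform first-order expansion of
  \<open>\<rho>\<close>, integrated against \<open>\<phi>\<close>, leaves an error of at most
  \<open>e / (M + 1) * norm (z - x)\<close> times the integral \<open>M\<close> of the absolute
  value of \<open>\<phi>\<close>.\<close>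

lemma GDERIV_conv:
  fixes \<rho> \<phi> :: "'a::euclidean_space \<Rightarrow> real"
  assumes \<rho>: "C1c UNIV \<rho> D"
    and \<phi>: "continuous_on UNIV \<phi>" "compact L" "\<And>x. x \<notin> L \<Longrightarrow> \<phi> x = 0"
  shows "GDERIV (conv \<rho> \<phi>) x :> (\<integral>y. \<phi> y *\<^sub>R D (x - y) \<partial>lborel)"
  unfolding gderiv_def has_derivative_at_alt
proof (intro conjI allI impI)
  note rho = C1cD[OF \<rho>]
  have uc: "uniformly_continuous_on UNIV D"
    using uniformly_continuous_compact_support[OF rho(2)] C1cE[OF \<rho>] by metis
  have intD: "integrable lborel (\<lambda>y. \<phi> y *\<^sub>R D (x - y))" for x
    by (rule integrable_compact_support[OF \<phi>(2)])
      (auto simp: \<phi>(3) intro!: continuous_intros continuous_on_subset[OF \<phi>(1)] continuous_on_compose2[OF rho(2)])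
  have int\<rho>: "integrable lborel (\<lambda>y. \<rho> (x - y) * \<phi> y)" for x
    using conv_integrable[OF rho(3) \<phi>] by simp
  have int\<phi>: "integrable lborel (\<lambda>y. c * \<bar>\<phi> y\<bar>)" for c
    by (rule integrable_compact_support[OF \<phi>(2)])
      (auto simp: \<phi>(3) intro!: continuous_intros continuous_on_subset[OF \<phi>(1)])
  show "bounded_linear (\<lambda>h. h \<bullet> (\<integral>y. \<phi> y *\<^sub>R D (x - y) \<partial>lborel))"
    by (rule bounded_linear_inner_left)
  fix e :: real assume "0 < e"
  define M where "M = (\<integral>y. \<bar>\<phi> y\<bar> \<partial>lborel)"
  have "M \<ge> 0" unfolding M_def by (rule Bochner_Integration.integral_nonneg) auto
  then have "e / (M + 1) > 0" using \<open>0 < e\<close> by simp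
  from gderiv_uniform[OF rho(1) uc this]
  obtain d where d: "0 < d" "\<And>x h. norm h < d \<Longrightarrow> \<bar>\<rho> (x + h) - \<rho> x - h \<bullet> D x\<bar> \<le> e / (M + 1) * norm h"
    by blast
  show "\<exists>d>0. \<forall>y. norm (y - x) < d \<longrightarrow> norm (conv \<rho> \<phi> y - conv \<rho> \<phi> x
      - (y - x) \<bullet> (\<integral>y. \<phi> y *\<^sub>R D (x - y) \<partial>lborel)) \<le> e * norm (y - x)"
  proof (intro exI[of _ d] conjI allI impI d(1))
    fix z assume z: "norm (z - x) < d"
    have "conv \<rho> \<phi> z - conv \<rho> \<phi> x - (z - x) \<bullet> (\<integral>y. \<phi> y *\<^sub>R D (x - y) \<partial>lborel)
      = (\<integral>y. \<rho> (z - y) * \<phi> y \<partial>lborel) - (\<integral>y. \<rho> (x - y) * \<phi> y \<partial>lborel) - (\<integral>y. (z - x) \<bullet> (\<phi> y *\<^sub>R D (x - y)) \<partial>lborel)"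
      unfolding conv_def using intD by (subst integral_inner_right) auto
    also have "\<dots> = (\<integral>y. \<rho> (z - y) * \<phi> y - \<rho> (x - y) * \<phi> y - (z - x) \<bullet> (\<phi> y *\<^sub>R D (x - y)) \<partial>lborel)"
      using int\<rho> integrable_inner_right[OF intD] by (simp del: inner_scaleR_right)
    finally have eq: "conv \<rho> \<phi> z - conv \<rho> \<phi> x - (z - x) \<bullet> (\<integral>y. \<phi> y *\<^sub>R D (x - y) \<partial>lborel)
      = (\<integral>y. \<rho> (z - y) * \<phi> y - \<rho> (x - y) * \<phi> y - (z - x) \<bullet> (\<phi> y *\<^sub>R D (x - y)) \<partial>lborel)" .
    have "norm (\<integral>y. \<rho> (z - y) * \<phi> y - \<rho> (x - y) * \<phi> y - (z - x) \<bullet> (\<phi> y *\<^sub>R D (x - y)) \<partial>lborel)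
      \<le> (\<integral>y. (e / (M + 1) * norm (z - x)) * \<bar>\<phi> y\<bar> \<partial>lborel)"
    proof (rule Bochner_Integration.integral_norm_bound_integral)
      show "integrable lborel (\<lambda>y. \<rho> (z - y) * \<phi> y - \<rho> (x - y) * \<phi> y - (z - x) \<bullet> (\<phi> y *\<^sub>R D (x - y)))"
        using int\<rho> integrable_inner_right[OF intD] by (simp del: inner_scaleR_right)
      show "norm (\<rho> (z - y) * \<phi> y - \<rho> (x - y) * \<phi> y - (z - x) \<bullet> (\<phi> y *\<^sub>R D (x - y)))
          \<le> (e / (M + 1) * norm (z - x)) * \<bar>\<phi> y\<bar>" for y
      proof -
        have "\<rho> (z - y) * \<phi> y - \<rho> (x - y) * \<phi> y - (z - x) \<bullet> (\<phi> y *\<^sub>R D (x - y))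
          = (\<rho> ((x - y) + (z - x)) - \<rho> (x - y) - (z - x) \<bullet> D (x - y)) * \<phi> y"
          by (simp add: algebra_simps)
        then show ?thesis
          using mult_right_mono[OF d(2)[OF z, of "x - y"] abs_ge_zero[of "\<phi> y"]] by (simp add: abs_mult)
      qed
    qed (rule int\<phi>)
    also have "\<dots> = (e / (M + 1) * norm (z - x)) * M" by (simp add: M_def)
    also have "\<dots> = e * norm (z - x) * (M / (M + 1))" by simp
    also have "\<dots> \<le> e * norm (z - x) * 1"
      using \<open>0 < e\<close> \<open>M \<ge> 0\<close> by (intro mult_left_mono) auto
    finally show "norm (conv \<rho> \<phi> z - conv \<rho> \<phi> x - (z - x) \<bullet> (\<integral>y. \<phi> y *\<^sub>R D (x - y) \<partial>lborel)) \<le> e * norm (z - x)"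
      by (simp add: eq)
  qed
qed

lemma C_k_imp_C1c:
  fixes \<rho> :: "'a::euclidean_space \<Rightarrow> real"
  assumes "C_k (Suc 0) \<rho>" "compact K" "\<And>x. x \<notin> K \<Longrightarrow> \<rho> x = 0"
  defines "D \<equiv> \<lambda>x. \<Sum>i\<in>Basis. frechet_derivative \<rho> (at x) i *\<^sub>R i"
  shows "C1c UNIV \<rho> D" "\<And>x. x \<notin> K \<Longrightarrow> D x = 0"
proof -
  have der: "GDERIV \<rho> x :> D x" for x
  proof -
    have *: "(\<rho> has_derivative frechet_derivative \<rho> (at x)) (at x)"
      using assms(1) by (simp add: frechet_derivative_works)
    then interpret bounded_linear "frechet_derivative \<rho> (at x)" by (rule has_derivative_bounded_linear)
    have "frechet_derivative \<rho> (at x) h = h \<bullet> D x" for h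
    proof -
      have "frechet_derivative \<rho> (at x) h = frechet_derivative \<rho> (at x) (\<Sum>i\<in>Basis. (h \<bullet> i) *\<^sub>R i)"
        by (simp add: euclidean_representation)
      also have "\<dots> = h \<bullet> D x" unfolding D_def
        by (simp add: sum scaleR inner_sum_right mult.commute)
      finally show ?thesis .
    qed
    then have "frechet_derivative \<rho> (at x) = (\<lambda>h. h \<bullet> D x)" by (rule ext)
    with * show ?thesis by (simp add: gderiv_def)
  qed
  have "continuous_on UNIV D"
    unfolding D_def using assms(1) by (auto intro!: continuous_intros)
  with der assms(2,3) show "C1c UNIV \<rho> D" unfolding C1c_def by auto
  show "D x = 0" if "x \<notin> K" for x
    using GDERIV_zero_outside[OF compact_imp_closed[OF assms(2)] that _ der] assms(3) by blast
qed

text \<open>Each partial derivative of the convolution is again a convolution, with the partial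
  derivative of the kernel; hence the induction varies \<open>\<rho>\<close> and keeps
  \<open>\<phi>\<close>.\<close>

lemma C_k_conv:
  fixes \<rho> \<phi> :: "'a::euclidean_space \<Rightarrow> real"
  assumes "\<And>k. C_k k \<rho>" "compact K" "\<And>x. x \<notin> K \<Longrightarrow> \<rho> x = 0"
    and \<phi>: "continuous_on UNIV \<phi>" "compact L" "\<And>x. x \<notin> L \<Longrightarrow> \<phi> x = 0"
  shows "C_k k (conv \<rho> \<phi>)"
  using assms(1-3)
proof (induction k arbitrary: \<rho>)
  case 0
  show ?case
    using GDERIV_imp_continuous[of UNIV "conv \<rho> \<phi>", OF GDERIV_conv[OF C_k_imp_C1c(1)[OF 0] \<phi>]] by simp
next
  case (Suc k)
  define D where "D = (\<lambda>x. \<Sum>i\<in>Basis. frechet_derivative \<rho> (at x) i *\<^sub>R i)"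
  have D: "C1c UNIV \<rho> D" "\<And>x. x \<notin> K \<Longrightarrow> D x = 0"
    unfolding D_def using C_k_imp_C1c[OF Suc.prems] by auto
  have Di: "i \<bullet> D x = frechet_derivative \<rho> (at x) i" if "i \<in> Basis" for i x
    using that by (simp add: D_def inner_sum_right inner_Basis if_distrib cong: if_cong)
  have intD: "integrable lborel (\<lambda>y. \<phi> y *\<^sub>R D (x - y))" for x
    by (rule integrable_compact_support[OF \<phi>(2)])
      (auto simp: \<phi>(3) intro!: continuous_intros continuous_on_subset[OF \<phi>(1)] continuous_on_compose2[OF C1cD(2)[OF D(1)]])
  show ?case
  proof (rule C_k_SucI)
    show "(conv \<rho> \<phi> has_derivative (\<lambda>h. h \<bullet> (\<integral>y. \<phi> y *\<^sub>R D (x - y) \<partial>lborel))) (at x)" for x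
      using GDERIV_conv[OF D(1) \<phi>] by (simp add: gderiv_def)
    fix i :: 'a assume i: "i \<in> Basis"
    have "(\<lambda>x. i \<bullet> (\<integral>y. \<phi> y *\<^sub>R D (x - y) \<partial>lborel)) = conv (\<lambda>z. frechet_derivative \<rho> (at z) i) \<phi>"
    proof
      fix x
      have "i \<bullet> (\<integral>y. \<phi> y *\<^sub>R D (x - y) \<partial>lborel) = (\<integral>y. i \<bullet> (\<phi> y *\<^sub>R D (x - y)) \<partial>lborel)"
        using intD by (subst integral_inner_right) auto
      then show "i \<bullet> (\<integral>y. \<phi> y *\<^sub>R D (x - y) \<partial>lborel) = conv (\<lambda>z. frechet_derivative \<rho> (at z) i) \<phi> x"
        using Di[OF i] by (simp add: conv_def mult.commute)
    qed
    moreover have "C_k k (conv (\<lambda>z. frechet_derivative \<rho> (at z) i) \<phi>)"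
    proof (rule Suc.IH[OF _ Suc.prems(2)])
      show "C_k k (\<lambda>z. frechet_derivative \<rho> (at z) i)" for k
        using Suc.prems(1)[of "Suc k"] i by simp
      show "frechet_derivative \<rho> (at x) i = 0" if "x \<notin> K" for x
        using D(2)[OF that] Di[OF i, of x] by simp
    qed
    ultimately show "C_k k (\<lambda>x. i \<bullet> (\<integral>y. \<phi> y *\<^sub>R D (x - y) \<partial>lborel))" by simp
  qed
qed

text \<open>The product \<open>\<rho> (x - y) * \<phi> y\<close> has compact support as a function
  of \<open>y\<close>, so its gradient integrates to 0; the sign from the inner function
  \<open>x - y\<close> makes the two terms equal. Hence the gradient of a mollified function is the
  mollified gradient.\<close>

lemma conv_gradient_commute:
  fixes \<rho> \<phi> :: "'a::euclidean_space \<Rightarrow> real"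
  assumes \<rho>: "C1c UNIV \<rho> D" and \<phi>: "C1c UNIV \<phi> E"
  shows "(\<integral>y. \<phi> y *\<^sub>R D (x - y) \<partial>lborel) = conv \<rho> E x"
proof -
  note r = C1cD[OF \<rho>] and f = C1cD[OF \<phi>]
  obtain L where L: "compact L" "\<And>x. x \<notin> L \<Longrightarrow> \<phi> x = 0" "\<And>x. x \<notin> L \<Longrightarrow> E x = 0"
    using C1cE[OF \<phi>] by metis
  have intD: "integrable lborel (\<lambda>y. \<phi> y *\<^sub>R D (x - y))"
    by (rule integrable_compact_support[OF L(1)])
      (auto simp: L intro!: continuous_intros continuous_on_subset[OF f(3)] continuous_on_compose2[OF r(2)])
  have intE: "integrable lborel (\<lambda>y. \<rho> (x - y) *\<^sub>R E y)"
    by (rule conv_integrable[OF r(3) f(2) L(1,3)])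
  have "C1c UNIV (\<lambda>y. \<rho> (x - y) * \<phi> y) (\<lambda>y. \<rho> (x - y) *\<^sub>R E y + \<phi> y *\<^sub>R - D (x - y))"
    unfolding C1c_def
  proof (intro conjI allI)
    show "GDERIV (\<lambda>y. \<rho> (x - y) * \<phi> y) y :> \<rho> (x - y) *\<^sub>R E y + \<phi> y *\<^sub>R - D (x - y)" for y
    proof (rule GDERIV_mult[OF _ f(1)])
      have "((\<lambda>y. x - y) has_derivative (\<lambda>h. - h)) (at y)"
        by (auto intro!: derivative_eq_intros)
      from has_derivative_compose[OF this r(1)[unfolded gderiv_def]]
      show "GDERIV (\<lambda>y. \<rho> (x - y)) y :> - D (x - y)" by (simp add: gderiv_def)
    qed
    show "continuous_on UNIV (\<lambda>y. \<rho> (x - y) *\<^sub>R E y + \<phi> y *\<^sub>R - D (x - y))"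
      by (intro continuous_intros continuous_on_compose2[OF r(3)] continuous_on_compose2[OF r(2)] f) auto
    show "\<exists>K. compact K \<and> K \<subseteq> UNIV \<and> (\<forall>y. y \<notin> K \<longrightarrow> \<rho> (x - y) * \<phi> y = 0)"
      using L by auto
  qed
  from integral_gderiv_eq_0[OF this]
  have "(\<integral>y. (\<rho> (x - y) *\<^sub>R E y + \<phi> y *\<^sub>R - D (x - y)) \<partial>lborel) \<bullet> a = 0" for a
    using intD intE by (subst (asm) integral_inner_left) auto
  then have "(\<integral>y. (\<rho> (x - y) *\<^sub>R E y - \<phi> y *\<^sub>R D (x - y)) \<partial>lborel) = 0"
    by (metis (no_types, lifting) inner_eq_zero_iff scaleR_minus_right add_uminus_conv_diff Bochner_Integration.integral_cong)
  then show ?thesis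
    using intD intE by (simp add: conv_def)
qed

lemma mollifier_exists:
  assumes "0 < (d::real)"
  shows "\<exists>\<rho>::'a::euclidean_space \<Rightarrow> real. (\<forall>k. C_k k \<rho>) \<and> (\<forall>x. 0 \<le> \<rho> x) \<and> (\<forall>x. d < norm x \<longrightarrow> \<rho> x = 0) \<and> integral\<^sup>L lborel \<rho> = 1"
proof -
  define \<rho> where "\<rho> = (\<lambda>x::'a. flat_exp 0 (d\<^sup>2 + (- 1) * (x \<bullet> x)))"
  have C: "C_k k \<rho>" for k
    unfolding \<rho>_def by (intro C_k_flat_exp_compose C_k_add C_k_mult C_k_const C_k_inner_self)
  have z: "\<rho> x = 0" if "d < norm x" for x
  proof -
    have "d\<^sup>2 < (norm x)\<^sup>2" using that assms by (intro power_strict_mono) auto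
    then show ?thesis by (simp add: \<rho>_def flat_exp_def power2_norm_eq_inner)
  qed
  have n: "0 \<le> \<rho> x" for x by (simp add: \<rho>_def flat_exp_nonneg)
  have "integrable lborel \<rho>"
    by (rule integrable_compact_support[of "cball 0 d"])
      (use C_k_imp_continuous[OF C] z in \<open>auto intro: continuous_on_subset\<close>)
  then have "\<rho> 0 = 0" if "integral\<^sup>L lborel \<rho> \<le> 0"
    using continuous_integral_eq_0[of UNIV \<rho> 0] C_k_imp_continuous[OF C] n that by auto
  moreover have "\<rho> 0 > 0" using assms by (simp add: \<rho>_def flat_exp_def)
  ultimately have pos: "integral\<^sup>L lborel \<rho> > 0" by force
  show ?thesis
    by (rule exI[of _ "\<lambda>x. inverse (integral\<^sup>L lborel \<rho>) * \<rho> x"])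
      (use pos n z C_k_mult[OF C_k_const C] in auto)
qed

text \<open>The difference is an average of \<open>\<phi> y - \<phi> x\<close> over points
  \<open>y\<close> within \<open>d\<close> of \<open>x\<close>, with weights of total mass
  1.\<close>

lemma conv_mollifier_close:
  fixes \<rho> :: "'a::euclidean_space \<Rightarrow> real" and \<phi> :: "'a \<Rightarrow> 'b::euclidean_space"
  assumes "continuous_on UNIV \<rho>" "\<And>x. 0 \<le> \<rho> x" "\<And>x. d < norm x \<Longrightarrow> \<rho> x = 0" "integral\<^sup>L lborel \<rho> = 1"
    and "continuous_on UNIV \<phi>" "compact L" "\<And>x. x \<notin> L \<Longrightarrow> \<phi> x = 0"
    and "\<And>y. norm (x - y) \<le> d \<Longrightarrow> norm (\<phi> y - \<phi> x) \<le> e"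
  shows "norm (conv \<rho> \<phi> x - \<phi> x) \<le> e"
proof -
  have int\<rho>: "integrable lborel (\<lambda>y. \<rho> (x - y))"
    by (rule integrable_compact_support[of "cball x d"])
      (use assms(1,3) in \<open>auto simp: dist_norm intro!: continuous_on_compose2[of UNIV \<rho>] continuous_intros\<close>)
  have 1: "(\<integral>y. \<rho> (x - y) \<partial>lborel) = 1"
    using integral_reflect[of \<rho> x] assms(1,4) by (simp add: borel_measurable_continuous_onI)
  have int: "integrable lborel (\<lambda>y. \<rho> (x - y) *\<^sub>R \<phi> y)"
    by (rule conv_integrable[OF assms(1,5-7)])
  have "conv \<rho> \<phi> x - \<phi> x = (\<integral>y. \<rho> (x - y) *\<^sub>R \<phi> y \<partial>lborel) - (\<integral>y. \<rho> (x - y) *\<^sub>R \<phi> x \<partial>lborel)"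
    using int\<rho> 1 by (simp add: conv_def)
  also have "\<dots> = (\<integral>y. \<rho> (x - y) *\<^sub>R \<phi> y - \<rho> (x - y) *\<^sub>R \<phi> x \<partial>lborel)"
    using int int\<rho> by simp
  also have "norm \<dots> \<le> (\<integral>y. \<rho> (x - y) * e \<partial>lborel)"
  proof (rule Bochner_Integration.integral_norm_bound_integral)
    show "norm (\<rho> (x - y) *\<^sub>R \<phi> y - \<rho> (x - y) *\<^sub>R \<phi> x) \<le> \<rho> (x - y) * e" for y
    proof (cases "norm (x - y) \<le> d")
      case True
      then show ?thesis
        using mult_left_mono[OF assms(8)[OF True] assms(2)[of "x - y"]] assms(2)[of "x - y"]
        by (simp add: scaleR_diff_right[symmetric])
    next
      case False
      then show ?thesis using assms(3)[of "x - y"] by simp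
    qed
  qed (use int int\<rho> in auto)
  also have "\<dots> = e" using 1 by simp
  finally show ?thesis .
qed

section \<open>Weak formulations\<close>

lemma set_plus_cball_subset:
  fixes K :: "'a::euclidean_space set"
  assumes "(\<Union>x\<in>K. cball x e) \<subseteq> U"
  shows "{x + y |x y. x \<in> K \<and> y \<in> cball 0 e} \<subseteq> U"
proof -
  have "x + y \<in> cball x e" if "y \<in> cball 0 e" for x y :: 'a
    using that by (simp add: dist_norm)
  then show ?thesis using assms by blast
qed

text \<open>\<open>K\<close> is chosen before \<open>e\<close>: one compact neighbourhood of the
  support holds all approximants. The error in a weak formulation is then at most \<open>e\<close>
  times a constant independent of the approximant.\<close>

lemma C1c_test_function_approx:
  fixes U :: "'a::euclidean_space set"
  assumes U: "open U" and \<phi>: "C1c U \<phi> D"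
  shows "\<exists>K. compact K \<and> K \<subseteq> U \<and> (\<forall>x. x \<notin> K \<longrightarrow> \<phi> x = 0) \<and> (\<forall>e>0. \<exists>\<psi> E. \<psi> \<in> test_functions U \<and> C1c K \<psi> E \<and>
      (\<forall>x. \<bar>\<psi> x - \<phi> x\<bar> \<le> e) \<and> (\<forall>x. norm (E x - D x) \<le> e))"
proof -
  note f = C1cD[OF \<phi>]
  obtain K where K: "compact K" "K \<subseteq> U" "\<And>x. x \<notin> K \<Longrightarrow> \<phi> x = 0" "\<And>x. x \<notin> K \<Longrightarrow> D x = 0"
    using C1cE[OF \<phi>] by metis
  obtain r where r: "0 < r" "(\<Union>x\<in>K. cball x r) \<subseteq> U"
    using compact_subset_open_imp_cball_epsilon_subset[OF K(1) U K(2)] by metis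
  define L where "L = {x + y |x y. x \<in> K \<and> y \<in> cball 0 r}"
  have L: "compact L" "L \<subseteq> U"
    unfolding L_def using compact_plus_cball[OF K(1)] set_plus_cball_subset[OF r(2)] by auto
  have "x \<in> L" if "x \<in> K" for x
    unfolding L_def using that r(1) by (intro CollectI exI[of _ x] exI[of _ 0]) auto
  then have KL: "K \<subseteq> L" by blast
  have "\<exists>\<psi> E. \<psi> \<in> test_functions U \<and> C1c L \<psi> E \<and>
      (\<forall>x. \<bar>\<psi> x - \<phi> x\<bar> \<le> e) \<and> (\<forall>x. norm (E x - D x) \<le> e)" if e: "0 < e" for e
  proof -
    have "uniformly_continuous_on UNIV \<phi>" "uniformly_continuous_on UNIV D"
      using uniformly_continuous_compact_support[OF f(3) K(1)] uniformly_continuous_compact_support[OF f(2) K(1)] K by blast+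
    then obtain d1 d2 where d: "0 < d1" "0 < d2" "\<And>x y. dist x y < d1 \<Longrightarrow> dist (\<phi> x) (\<phi> y) < e"
        "\<And>x y. dist x y < d2 \<Longrightarrow> dist (D x) (D y) < e"
      using e unfolding uniformly_continuous_on_def by (metis UNIV_I)
    \<comment> \<open>\<open>\<delta> \<le> r\<close> keeps the mollified function supported in
      \<open>L\<close>; staying below \<open>d1\<close> and \<open>d2\<close> gives the two uniform
      error bounds.\<close>
    define \<delta> where "\<delta> = min r (min d1 d2 / 2)"
    have \<delta>: "0 < \<delta>" "\<delta> \<le> r" "\<delta> < d1" "\<delta> < d2" using d(1,2) r(1) by (auto simp: \<delta>_def)
    obtain \<rho> :: "'a \<Rightarrow> real" where \<rho>: "\<And>k. C_k k \<rho>" "\<And>x. 0 \<le> \<rho> x" "\<And>x. \<delta> < norm x \<Longrightarrow> \<rho> x = 0" "integral\<^sup>L lborel \<rho> = 1"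
      using mollifier_exists[OF \<delta>(1)] by blast
    have \<rho>0: "\<rho> x = 0" if "x \<notin> cball 0 \<delta>" for x using that \<rho>(3) by auto
    define R where "R = (\<lambda>x. \<Sum>i\<in>Basis. frechet_derivative \<rho> (at x) i *\<^sub>R i)"
    have R: "C1c UNIV \<rho> R"
      unfolding R_def using C_k_imp_C1c(1)[OF \<rho>(1) compact_cball \<rho>0] .
    have supp: "conv \<rho> \<phi> x = 0" if "x \<notin> L" for x
    proof -
      have "\<rho> (x - y) *\<^sub>R \<phi> y = 0" for y
      proof (cases "y \<in> K")
        case True
        have "x - y \<notin> cball 0 r"
        proof
          assume "x - y \<in> cball 0 r"
          with True have "y + (x - y) \<in> L" unfolding L_def by blast
          with that show False by simp
        qed
        then show ?thesis using \<rho>(3) \<delta>(2) by simp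
      qed (use K in auto)
      then have "(\<lambda>y. \<rho> (x - y) *\<^sub>R \<phi> y) = (\<lambda>y. 0)" by (rule ext)
      then show ?thesis unfolding conv_def by (simp only: integral_zero)
    qed
    have der: "GDERIV (conv \<rho> \<phi>) x :> conv \<rho> D x" for x
      using GDERIV_conv[OF R f(3) K(1,3)] conv_gradient_commute[OF R C1c_mono[OF \<phi> subset_UNIV]] by simp
    have Ck: "C_k k (conv \<rho> \<phi>)" for k
      by (rule C_k_conv[OF \<rho>(1) compact_cball \<rho>0 f(3) K(1,3)])
    have "C1c L (conv \<rho> \<phi>) (conv \<rho> D)"
      unfolding C1c_def
    proof (intro conjI allI der)
      define D' where "D' = (\<lambda>x. \<Sum>i\<in>Basis. frechet_derivative (conv \<rho> \<phi>) (at x) i *\<^sub>R i)"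
      have "C1c UNIV (conv \<rho> \<phi>) D'"
        unfolding D'_def using C_k_imp_C1c(1)[OF Ck L(1) supp] .
      moreover have "D' = conv \<rho> D"
        using C1cD(1)[OF calculation] der gradient_eq by (metis ext)
      ultimately show "continuous_on UNIV (conv \<rho> D)" using C1cD(2) by metis
    qed (use L supp in blast)
    moreover have "conv \<rho> \<phi> \<in> test_functions U"
    proof -
      have "closure {x. conv \<rho> \<phi> x \<noteq> 0} \<subseteq> L"
        using supp by (intro closure_minimal compact_imp_closed L(1)) auto
      moreover from this have "compact (closure {x. conv \<rho> \<phi> x \<noteq> 0})"
        using L(1) by (metis closed_closure compact_Int_closed inf.absorb2)
      ultimately show ?thesis unfolding test_functions_def using Ck L(2) by blast
    qed
    moreover have "norm (conv \<rho> \<phi> x - \<phi> x) \<le> e" for x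
    proof (rule conv_mollifier_close[OF C_k_imp_continuous[OF \<rho>(1)] \<rho>(2-4) f(3) K(1,3)])
      show "norm (\<phi> y - \<phi> x) \<le> e" if "norm (x - y) \<le> \<delta>" for y
        using d(3)[of y x] that \<delta> by (simp add: dist_norm norm_minus_commute)
    qed
    moreover have "norm (conv \<rho> D x - D x) \<le> e" for x
    proof (rule conv_mollifier_close[OF C_k_imp_continuous[OF \<rho>(1)] \<rho>(2-4) f(2) K(1,4)])
      show "norm (D y - D x) \<le> e" if "norm (x - y) \<le> \<delta>" for y
        using d(4)[of y x] that \<delta> by (simp add: dist_norm norm_minus_commute)
    qed
    ultimately show ?thesis by auto
  qed
  moreover have "\<phi> x = 0" if "x \<notin> L" for x using that KL K(3) by blast
  ultimately show ?thesis using L by (intro exI[of _ L] conjI allI impI)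
qed

lemma integrable_C1c:
  assumes "C1c U \<phi> D"
  shows "continuous_on U F \<Longrightarrow> integrable lborel (\<lambda>x. F x \<bullet> D x)"
    and "continuous_on U h \<Longrightarrow> integrable lborel (\<lambda>x. h x * \<phi> x)"
proof -
  obtain K where K: "compact K" "K \<subseteq> U" "\<And>x. x \<notin> K \<Longrightarrow> \<phi> x = 0" "\<And>x. x \<notin> K \<Longrightarrow> D x = 0"
    using C1cE[OF assms] by metis
  note f = C1cD[OF assms]
  show "integrable lborel (\<lambda>x. F x \<bullet> D x)" if "continuous_on U F"
    by (rule integrable_compact_support[OF K(1)])
      (use K that in \<open>auto intro!: continuous_intros continuous_on_subset[OF f(2)] intro: continuous_on_subset[of U F]\<close>)
  show "integrable lborel (\<lambda>x. h x * \<phi> x)" if "continuous_on U h"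
    by (rule integrable_compact_support[OF K(1)])
      (use K that in \<open>auto intro!: continuous_intros continuous_on_subset[OF f(3)] intro: continuous_on_subset[of U h]\<close>)
qed

text \<open>A density argument: smooth approximants satisfy the identity, and the error is at most
  \<open>e * N\<close>, with \<open>N\<close> the integral of
  \<open>norm (F x) + \<bar>h x\<bar>\<close> over the fixed compact set \<open>K\<close>. The field
  \<open>F\<close> is arbitrary, which covers the linear and the nonlinear flux alike.\<close>

lemma weak_form_C1c:
  fixes U :: "'a::euclidean_space set"
  assumes U: "open U" and F: "continuous_on U F" and h: "continuous_on U h"
    and weak: "\<And>\<psi>. \<psi> \<in> test_functions U \<Longrightarrow>
      (LINT x:U|lborel. F x \<bullet> gradient \<psi> x) = (LINT x:U|lborel. h x * \<psi> x)"
    and \<phi>: "C1c U \<phi> D"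
  shows "(\<integral>x. F x \<bullet> D x \<partial>lborel) = (\<integral>x. h x * \<phi> x \<partial>lborel)"
proof -
  obtain K where K: "compact K" "K \<subseteq> U" "\<And>x. x \<notin> K \<Longrightarrow> \<phi> x = 0"
    and approx: "\<And>e. e > 0 \<Longrightarrow> \<exists>\<psi> E. \<psi> \<in> test_functions U \<and> C1c K \<psi> E \<and>
      (\<forall>x. \<bar>\<psi> x - \<phi> x\<bar> \<le> e) \<and> (\<forall>x. norm (E x - D x) \<le> e)"
    using C1c_test_function_approx[OF U \<phi>] by metis
  have D0: "D x = 0" if "x \<notin> K" for x
    using GDERIV_zero_outside[OF compact_imp_closed[OF K(1)] that _ C1cD(1)[OF \<phi>]] K(3) by blast
  define N where "N = (\<integral>x. indicator K x *\<^sub>R (norm (F x) + \<bar>h x\<bar>) \<partial>lborel)"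
  have intN: "integrable lborel (\<lambda>x. indicator K x *\<^sub>R (norm (F x) + \<bar>h x\<bar>))"
    by (intro borel_integrable_compact K(1) continuous_intros continuous_on_subset[OF F] continuous_on_subset[OF h] K(2))
  have N: "N \<ge> 0" unfolding N_def by (intro Bochner_Integration.integral_nonneg) auto
  let ?I = "(\<integral>x. F x \<bullet> D x \<partial>lborel) - (\<integral>x. h x * \<phi> x \<partial>lborel)"
  have bound: "\<bar>?I\<bar> \<le> e * N" if "e > 0" for e
  proof -
    obtain \<psi> E where \<psi>: "\<psi> \<in> test_functions U" "C1c K \<psi> E"
      "\<And>x. \<bar>\<psi> x - \<phi> x\<bar> \<le> e" "\<And>x. norm (E x - D x) \<le> e"
      using approx[OF \<open>e > 0\<close>] by blast
    obtain K' where "K' \<subseteq> K" "\<And>x. x \<notin> K' \<Longrightarrow> \<psi> x = 0" "\<And>x. x \<notin> K' \<Longrightarrow> E x = 0"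
      using C1cE[OF \<psi>(2)] by metis
    then have z: "\<psi> x = 0" "E x = 0" if "x \<notin> K" for x using that by blast+
    have "gradient \<psi> x = E x" for x using gradient_eq C1cD(1)[OF \<psi>(2)] by blast
    then have "(\<integral>x. F x \<bullet> E x \<partial>lborel) = (LINT x:U|lborel. F x \<bullet> gradient \<psi> x)"
      unfolding set_lebesgue_integral_def \<open>\<And>x. gradient \<psi> x = E x\<close>
      using z(2) subsetD[OF K(2)] by (intro Bochner_Integration.integral_cong) (auto simp: indicator_def, metis inner_zero_right)
    moreover have "(\<integral>x. h x * \<psi> x \<partial>lborel) = (LINT x:U|lborel. h x * \<psi> x)"
      unfolding set_lebesgue_integral_def \<open>\<And>x. gradient \<psi> x = E x\<close>
      using z(1) subsetD[OF K(2)] by (intro Bochner_Integration.integral_cong) (auto simp: indicator_def)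
    ultimately have eq: "(\<integral>x. F x \<bullet> E x \<partial>lborel) = (\<integral>x. h x * \<psi> x \<partial>lborel)"
      using weak[OF \<psi>(1)] by simp
    note \<psi>U = C1c_mono[OF \<psi>(2) K(2)]
    have "?I = (\<integral>x. F x \<bullet> D x \<partial>lborel) - (\<integral>x. F x \<bullet> E x \<partial>lborel) - ((\<integral>x. h x * \<phi> x \<partial>lborel) - (\<integral>x. h x * \<psi> x \<partial>lborel))"
      using eq by simp
    also have "\<dots> = (\<integral>x. (F x \<bullet> D x - F x \<bullet> E x) - (h x * \<phi> x - h x * \<psi> x) \<partial>lborel)"
      using integrable_C1c[OF \<phi>] integrable_C1c[OF \<psi>U] F h by simp
    finally have I: "?I = (\<integral>x. (F x \<bullet> D x - F x \<bullet> E x) - (h x * \<phi> x - h x * \<psi> x) \<partial>lborel)" .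
    have "norm ?I \<le> (\<integral>x. e * (indicator K x *\<^sub>R (norm (F x) + \<bar>h x\<bar>)) \<partial>lborel)"
      unfolding I
    proof (rule Bochner_Integration.integral_norm_bound_integral)
      show "integrable lborel (\<lambda>x. (F x \<bullet> D x - F x \<bullet> E x) - (h x * \<phi> x - h x * \<psi> x))"
        using integrable_C1c[OF \<phi>] integrable_C1c[OF \<psi>U] F h by simp
      show "norm ((F x \<bullet> D x - F x \<bullet> E x) - (h x * \<phi> x - h x * \<psi> x)) \<le> e * (indicator K x *\<^sub>R (norm (F x) + \<bar>h x\<bar>))" for x
      proof (cases "x \<in> K")
        case True
        have "\<bar>F x \<bullet> (D x - E x)\<bar> \<le> norm (F x) * norm (D x - E x)" by (rule Cauchy_Schwarz_ineq2)
        also have "\<dots> \<le> norm (F x) * e"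
          using \<psi>(4)[of x] by (intro mult_left_mono) (auto simp: norm_minus_commute)
        finally have 1: "\<bar>F x \<bullet> (D x - E x)\<bar> \<le> norm (F x) * e" .
        have 2: "\<bar>h x * (\<phi> x - \<psi> x)\<bar> \<le> \<bar>h x\<bar> * e"
          unfolding abs_mult using \<psi>(3)[of x] by (intro mult_left_mono) (auto simp: abs_minus_commute)
        show ?thesis using 1 2 True by (simp add: inner_diff_right algebra_simps)
      next
        case False
        then show ?thesis using z D0 K(3) by simp
      qed
    qed (use intN in auto)
    also have "\<dots> = e * N" by (simp only: N_def integral_mult_right_zero)
    finally show ?thesis by simp
  qed
  show ?thesis
  proof (rule ccontr)
    assume "\<not> ?thesis"
    then have "\<bar>?I\<bar> > 0" by simp
    then have "\<bar>?I\<bar> \<le> \<bar>?I\<bar> / (2 * (N + 1)) * N" using N by (intro bound) auto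
    also have "\<dots> = \<bar>?I\<bar> * (N / (2 * (N + 1)))" by simp
    also have "\<dots> < \<bar>?I\<bar> * 1"
      using N \<open>\<bar>?I\<bar> > 0\<close> by (intro mult_strict_left_mono) (auto simp: divide_simps)
    finally show False by simp
  qed
qed

text \<open>\<open>measure_orthogonal_image\<close> requires a well-ordered index type. Here Fubini's theorem is applied to
  \<open>1\<^sub>B(y) 1\<^sub>A(T y + x)\<close>, where \<open>B\<close> is the unit ball, which is \<open>T\<close>-invariant.\<close>

lemma distr_lborel_linear_isometry:
  fixes T :: "'a::euclidean_space \<Rightarrow> 'a"
  assumes lin: "linear T" and nrm: "\<And>x. norm (T x) = norm x" and inv: "\<And>x. T (T x) = x"
  shows "distr lborel borel T = lborel"
proof (rule measure_eqI)
  show "sets (distr lborel borel T) = sets (lborel :: 'a measure)" by simp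
  fix A assume "A \<in> sets (distr lborel borel T)"
  then have A[measurable]: "A \<in> sets borel" by simp
  have T[measurable]: "T \<in> borel_measurable borel"
    by (intro borel_measurable_continuous_onI linear_continuous_on linear_conv_bounded_linear[THEN iffD1] lin)
  define b where "b = emeasure lborel (ball (0::'a) 1)"
  have b: "b \<noteq> 0" "b \<noteq> \<infinity>"
    using emeasure_bounded_finite[OF bounded_ball[of "0::'a" 1]] emeasure_lborel_ball_finite
      content_ball_pos[of 1 "0::'a"]
    by (auto simp: b_def measure_def)
  have bc: "emeasure lborel (ball z 1) = b" for z :: 'a
  proof -
    have "emeasure lborel (ball z 1) = emeasure (distr lborel borel ((+) z)) (ball z 1)"
      by (simp add: lborel_distr_plus)
    also have "\<dots> = emeasure lborel ((+) z -` ball z 1)"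
      by (subst emeasure_distr) auto
    also have "(+) z -` ball z 1 = ball 0 1" by (auto simp: dist_norm)
    finally show ?thesis by (simp add: b_def)
  qed
  let ?B = "indicator (ball (0::'a) 1) :: 'a \<Rightarrow> ennreal"
  have B[measurable]: "?B \<in> borel_measurable borel" by (intro borel_measurable_indicator) simp
  have A'[measurable]: "indicator A \<in> borel_measurable (borel :: 'a measure)" 
    using A by (rule borel_measurable_indicator)
  have shift: "(\<integral>\<^sup>+ x. f (z + x) \<partial>lborel) = (\<integral>\<^sup>+ x. f x \<partial>lborel)" if [measurable]: "f \<in> borel_measurable borel" for f :: "'a \<Rightarrow> ennreal" and z
  proof -
    have "(\<integral>\<^sup>+ x. f x \<partial>lborel) = (\<integral>\<^sup>+ x. f x \<partial>distr lborel borel ((+) z))" by (simp add: lborel_distr_plus)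
    also have "\<dots> = (\<integral>\<^sup>+ x. f (z + x) \<partial>lborel)" by (subst nn_integral_distr) auto
    finally show ?thesis by simp
  qed
  have "emeasure lborel A * b = (\<integral>\<^sup>+ y. ?B y * emeasure lborel A \<partial>lborel)"
    by (subst nn_integral_multc) (auto simp: b_def mult.commute intro!: borel_measurable_indicator)
  also have "\<dots> = (\<integral>\<^sup>+ y. ?B y * (\<integral>\<^sup>+ x. indicator A (T y + x) \<partial>lborel) \<partial>lborel)"
    by (simp add: shift)
  also have "\<dots> = (\<integral>\<^sup>+ y. (\<integral>\<^sup>+ x. ?B y * indicator A (T y + x) \<partial>lborel) \<partial>lborel)"
    by (simp add: nn_integral_cmult)
  also have "\<dots> = (\<integral>\<^sup>+ x. (\<integral>\<^sup>+ y. ?B y * indicator A (T y + x) \<partial>lborel) \<partial>lborel)"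
  proof (rule lborel_pair.Fubini')
    have "(\<lambda>p. T (snd p) + fst p) \<in> borel_measurable (lborel \<Otimes>\<^sub>M lborel)" by measurable
    moreover have "snd \<in> borel_measurable (lborel \<Otimes>\<^sub>M (lborel :: 'a measure))" by measurable
    ultimately
    show "(\<lambda>(x, y). ?B y * indicator A (T y + x)) \<in> borel_measurable (lborel \<Otimes>\<^sub>M lborel)"
      unfolding case_prod_unfold
      by (intro borel_measurable_times_ennreal measurable_compose[OF _ A'] measurable_compose[OF _ B])
  qed
  \<comment> \<open>Translating \<open>y\<close> by \<open>- T x\<close> cancels \<open>x\<close>,
    because \<open>T\<close> is a linear involution. The \<open>x\<close>-integral that remains is
    the volume of the unit ball about \<open>T y\<close>, which is \<open>b\<close> by translation
    invariance.\<close>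
  also have "\<dots> = (\<integral>\<^sup>+ x. (\<integral>\<^sup>+ y. ?B (- T x + y) * indicator A (T y) \<partial>lborel) \<partial>lborel)"
  proof (rule nn_integral_cong)
    fix x
    have "(\<integral>\<^sup>+ y. ?B y * indicator A (T y + x) \<partial>lborel) = (\<integral>\<^sup>+ y. ?B (- T x + y) * indicator A (T (- T x + y) + x) \<partial>lborel)"
      by (rule shift[symmetric]) measurable
    moreover have "T (- T x + y) + x = T y" for y
      using linear_diff[OF lin] inv by simp
    ultimately show "(\<integral>\<^sup>+ y. ?B y * indicator A (T y + x) \<partial>lborel) = (\<integral>\<^sup>+ y. ?B (- T x + y) * indicator A (T y) \<partial>lborel)"
      by simp
  qed
  also have "\<dots> = (\<integral>\<^sup>+ y. (\<integral>\<^sup>+ x. ?B (- T x + y) * indicator A (T y) \<partial>lborel) \<partial>lborel)"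
  proof (rule lborel_pair.Fubini')
    have "(\<lambda>p. - T (snd p) + fst p) \<in> borel_measurable (lborel \<Otimes>\<^sub>M lborel)"
      "(\<lambda>p. T (fst p)) \<in> borel_measurable (lborel \<Otimes>\<^sub>M (lborel :: 'a measure))" by measurable
    then show "(\<lambda>(y, x). ?B (- T x + y) * indicator A (T y)) \<in> borel_measurable (lborel \<Otimes>\<^sub>M lborel)"
      unfolding case_prod_unfold
      by (intro borel_measurable_times_ennreal measurable_compose[OF _ A'] measurable_compose[OF _ B])
  qed
  also have "\<dots> = (\<integral>\<^sup>+ y. b * indicator A (T y) \<partial>lborel)"
  proof (rule nn_integral_cong)
    fix y
    have "norm (T x - y) = norm (T y - x)" for x
      using nrm[of "T x - y"] norm_minus_commute[of x "T y"] linear_diff[OF lin] inv by simp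
    then have "?B (- T x + y) = indicator (ball (T y) 1) x" for x
      by (auto simp: indicator_def dist_norm)
    then show "(\<integral>\<^sup>+ x. ?B (- T x + y) * indicator A (T y) \<partial>lborel) = b * indicator A (T y)"
      using bc[of "T y"] by (cases "T y \<in> A") auto
  qed
  also have "\<dots> = b * (\<integral>\<^sup>+ y. indicator A (T y) \<partial>lborel)"
    by (rule nn_integral_cmult) measurable
  also have "(\<integral>\<^sup>+ y. indicator A (T y) \<partial>lborel) = emeasure (distr lborel borel T) A"
  proof -
    have "emeasure (distr lborel borel T) A = (\<integral>\<^sup>+ y. indicator A y \<partial>distr lborel borel T)" by simp
    also have "\<dots> = (\<integral>\<^sup>+ y. indicator A (T y) \<partial>lborel)"
      by (rule nn_integral_distr) (use T A' in simp_all)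
    finally show ?thesis by simp
  qed
  finally have "b * emeasure (distr lborel borel T) A = b * emeasure lborel A"
    by (simp add: mult.commute)
  then show "emeasure (distr lborel borel T) A = emeasure lborel A"
    using b by (simp add: ennreal_mult_cancel_left)
qed

section \<open>Continuity and monotonicity of the p-Laplacian flux\<close>

lemma p_flux_2: "p_flux 2 z = z"
  by (cases "z = 0") (auto simp: p_flux_def)

text \<open>For \<open>p < 2\<close> the factor \<open>norm z powr (p - 2)\<close> is unbounded near
  0, but the flux has norm \<open>norm z powr (p - 1)\<close>, which tends to 0 for every
  \<open>p > 1\<close>.\<close>

lemma continuous_p_flux:
  assumes "1 < p"
  shows "continuous_on UNIV (p_flux p :: 'a::euclidean_space \<Rightarrow> 'a)"
  unfolding continuous_on_eq_continuous_at[OF open_UNIV]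
proof
  fix z :: 'a
  show "isCont (p_flux p) z"
  proof (cases "z = 0")
    case False
    then show ?thesis unfolding p_flux_def by (auto intro!: continuous_intros)
  next
    case True
    have n: "norm (p_flux p y) = norm y powr (p - 1)" for y :: 'a
    proof (cases "y = 0")
      case False
      then show ?thesis using powr_add[of "norm y" "p - 2" 1] by (simp add: p_flux_def)
    qed (use assms in \<open>auto simp: p_flux_def\<close>)
    have "((\<lambda>y::'a. norm y powr (p - 1)) \<longlongrightarrow> norm (0::'a) powr (p - 1)) (at 0)"
      by (rule tendsto_powr'[OF tendsto_norm tendsto_const]) (use assms in auto)
    then have "((\<lambda>y::'a. norm (p_flux p y)) \<longlongrightarrow> 0) (at 0)"
      using assms by (simp add: n)
    then have "(p_flux p \<longlongrightarrow> 0) (at (0::'a))" by (rule tendsto_norm_zero_cancel)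
    then show ?thesis
      unfolding isCont_def True by (simp add: p_flux_def)
  qed
qed

text \<open>The expression splits into a radial part, nonnegative because the power
  \<open>p - 1\<close> is increasing, and \<open>s + t\<close> times the defect in the
  Cauchy-Schwarz inequality. If both vanish, the norms agree and then the directions agree. The
  singular and the degenerate range of \<open>p\<close> are thus handled together.\<close>

lemma p_flux_monotone:
  fixes a b :: "'a::euclidean_space"
  assumes "1 < p"
  shows "0 \<le> (p_flux p a - p_flux p b) \<bullet> (a - b)"
    and "(p_flux p a - p_flux p b) \<bullet> (a - b) = 0 \<Longrightarrow> a = b"
proof -
  define s t where "s = norm a powr (p - 2)" and "t = norm b powr (p - 2)"
  have pos: "s \<ge> 0" "t \<ge> 0" by (auto simp: s_def t_def)
  have pw: "norm z powr (p - 2) * norm z = norm z powr (p - 1)" for z :: 'a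
    using powr_add[of "norm z" "p - 2" 1] assms by (cases "z = 0") auto
  have eq: "(p_flux p a - p_flux p b) \<bullet> (a - b)
    = (s * norm a - t * norm b) * (norm a - norm b) + (s + t) * (norm a * norm b - a \<bullet> b)"
    by (simp add: p_flux_def s_def t_def algebra_simps inner_commute dot_square_norm power2_eq_square)
  have 1: "(s * norm a - t * norm b) * (norm a - norm b) \<ge> 0"
    unfolding s_def t_def pw
    using powr_mono2[of "p - 1" "norm a" "norm b"] powr_mono2[of "p - 1" "norm b" "norm a"] assms
    by (cases "norm a \<le> norm b") (auto simp: mult_nonpos_nonpos)
  have 2: "(s + t) * (norm a * norm b - a \<bullet> b) \<ge> 0"
    using pos norm_cauchy_schwarz[of a b] by simp
  show "0 \<le> (p_flux p a - p_flux p b) \<bullet> (a - b)" using 1 2 eq by simp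
  assume "(p_flux p a - p_flux p b) \<bullet> (a - b) = 0"
  then have z: "(s * norm a - t * norm b) * (norm a - norm b) = 0" "(s + t) * (norm a * norm b - a \<bullet> b) = 0"
    using 1 2 eq by linarith+
  have n: "norm a = norm b"
  proof (rule ccontr)
    assume "norm a \<noteq> norm b"
    then have "norm a powr (p - 1) \<noteq> norm b powr (p - 1)"
      using powr_less_mono2[of "p - 1" "norm a" "norm b"] powr_less_mono2[of "p - 1" "norm b" "norm a"] assms
      by (cases "norm a < norm b") auto
    then show False using z(1) \<open>norm a \<noteq> norm b\<close> unfolding s_def t_def pw by simp
  qed
  show "a = b"
  proof (cases "a = 0")
    case False
    then have "b \<noteq> 0" using n by auto
    then have "s + t \<noteq> 0" using n by (simp add: s_def t_def)
    then have "a \<bullet> b = norm a * norm b" using z(2) by simp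
    then show ?thesis using n False by (metis norm_cauchy_schwarz_eq scaleR_cancel_left norm_eq_zero)
  qed (use n in simp)
qed

section \<open>Comparison and the Hopf lemma\<close>

text \<open>Off \<open>K\<close> the function is locally 0, so its gradient is 0 there as well; the
  open sets \<open>U\<close> and \<open>- K\<close> cover the space.\<close>

lemma C1c_extend_zero:
  fixes \<phi> :: "'a::euclidean_space \<Rightarrow> real"
  assumes U: "open U" and K: "compact K" "K \<subseteq> U"
    and der: "\<And>x. x \<in> U \<Longrightarrow> GDERIV \<phi> x :> D x" and D: "continuous_on U D"
    and z: "\<And>x. x \<in> U \<Longrightarrow> x \<notin> K \<Longrightarrow> \<phi> x = 0"
  shows "C1c U (\<lambda>x. if x \<in> U then \<phi> x else 0) (\<lambda>x. if x \<in> U then D x else 0)" (is "C1c U ?f ?D")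
  unfolding C1c_def
proof (intro conjI allI)
  have f0: "\<forall>x. x \<notin> K \<longrightarrow> ?f x = 0" using z K(2) by auto
  have derU: "GDERIV ?f x :> ?D x" if "x \<in> U" for x
  proof -
    have "(?f has_derivative (\<lambda>h. h \<bullet> D x)) (at x)"
      by (rule has_derivative_transform_within_open[OF der[OF that, unfolded gderiv_def] U that]) simp
    then show ?thesis using that by (simp add: gderiv_def)
  qed
  have D0: "?D x = 0" if "x \<notin> K" for x
    using GDERIV_zero_outside[OF compact_imp_closed[OF K(1)] that f0 derU] by (cases "x \<in> U") auto
  have oK: "open (- K)" by (rule open_Compl[OF compact_imp_closed[OF K(1)]])
  show "GDERIV ?f x :> ?D x" for x
  proof (cases "x \<in> U")
    case False
    have "(?f has_derivative (\<lambda>h. h \<bullet> 0)) (at x)"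
      unfolding inner_zero_right
      by (rule has_derivative_transform_within_open[OF has_derivative_const[of 0] oK]) (use f0 False K(2) in auto)
    then show ?thesis using False by (simp add: gderiv_def)
  qed (rule derU)
  have "continuous_on (U \<union> - K) ?D"
  proof (rule continuous_on_open_Un[OF U oK])
    show "continuous_on U ?D" using D by (rule continuous_on_eq) simp
    show "continuous_on (- K) ?D" using D0 by (intro continuous_on_eq[OF continuous_on_const[of _ 0]]) auto
  qed
  moreover have "U \<union> - K = UNIV" using K(2) by auto
  ultimately show "continuous_on UNIV ?D" by metis
  show "\<exists>K. compact K \<and> K \<subseteq> U \<and> (\<forall>x. x \<notin> K \<longrightarrow> ?f x = 0)"
    using K f0 by blast
qed

lemma weak_comparison:
  fixes a b :: "'a::euclidean_space \<Rightarrow> real"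
  assumes p: "1 < p" and U: "open U" "bounded U"
    and cont: "continuous_on (closure U) a" "continuous_on (closure U) b"
    and der: "\<And>x. x \<in> U \<Longrightarrow> GDERIV a x :> A x" "\<And>x. x \<in> U \<Longrightarrow> GDERIV b x :> B x"
    and grad: "continuous_on U A" "continuous_on U B"
    and bd: "\<And>x. x \<in> frontier U \<Longrightarrow> a x \<le> b x"
    and ineq: "\<And>\<phi> D. C1c U \<phi> D \<Longrightarrow> (\<And>x. 0 \<le> \<phi> x) \<Longrightarrow>
      (\<integral>x. p_flux p (A x) \<bullet> D x \<partial>lborel) \<le> (\<integral>x. p_flux p (B x) \<bullet> D x \<partial>lborel)"
    and x0: "x0 \<in> U"
  shows "a x0 \<le> b x0"
proof (rule ccontr)
  assume "\<not> a x0 \<le> b x0"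
  \<comment> \<open>Subtracting half of the assumed excess keeps \<open>w\<close> positive at
    \<open>x0\<close> and makes it negative on the frontier, so the set \<open>K\<close> where
    \<open>w \<ge> 0\<close> is a compact subset of \<open>U\<close>.\<close>
  define e where "e = (a x0 - b x0) / 2"
  have e: "e > 0" using \<open>\<not> a x0 \<le> b x0\<close> by (simp add: e_def)
  define w where "w = (\<lambda>x. a x - b x - e)"
  define K where "K = {x \<in> closure U. w x \<in> {0..}}"
  have cw: "continuous_on (closure U) w" unfolding w_def by (intro continuous_intros cont)
  have "closed K" unfolding K_def
    using continuous_closed_preimage[OF cw closed_closure closed_atLeast[of 0]]
    by (simp add: vimage_def Int_def)
  then have K: "compact K"
    using U(2) unfolding K_def compact_eq_bounded_closed
    by (metis (no_types, lifting) bounded_closure bounded_subset mem_Collect_eq subsetI)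
  have KU: "K \<subseteq> U"
  proof
    fix x assume "x \<in> K"
    then have x: "x \<in> closure U" "w x \<ge> 0" by (auto simp: K_def)
    show "x \<in> U"
    proof (rule ccontr)
      assume "x \<notin> U"
      then have "x \<in> frontier U" using x(1) U(1) by (simp add: frontier_def interior_open)
      from bd[OF this] show False using x(2) e by (simp add: w_def)
    qed
  qed
  \<comment> \<open>the square makes the test function \<open>((a - b - e)\<^sup>+)\<^sup>2\<close> continuously differentiable\<close>
  define \<eta> where "\<eta> = (\<lambda>t::real. (max 0 t)\<^sup>2)"
  have \<eta>: "(\<eta> has_real_derivative 2 * max 0 t) (at t)" for t
  proof -
    consider "t > 0" | "t < 0" | "t = 0" by linarith
    then show ?thesis
    proof cases
      case 1
      have "((\<lambda>t. t\<^sup>2) has_real_derivative 2 * t) (at t)" by (auto intro!: derivative_eq_intros)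
      then have "(\<eta> has_real_derivative 2 * t) (at t)"
        by (rule has_field_derivative_transform_within_open[where S = "{0<..}"]) (use 1 in \<open>auto simp: \<eta>_def\<close>)
      then show ?thesis using 1 by simp
    next
      case 2
      have "((\<lambda>t. 0::real) has_real_derivative 0) (at t)" by simp
      then have "(\<eta> has_real_derivative 0) (at t)"
        by (rule has_field_derivative_transform_within_open[where S = "{..<0}"]) (use 2 in \<open>auto simp: \<eta>_def\<close>)
      then show ?thesis using 2 by simp
    next
      case 3
      have "((\<lambda>h::real. \<bar>h\<bar>) \<longlongrightarrow> 0) (at 0)" by (rule tendsto_rabs_zero[OF tendsto_ident_at])
      moreover have "norm (\<eta> h / h) \<le> \<bar>h\<bar>" for h
        by (cases "h > 0") (auto simp: \<eta>_def power2_eq_square max_def)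
      ultimately have "((\<lambda>h. \<eta> h / h) \<longlongrightarrow> 0) (at 0)"
        by (intro Lim_null_comparison[of "\<lambda>h. \<eta> h / h"]) auto
      then show ?thesis using 3 by (simp add: DERIV_def \<eta>_def)
    qed
  qed
  let ?\<phi> = "\<lambda>x. if x \<in> U then \<eta> (w x) else 0"
  let ?D = "\<lambda>x. if x \<in> U then (2 * max 0 (w x)) *\<^sub>R (A x - B x) else 0"
  have \<phi>: "C1c U ?\<phi> ?D"
  proof (rule C1c_extend_zero[OF U(1) K KU])
    show "GDERIV (\<lambda>x. \<eta> (w x)) x :> (2 * max 0 (w x)) *\<^sub>R (A x - B x)" if "x \<in> U" for x
    proof (rule GDERIV_DERIV_compose[OF _ \<eta>])
      show "GDERIV w x :> A x - B x"
        unfolding w_def using GDERIV_diff[OF GDERIV_diff[OF der(1)[OF that] der(2)[OF that]] GDERIV_const] by simp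
    qed
    show "continuous_on U (\<lambda>x. (2 * max 0 (w x)) *\<^sub>R (A x - B x))"
      by (intro continuous_intros grad continuous_on_subset[OF cw closure_subset])
    show "\<eta> (w x) = 0" if "x \<in> U" "x \<notin> K" for x
      using that closure_subset[of U] by (auto simp: K_def \<eta>_def)
  qed
  note f = C1cD[OF \<phi>]
  have cA: "continuous_on U (\<lambda>x. p_flux p (A x))" "continuous_on U (\<lambda>x. p_flux p (B x))"
    using continuous_on_compose2[OF continuous_p_flux[OF p]] grad by blast+
  let ?I = "\<lambda>x. p_flux p (A x) \<bullet> ?D x - p_flux p (B x) \<bullet> ?D x"
  have int: "integrable lborel (\<lambda>x. p_flux p (A x) \<bullet> ?D x)" "integrable lborel (\<lambda>x. p_flux p (B x) \<bullet> ?D x)"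
    using integrable_C1c(1)[OF \<phi>] cA by blast+
  have "0 \<le> ?\<phi> x" for x by (simp add: \<eta>_def)
  from ineq[OF \<phi> this] int
  have le0: "(\<integral>x. ?I x \<partial>lborel) \<le> 0" by (subst Bochner_Integration.integral_diff) auto
  have I: "?I x = 2 * max 0 (w x) * ((p_flux p (A x) - p_flux p (B x)) \<bullet> (A x - B x))" if "x \<in> U" for x
    using that by (simp add: algebra_simps)
  have nonneg: "0 \<le> ?I x" for x
  proof (cases "x \<in> U")
    case True
    then show ?thesis unfolding I[OF True] by (intro mult_nonneg_nonneg p_flux_monotone(1)[OF p]) auto
  qed simp
  have "?I x = 0" if "x \<in> U" for x
  proof (rule continuous_integral_eq_0[OF U(1) _ _ nonneg le0 that])
    show "continuous_on U ?I"
      by (intro continuous_on_diff continuous_on_inner cA continuous_on_subset[OF f(2)]) auto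
    show "integrable lborel ?I" using int by (rule Bochner_Integration.integrable_diff)
  qed
  then have AB: "A x = B x" if "x \<in> U" "w x > 0" for x
    using I[OF that(1)] that p_flux_monotone(2)[OF p, of "A x" "B x"] by fastforce
  \<comment> \<open>Where \<open>w > 0\<close> the gradients agree by strict monotonicity; elsewhere
    the factor \<open>max 0 (w x)\<close> is 0. The test function, extended by 0, is thus constant
    on the whole space, which treats all components of \<open>U\<close> at once: it vanishes off
    \<open>K\<close>, yet is positive at \<open>x0\<close>.\<close>
  have "?D x = 0" for x
    using AB[of x] by (cases "x \<in> U"; cases "w x > 0") auto
  then have "(?\<phi> has_derivative (\<lambda>h. 0)) (at x)" for x
    using f(1)[of x] unfolding gderiv_def by (simp only: inner_zero_right)
  then obtain c where c: "\<And>x. ?\<phi> x = c"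
    using has_derivative_zero_constant[of UNIV ?\<phi>] convex_UNIV by blast
  have "K \<noteq> UNIV" using K compact_imp_bounded not_bounded_UNIV by metis
  then obtain y where "y \<notin> K" by blast
  then have "?\<phi> y = 0" using closure_subset[of U] by (auto simp: K_def \<eta>_def)
  moreover have "?\<phi> x0 > 0" using x0 e by (simp add: \<eta>_def w_def e_def)
  ultimately show False using c[of y] c[of x0] by linarith
qed

text \<open>If \<open>B\<close> is the gradient of a C^1 function, this is the weak form of a
  nonpositive Laplacian.\<close>

definition superharmonic_gradient :: "'a::euclidean_space set \<Rightarrow> ('a \<Rightarrow> 'a) \<Rightarrow> bool" where
  "superharmonic_gradient U B \<longleftrightarrow>
    (\<forall>\<phi> D. C1c U \<phi> D \<longrightarrow> (\<forall>x. 0 \<le> \<phi> x) \<longrightarrow> 0 \<le> (\<integral>x. B x \<bullet> D x \<partial>lborel))"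

lemma superharmonic_gradient_subset:
  "superharmonic_gradient U B \<Longrightarrow> V \<subseteq> U \<Longrightarrow> superharmonic_gradient V B"
  unfolding superharmonic_gradient_def using C1c_mono by blast

text \<open>The second integrand contains minus the divergence of
  \<open>E x *\<^sub>R (x - c)\<close>; up to the factor \<open>2 * \<alpha>\<close> this is the
  Laplacian of the Gaussian \<open>E\<close>. For each coordinate direction \<open>i\<close> the
  function \<open>?H i x * \<phi> x\<close> has compact support, so its derivative along
  \<open>i\<close> integrates to 0; these identities are summed over \<open>i\<close>.\<close>

lemma gaussian_by_parts:
  fixes c :: "'a::euclidean_space" and \<alpha> :: real
  assumes \<phi>: "C1c U \<phi> D"
  defines "E \<equiv> \<lambda>x. exp (- \<alpha> * (dist c x)\<^sup>2)"
  shows "(\<integral>x. (E x *\<^sub>R (x - c)) \<bullet> D x \<partial>lborel)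
    = (\<integral>x. E x * (2 * \<alpha> * (dist c x)\<^sup>2 - real DIM('a)) * \<phi> x \<partial>lborel)"
proof -
  note f = C1cD[OF \<phi>]
  have dE: "GDERIV E x :> (- 2 * \<alpha> * E x) *\<^sub>R (x - c)" for x
    unfolding gderiv_def E_def dist_norm power2_norm_eq_inner
    by (auto intro!: derivative_eq_intros simp: algebra_simps inner_commute)
  have cE: "continuous_on UNIV E" unfolding E_def by (intro continuous_intros)
  let ?H = "\<lambda>i x. E x * ((x - c) \<bullet> i)"
  let ?G = "\<lambda>i x. E x *\<^sub>R i + ((x - c) \<bullet> i) *\<^sub>R (- 2 * \<alpha> * E x) *\<^sub>R (x - c)"
  have zero: "(\<integral>x. (?H i x *\<^sub>R D x + \<phi> x *\<^sub>R ?G i x) \<bullet> i \<partial>lborel) = 0" for i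
  proof (rule integral_gderiv_eq_0)
    show "C1c UNIV (\<lambda>x. ?H i x * \<phi> x) (\<lambda>x. ?H i x *\<^sub>R D x + \<phi> x *\<^sub>R ?G i x)"
      unfolding C1c_def
    proof (intro conjI allI)
      have "GDERIV (\<lambda>x. (x - c) \<bullet> i) x :> i" for x
        unfolding gderiv_def by (auto intro!: derivative_eq_intros)
      from GDERIV_mult[OF GDERIV_mult[OF dE this] f(1)]
      show "GDERIV (\<lambda>x. ?H i x * \<phi> x) x :> ?H i x *\<^sub>R D x + \<phi> x *\<^sub>R ?G i x" for x .
      show "continuous_on UNIV (\<lambda>x. ?H i x *\<^sub>R D x + \<phi> x *\<^sub>R ?G i x)"
        by (intro continuous_intros cE f)
      show "\<exists>K. compact K \<and> K \<subseteq> UNIV \<and> (\<forall>x. x \<notin> K \<longrightarrow> ?H i x * \<phi> x = 0)"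
        using C1cE[OF \<phi>] by (metis mult_zero_right subset_UNIV)
    qed
  qed
  have int1: "integrable lborel (\<lambda>x. ((?H i x) *\<^sub>R i) \<bullet> D x)" for i
    by (rule integrable_C1c(1)[OF C1c_mono[OF \<phi> subset_UNIV]]) (intro continuous_intros cE)
  have int2: "integrable lborel (\<lambda>x. (?G i x \<bullet> i) * \<phi> x)" for i
    by (rule integrable_C1c(2)[OF C1c_mono[OF \<phi> subset_UNIV]]) (intro continuous_intros cE)
  have split: "(\<integral>x. ((?H i x) *\<^sub>R i) \<bullet> D x \<partial>lborel) = - (\<integral>x. (?G i x \<bullet> i) * \<phi> x \<partial>lborel)" for i
  proof -
    have "((?H i x) *\<^sub>R i) \<bullet> D x + (?G i x \<bullet> i) * \<phi> x = (?H i x *\<^sub>R D x + \<phi> x *\<^sub>R ?G i x) \<bullet> i" for x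
      by (simp add: inner_add_left inner_commute[of i "D x"] mult.commute[of "\<phi> x"])
    then have "(\<integral>x. ((?H i x) *\<^sub>R i) \<bullet> D x + (?G i x \<bullet> i) * \<phi> x \<partial>lborel) = 0"
      using zero[of i] by (simp only:)
    then show ?thesis
      using Bochner_Integration.integral_add[OF int1 int2, of i i] by linarith
  qed
  have sumH: "(\<Sum>i\<in>Basis. ((?H i x) *\<^sub>R i) \<bullet> D x) = (E x *\<^sub>R (x - c)) \<bullet> D x" for x
  proof -
    have "(E x *\<^sub>R (x - c)) \<bullet> D x = (\<Sum>i\<in>Basis. ((E x *\<^sub>R (x - c)) \<bullet> i) * (D x \<bullet> i))"
      by (rule euclidean_inner)
    then show ?thesis by (simp add: inner_commute mult.assoc)
  qed
  have sumG: "(\<Sum>i\<in>Basis. (?G i x \<bullet> i) * \<phi> x) = - (E x * (2 * \<alpha> * (dist c x)\<^sup>2 - real DIM('a)) * \<phi> x)" for x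
  proof -
    have "(\<Sum>i\<in>Basis. ?G i x \<bullet> i) = (\<Sum>i\<in>Basis. E x - 2 * \<alpha> * E x * (((x - c) \<bullet> i) * ((x - c) \<bullet> i)))"
      by (intro sum.cong refl) (simp add: inner_add_left algebra_simps)
    also have "\<dots> = real DIM('a) * E x - 2 * \<alpha> * E x * ((x - c) \<bullet> (x - c))"
      by (simp add: sum_subtractf sum_distrib_left[symmetric] euclidean_inner[of "x - c" "x - c"])
    finally have G: "(\<Sum>i\<in>Basis. ?G i x \<bullet> i) = real DIM('a) * E x - 2 * \<alpha> * E x * ((x - c) \<bullet> (x - c))" .
    have "(dist c x)\<^sup>2 = (x - c) \<bullet> (x - c)"
      by (metis dist_commute dist_norm power2_norm_eq_inner)
    moreover have "(n * e - 2 * \<alpha> * e * q) * f = - (e * (2 * \<alpha> * q - n) * f)" for n e q f :: real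
      by (simp add: algebra_simps)
    ultimately show ?thesis
      unfolding sum_distrib_right[symmetric] G by metis
  qed
  have "(\<integral>x. (E x *\<^sub>R (x - c)) \<bullet> D x \<partial>lborel) = (\<Sum>i\<in>Basis. \<integral>x. ((?H i x) *\<^sub>R i) \<bullet> D x \<partial>lborel)"
    unfolding sumH[symmetric] using int1 by (rule Bochner_Integration.integral_sum)
  also have "\<dots> = - (\<Sum>i\<in>Basis. \<integral>x. (?G i x \<bullet> i) * \<phi> x \<partial>lborel)"
    by (simp only: split sum_negf)
  also have "(\<Sum>i\<in>Basis. \<integral>x. (?G i x \<bullet> i) * \<phi> x \<partial>lborel) = (\<integral>x. (\<Sum>i\<in>Basis. (?G i x \<bullet> i) * \<phi> x) \<partial>lborel)"
    using int2 by (rule Bochner_Integration.integral_sum[symmetric])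
  finally show ?thesis
    unfolding sumG by simp
qed

text \<open>On the annulus between the radii \<open>r / 2\<close> and \<open>r\<close>,
  \<open>w\<close> is compared with the barrier \<open>m * (E x - q)\<close>. The constant
  \<open>q\<close> is the value of \<open>E\<close> on the outer sphere, so the barrier vanishes
  there; \<open>m\<close> is the minimum of \<open>w\<close> on the inner closed ball, and
  \<open>E x \<le> 1\<close> keeps the barrier below \<open>w\<close> on the inner sphere. The
  resulting bound involves no derivative of \<open>w\<close> on the sphere.\<close>

lemma hopf_barrier:
  fixes w :: "'a::euclidean_space \<Rightarrow> real"
  assumes r: "0 < r" and cont: "continuous_on (cball c r) w"
    and der: "\<And>x. x \<in> ball c r \<Longrightarrow> GDERIV w x :> B x" and B: "continuous_on (ball c r) B"
    and sup: "superharmonic_gradient (ball c r) B"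
    and pos: "\<And>x. x \<in> ball c r \<Longrightarrow> 0 < w x" and nonneg: "\<And>x. x \<in> sphere c r \<Longrightarrow> 0 \<le> w x"
  shows "\<exists>k>0. \<forall>x. r / 2 \<le> dist c x \<and> dist c x \<le> r \<longrightarrow> k * (r - dist c x) \<le> w x"
proof -
  \<comment> \<open>with this exponent the Gaussian is subharmonic outside the ball of radius \<open>r/2\<close>\<close>
  define \<alpha> where "\<alpha> = 2 * real DIM('a) / r\<^sup>2"
  have \<alpha>: "\<alpha> > 0" using r by (simp add: \<alpha>_def)
  define E where "E = (\<lambda>x::'a. exp (- \<alpha> * (dist c x)\<^sup>2))"
  have cE: "continuous_on UNIV E" unfolding E_def by (intro continuous_intros)
  have E1: "E x \<le> 1" for x using \<alpha> by (simp add: E_def)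
  define q where "q = exp (- \<alpha> * r\<^sup>2)"
  have q: "q > 0" by (simp add: q_def)
  obtain y where y: "y \<in> cball c (r / 2)" "\<And>x. x \<in> cball c (r / 2) \<Longrightarrow> w y \<le> w x"
    using continuous_attains_inf[of "cball c (r/2)" w] continuous_on_subset[OF cont, of "cball c (r/2)"] r by force
  define m where "m = w y"
  have m: "m > 0" unfolding m_def using y(1) r by (intro pos) auto
  define U where "U = {x. r / 2 < dist c x \<and> dist c x < r}"
  have U_eq: "U = ball c r - cball c (r/2)" by (auto simp: U_def)
  have oU: "open U" unfolding U_eq by (intro open_Diff open_ball closed_cball)
  have bU: "bounded U" unfolding U_eq by (rule bounded_subset[OF bounded_ball]) auto
  have UB: "U \<subseteq> ball c r" by (auto simp: U_eq)
  have clU: "closure U \<subseteq> {x. r / 2 \<le> dist c x \<and> dist c x \<le> r}"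
  proof (rule closure_minimal)
    have "{x. r / 2 \<le> dist c x \<and> dist c x \<le> r} = cball c r - ball c (r/2)" by auto
    then show "closed {x. r / 2 \<le> dist c x \<and> dist c x \<le> r}" by (simp add: closed_Diff)
  qed (auto simp: U_def)
  have frU: "dist c x = r / 2 \<or> dist c x = r" if "x \<in> frontier U" for x
  proof -
    have "x \<in> closure U" "x \<notin> U" using that oU by (auto simp: frontier_def interior_open)
    then show ?thesis using clU by (force simp: U_def)
  qed
  have dh: "GDERIV (\<lambda>x. m * (E x - q)) x :> (- 2 * \<alpha> * m) *\<^sub>R E x *\<^sub>R (x - c)" for x
    unfolding gderiv_def E_def dist_norm power2_norm_eq_inner
    by (auto intro!: derivative_eq_intros simp: algebra_simps inner_commute)
  have comp: "m * (E x - q) \<le> w x" if "x \<in> U" for x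
  proof (rule weak_comparison[of 2 U, OF _ oU bU _ _ dh der _ _ _ _ that])
    show "continuous_on (closure U) (\<lambda>x. m * (E x - q))"
      by (intro continuous_intros continuous_on_subset[OF cE]) auto
    show "continuous_on (closure U) w" using clU by (intro continuous_on_subset[OF cont]) auto
    show "continuous_on U (\<lambda>x. (- 2 * \<alpha> * m) *\<^sub>R E x *\<^sub>R (x - c))"
      by (intro continuous_intros continuous_on_subset[OF cE]) auto
    show "continuous_on U B" by (rule continuous_on_subset[OF B UB])
    show "m * (E x - q) \<le> w x" if "x \<in> frontier U" for x
    proof (cases "dist c x = r")
      case True
      then show ?thesis using nonneg[of x] by (simp add: E_def q_def)
    next
      case False
      then have "x \<in> cball c (r/2)" using frU[OF that] by auto
      then have "m \<le> w x" using y(2) by (simp add: m_def)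
      moreover have "m * (E x - q) \<le> m * 1"
        using m q E1[of x] by (intro mult_left_mono) auto
      ultimately show ?thesis by simp
    qed
    fix \<phi> D assume \<phi>: "C1c U \<phi> D" and \<phi>0: "\<And>x. 0 \<le> \<phi> (x::'a)"
    obtain K where K: "K \<subseteq> U" "\<And>x. x \<notin> K \<Longrightarrow> \<phi> x = 0" using C1cE[OF \<phi>] by metis
    have "0 \<le> (\<integral>x. E x * (2 * \<alpha> * (dist c x)\<^sup>2 - real DIM('a)) * \<phi> x \<partial>lborel)"
    proof (rule Bochner_Integration.integral_nonneg)
      fix x
      show "0 \<le> E x * (2 * \<alpha> * (dist c x)\<^sup>2 - real DIM('a)) * \<phi> x"
      proof (cases "x \<in> U")
        case True
        then have "(r / 2)\<^sup>2 \<le> (dist c x)\<^sup>2" using r by (intro power_mono) (auto simp: U_def)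
        then have "2 * \<alpha> * (r / 2)\<^sup>2 \<le> 2 * \<alpha> * (dist c x)\<^sup>2" using \<alpha> by (intro mult_left_mono) auto
        moreover have "2 * \<alpha> * (r / 2)\<^sup>2 = real DIM('a)" using r by (simp add: \<alpha>_def power_divide)
        ultimately show ?thesis using \<phi>0[of x] by (simp add: E_def)
      next
        case False
        then have "\<phi> x = 0" using K by blast
        then show ?thesis by simp
      qed
    qed
    then have "0 \<le> (\<integral>x. (E x *\<^sub>R (x - c)) \<bullet> D x \<partial>lborel)"
      unfolding E_def gaussian_by_parts[OF \<phi>, of \<alpha> c] .
    then have "(- 2 * \<alpha> * m) * (\<integral>x. (E x *\<^sub>R (x - c)) \<bullet> D x \<partial>lborel) \<le> 0"
      using \<alpha> m by (intro mult_nonpos_nonneg) auto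
    then have "(\<integral>x. ((- 2 * \<alpha> * m) *\<^sub>R E x *\<^sub>R (x - c)) \<bullet> D x \<partial>lborel) \<le> 0"
      unfolding inner_scaleR_left[of "- 2 * \<alpha> * m"] integral_mult_right_zero .
    also have "0 \<le> (\<integral>x. B x \<bullet> D x \<partial>lborel)"
      using sup C1c_mono[OF \<phi> UB] \<phi>0 unfolding superharmonic_gradient_def by blast
    finally show "(\<integral>x. p_flux 2 ((- 2 * \<alpha> * m) *\<^sub>R E x *\<^sub>R (x - c)) \<bullet> D x \<partial>lborel) \<le> (\<integral>x. p_flux 2 (B x) \<bullet> D x \<partial>lborel)"
      by (simp only: p_flux_2)
  qed (use UB in auto)
  \<comment> \<open>This slope comes from \<open>exp s \<ge> 1 + s\<close> and from
    \<open>r\<^sup>2 - (dist c x)\<^sup>2 \<ge> r / 2 * (r - dist c x)\<close>.\<close>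
  define k where "k = m * q * \<alpha> * r / 2"
  have k: "k > 0" using m q \<alpha> r by (simp add: k_def)
  have lin: "k * (r - dist c x) \<le> m * (E x - q)" if "r / 2 \<le> dist c x" "dist c x \<le> r" for x
  proof -
    have "E x = q * exp (\<alpha> * (r\<^sup>2 - (dist c x)\<^sup>2))"
      unfolding E_def q_def exp_add[symmetric] by (simp add: algebra_simps)
    moreover have "1 + \<alpha> * (r\<^sup>2 - (dist c x)\<^sup>2) \<le> exp (\<alpha> * (r\<^sup>2 - (dist c x)\<^sup>2))"
      by (rule exp_ge_add_one_self)
    then have "q * (1 + \<alpha> * (r\<^sup>2 - (dist c x)\<^sup>2)) \<le> q * exp (\<alpha> * (r\<^sup>2 - (dist c x)\<^sup>2))"
      using q by (intro mult_left_mono) auto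
    ultimately have 1: "q * \<alpha> * (r\<^sup>2 - (dist c x)\<^sup>2) \<le> E x - q" by (simp add: algebra_simps)
    have "r / 2 * (r - dist c x) \<le> (r + dist c x) * (r - dist c x)"
      using that r by (intro mult_right_mono) auto
    also have "\<dots> = r\<^sup>2 - (dist c x)\<^sup>2" by (simp add: power2_eq_square algebra_simps)
    finally have "q * \<alpha> * (r / 2 * (r - dist c x)) \<le> q * \<alpha> * (r\<^sup>2 - (dist c x)\<^sup>2)"
      using q \<alpha> by (intro mult_left_mono) auto
    then have "q * \<alpha> * (r / 2 * (r - dist c x)) \<le> E x - q" using 1 by linarith
    then have "m * (q * \<alpha> * (r / 2 * (r - dist c x))) \<le> m * (E x - q)"
      using m by (intro mult_left_mono) auto
    then show ?thesis by (simp add: k_def algebra_simps)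
  qed
  have "k * (r - dist c x) \<le> w x" if x: "r / 2 \<le> dist c x" "dist c x \<le> r" for x
  proof -
    consider "x \<in> U" | "dist c x = r" | "dist c x = r / 2" using x unfolding U_def mem_Collect_eq by linarith
    then show ?thesis
    proof cases
      case 1 then show ?thesis using lin[OF x] comp by force
    next
      case 2 then show ?thesis using nonneg[of x] by simp
    next
      case 3
      then have "m \<le> w x" using y(2)[of x] by (simp add: m_def)
      moreover have "m * (E x - q) \<le> m * 1"
        using m q E1[of x] by (intro mult_left_mono) auto
      ultimately show ?thesis using lin[OF x] by simp
    qed
  qed
  then show ?thesis using k by blast
qed

text \<open>The point \<open>y\<close> may lie on the boundary, where \<open>G\<close> is only the
  continuous extension of the gradient. The mean value theorem on short segments starting at
  \<open>y\<close>, with continuity of \<open>G\<close>, carries the growth rate of \<open>v\<close>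
  over to \<open>G y\<close>.\<close>

lemma gradient_ge:
  fixes v :: "'a::euclidean_space \<Rightarrow> real"
  assumes "0 < \<tau>" and der: "\<And>t. 0 < t \<Longrightarrow> t < \<tau> \<Longrightarrow> GDERIV v (y + t *\<^sub>R h) :> G (y + t *\<^sub>R h)"
    and cont: "continuous_on S v" "continuous_on S G"
    and S: "\<And>t. 0 \<le> t \<Longrightarrow> t < \<tau> \<Longrightarrow> y + t *\<^sub>R h \<in> S"
    and ge: "\<And>t. 0 < t \<Longrightarrow> t < \<tau> \<Longrightarrow> \<kappa> * t \<le> v (y + t *\<^sub>R h) - v y"
  shows "\<kappa> \<le> h \<bullet> G y"
proof (rule ccontr)
  assume "\<not> \<kappa> \<le> h \<bullet> G y"
  then have "0 < \<kappa> - h \<bullet> G y" by simp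
  have "continuous_on {0..<\<tau>} (\<lambda>t. h \<bullet> G (y + t *\<^sub>R h))"
    by (intro continuous_intros continuous_on_compose2[OF cont(2)]) (use S in auto)
  then obtain d where d: "0 < d" "\<And>t. t \<in> {0..<\<tau>} \<Longrightarrow> dist t 0 < d \<Longrightarrow> dist (h \<bullet> G (y + t *\<^sub>R h)) (h \<bullet> G (y + 0 *\<^sub>R h)) < \<kappa> - h \<bullet> G y"
    unfolding continuous_on_iff using \<open>0 < \<kappa> - h \<bullet> G y\<close> \<open>0 < \<tau>\<close> by (metis atLeastLessThan_iff order_refl)
  define t where "t = min d \<tau> / 2"
  have t: "0 < t" "t < d" "t < \<tau>" using d(1) \<open>0 < \<tau>\<close> by (auto simp: t_def)
  have st: "0 \<le> s * t" "s * t \<le> t" if "0 \<le> s" "s \<le> 1" for s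
    using that t mult_left_le_one_le[of t s] by auto
  have "\<exists>s. 0 < s \<and> s < 1 \<and> v (y + t *\<^sub>R h) - v y = (t *\<^sub>R h) \<bullet> G (y + s *\<^sub>R t *\<^sub>R h)"
  proof (rule gderiv_mvt)
    show "GDERIV v (y + s *\<^sub>R t *\<^sub>R h) :> G (y + s *\<^sub>R t *\<^sub>R h)" if "0 < s" "s < 1" for s
      using der[of "s * t"] le_less_trans[OF st(2)[of s] t(3)] t that by simp
    show "continuous_on {0..1} (\<lambda>s. v (y + s *\<^sub>R t *\<^sub>R h))"
    proof (intro continuous_on_compose2[OF cont(1)] continuous_intros image_subsetI)
      fix s :: real assume "s \<in> {0..1}"
      then show "y + s *\<^sub>R t *\<^sub>R h \<in> S" using S[of "s * t"] le_less_trans[OF st(2)[of s] t(3)] t by simp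
    qed
  qed
  then obtain s where s: "0 < s" "s < 1" "v (y + t *\<^sub>R h) - v y = t * (h \<bullet> G (y + (s * t) *\<^sub>R h))" by auto
  have "\<kappa> * t \<le> t * (h \<bullet> G (y + (s * t) *\<^sub>R h))" using ge[of t] t s by simp
  then have "\<kappa> \<le> h \<bullet> G (y + (s * t) *\<^sub>R h)" using t by (simp add: mult.commute)
  moreover have "h \<bullet> G (y + (s * t) *\<^sub>R h) < \<kappa>"
    using d(2)[of "s * t"] le_less_trans[OF st(2)[of s] t(3)] le_less_trans[OF st(2)[of s] t(2)] s t by (simp add: dist_real_def)
  ultimately show False by simp
qed

text \<open>Along the radius from \<open>y\<close> to the centre the barrier gives growth at rate
  \<open>k * r\<close>, and \<open>gradient_ge\<close> transfers it to \<open>B y\<close>. As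
  \<open>S\<close> only has to contain the closed ball, \<open>y\<close> may be an interior minimum,
  a boundary point of the domain or a point of the moving plane.\<close>

lemma hopf_gradient:
  fixes w :: "'a::euclidean_space \<Rightarrow> real"
  assumes r: "0 < r" and S: "cball c r \<subseteq> S" and cont: "continuous_on S w" "continuous_on S B"
    and der: "\<And>x. x \<in> ball c r \<Longrightarrow> GDERIV w x :> B x"
    and sup: "superharmonic_gradient (ball c r) B"
    and pos: "\<And>x. x \<in> ball c r \<Longrightarrow> 0 < w x"
    and y: "dist c y = r" "w y = 0" and nonneg: "\<And>x. x \<in> sphere c r \<Longrightarrow> 0 \<le> w x"
  shows "0 < (c - y) \<bullet> B y"
proof -
  have cb: "continuous_on (cball c r) w" "continuous_on (ball c r) B"
    using continuous_on_subset[OF cont(1) S] continuous_on_subset[OF cont(2) order_trans[OF ball_subset_cball S]] by auto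
  obtain k where k: "0 < k" "\<And>x. r / 2 \<le> dist c x \<Longrightarrow> dist c x \<le> r \<Longrightarrow> k * (r - dist c x) \<le> w x"
    using hopf_barrier[OF r cb(1) der cb(2) sup pos nonneg] by blast
  have dist: "dist c (y + t *\<^sub>R (c - y)) = (1 - t) * r" if "0 \<le> t" "t < 1" for t
  proof -
    have "c - (y + t *\<^sub>R (c - y)) = (1 - t) *\<^sub>R (c - y)" by (simp add: algebra_simps)
    then show ?thesis using y(1) that by (simp add: dist_norm)
  qed
  \<comment> \<open>For \<open>t < 1/2\<close> the point on the radius stays in the annulus where
    the barrier bound holds.\<close>
  have "k * r \<le> (c - y) \<bullet> B y"
  proof (rule gradient_ge[where \<tau> = "1/2" and S = S and v = w and G = B and y = y and h = "c - y" and \<kappa> = "k * r"])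
    show "GDERIV w (y + t *\<^sub>R (c - y)) :> B (y + t *\<^sub>R (c - y))" if "0 < t" "t < 1/2" for t
      using dist[of t] that r by (intro der) auto
    show "y + t *\<^sub>R (c - y) \<in> S" if "0 \<le> t" "t < 1/2" for t
    proof -
      have "dist c (y + t *\<^sub>R (c - y)) \<le> r"
        using dist[of t] that r mult_left_le_one_le[of r "1 - t"] by simp
      then show ?thesis using S by auto
    qed
    show "k * r * t \<le> w (y + t *\<^sub>R (c - y)) - w y" if "0 < t" "t < 1/2" for t
    proof -
      have "1 / 2 * r \<le> (1 - t) * r" using that r by (intro mult_right_mono) auto
      moreover have "(1 - t) * r \<le> r" using that r mult_left_le_one_le[of r "1 - t"] by simp
      ultimately have "k * (r - (1 - t) * r) \<le> w (y + t *\<^sub>R (c - y))"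
        using k(2)[of "y + t *\<^sub>R (c - y)"] dist[of t] that by simp
      moreover have "k * (r - (1 - t) * r) = k * r * t" by (simp add: algebra_simps)
      ultimately show ?thesis using y(2) by simp
    qed
  qed (use cont in auto)
  moreover have "k * r > 0" using k r by simp
  ultimately show ?thesis by linarith
qed

text \<open>Hopf's argument: were \<open>w z \<noteq> 0\<close> for some \<open>z\<close> near
  \<open>x\<close>, let \<open>y\<close> be a zero of \<open>w\<close> closest to \<open>z\<close>.
  The open ball about \<open>z\<close> that reaches up to \<open>y\<close> contains no zero, so the
  boundary point lemma gives a nonzero gradient at \<open>y\<close>, which is an interior
  minimum.\<close>

lemma strong_maximum_principle:
  fixes w :: "'a::euclidean_space \<Rightarrow> real"
  assumes U: "open U" and der: "\<And>x. x \<in> U \<Longrightarrow> GDERIV w x :> B x" and B: "continuous_on U B"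
    and sup: "superharmonic_gradient U B" and nonneg: "\<And>x. x \<in> U \<Longrightarrow> 0 \<le> w x"
    and x: "x \<in> U" "w x = 0"
  shows "\<exists>e>0. \<forall>z\<in>ball x e. w z = 0"
proof -
  obtain e0 where e0: "0 < e0" "ball x e0 \<subseteq> U" using U x(1) openE by blast
  \<comment> \<open>Halving the radius keeps in \<open>U\<close> every closed ball about a point of
    \<open>ball x e\<close> that reaches up to \<open>x\<close>.\<close>
  define e where "e = e0 / 2"
  have e: "0 < e" "ball x (2 * e) \<subseteq> U" using e0 by (auto simp: e_def)
  have cw: "continuous_on U w" using GDERIV_imp_continuous[of U w B] der by blast
  have "w z = 0" if z: "z \<in> ball x e" for z
  proof (rule ccontr)
    assume "w z \<noteq> 0"
    define C where "C = {y \<in> cball z (dist z x). w y \<in> {0}}"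
    have sub: "cball z (dist z x) \<subseteq> U"
    proof
      fix y assume "y \<in> cball z (dist z x)"
      then have "dist x y < 2 * e"
        using z dist_triangle[of x y z] by (simp add: dist_commute)
      then show "y \<in> U" using e(2) by auto
    qed
    have "closed C" unfolding C_def
      using continuous_closed_preimage[OF continuous_on_subset[OF cw sub] closed_cball closed_singleton[of 0]]
      by (simp add: vimage_def Int_def)
    moreover have "x \<in> C" using x(2) by (simp add: C_def dist_commute)
    ultimately obtain y where y: "y \<in> C" "\<And>y'. y' \<in> C \<Longrightarrow> dist z y \<le> dist z y'"
      using distance_attains_inf[of C z] by blast
    define d where "d = dist z y"
    have yU: "y \<in> U" "w y = 0" using y(1) sub by (auto simp: C_def)
    have dx: "d \<le> dist z x" using y(1) by (simp add: C_def d_def)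
    have d: "d > 0" using yU \<open>w z \<noteq> 0\<close> by (auto simp: d_def)
    have cb: "cball z d \<subseteq> U" using sub dx by auto
    have pos: "0 < w y'" if "y' \<in> ball z d" for y'
    proof -
      have "w y' \<noteq> 0"
      proof
        assume "w y' = 0"
        then have "y' \<in> C" using that dx by (auto simp: C_def)
        from y(2)[OF this] show False using that by (simp add: d_def)
      qed
      moreover have "0 \<le> w y'" using nonneg[OF subsetD[OF cb]] that by auto
      ultimately show ?thesis by simp
    qed
    have "0 < (z - y) \<bullet> B y"
    proof (rule hopf_gradient[OF d cb cw B])
      show "superharmonic_gradient (ball z d) B"
        by (rule superharmonic_gradient_subset[OF sup]) (use cb in auto)
      show "GDERIV w x :> B x" if "x \<in> ball z d" for x
        using der[OF subsetD[OF cb]] that by auto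
      show "0 \<le> w x" if "x \<in> sphere z d" for x
        using nonneg[OF subsetD[OF cb]] that by auto
    qed (use pos yU in \<open>auto simp: d_def\<close>)
    \<comment> \<open>At a minimum the growth rate is nonnegative in every direction; the direction
      \<open>- (z - y)\<close> contradicts the boundary point lemma.\<close>
    moreover have "0 \<le> h \<bullet> B y" for h
    proof -
      obtain \<delta> where \<delta>: "0 < \<delta>" "ball y \<delta> \<subseteq> U" using U yU(1) openE by blast
      define \<tau> where "\<tau> = \<delta> / (norm h + 1)"
      have \<tau>: "0 < \<tau>" using \<delta> by (simp add: \<tau>_def add_nonneg_pos)
      have inU: "y + t *\<^sub>R h \<in> U" if "0 \<le> t" "t < \<tau>" for t
      proof -
        have "t * norm h \<le> t * (norm h + 1)" using that by (intro mult_left_mono) auto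
        also have "\<dots> < \<delta>" using that by (simp add: \<tau>_def pos_less_divide_eq add_nonneg_pos)
        finally have "y + t *\<^sub>R h \<in> ball y \<delta>" using that by (simp add: dist_norm)
        then show ?thesis using \<delta>(2) by blast
      qed
      show ?thesis
        by (rule gradient_ge[OF \<tau> der cw B inU]) (use inU nonneg yU in auto)
    qed
    from this[of "- (z - y)"] have "(z - y) \<bullet> B y \<le> 0" by (metis inner_minus_left neg_0_le_iff_le)
    ultimately show False by simp
  qed
  then show ?thesis using e(1) by blast
qed

section \<open>Geometry of the moving plane\<close>

lemma closure_seqE:
  fixes S :: "'a::euclidean_space set"
  assumes "x \<in> closure S"
  obtains X where "\<And>n::nat. X n \<in> S" "X \<longlonglongrightarrow> x"
  using assms unfolding closure_sequential by blast

lemma closure_seqI: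
  fixes S :: "'a::euclidean_space set"
  assumes "\<And>n::nat. X n \<in> closure S" "X \<longlonglongrightarrow> x"
  shows "x \<in> closure S"
  using closed_sequentially[OF closed_closure assms] .

lemma continuous_on_seq:
  fixes v :: "'a::euclidean_space \<Rightarrow> 'b::topological_space"
  assumes "continuous_on S v" "x \<in> S" "\<And>n::nat. X n \<in> S" "X \<longlonglongrightarrow> x"
  shows "(\<lambda>n. v (X n)) \<longlonglongrightarrow> v x"
  by (rule continuous_on_tendsto_compose[OF assms(1) assms(4,2)]) (use assms(3) in auto)

text \<open>An open half-space lies in a closed one, so \<open>n\<close> is a nonnegative multiple
  of \<open>g\<close>; only the sign is extracted. The vector
  \<open>\<tau> *\<^sub>R g - \<nu>\<close> refutes the contrary, with \<tau> so small that
  \<open>\<tau> * (g \<bullet> n)\<close> is at most half of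
  \<open>\<nu> \<bullet> n\<close>.\<close>

lemma halfspace_sign:
  fixes g n \<nu> :: "'a::euclidean_space"
  assumes g: "g \<noteq> 0" and imp: "\<And>d. 0 < d \<bullet> g \<Longrightarrow> 0 \<le> d \<bullet> n" and \<nu>: "0 < \<nu> \<bullet> n"
  shows "0 < \<nu> \<bullet> g"
proof (rule ccontr)
  assume "\<not> 0 < \<nu> \<bullet> g"
  define m where "m = \<bar>g \<bullet> n\<bar> + 1"
  have m: "0 < m" "g \<bullet> n \<le> m" by (auto simp: m_def)
  define \<tau> where "\<tau> = (\<nu> \<bullet> n) / (2 * m)"
  have \<tau>: "0 < \<tau>" using \<nu> m by (simp add: \<tau>_def)
  have "0 < \<tau> * (g \<bullet> g)" using \<tau> g by simp
  then have "0 < (\<tau> *\<^sub>R g - \<nu>) \<bullet> g" using \<open>\<not> 0 < \<nu> \<bullet> g\<close> by (simp add: inner_diff_left)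
  then have "\<nu> \<bullet> n \<le> \<tau> * (g \<bullet> n)" using imp[of "\<tau> *\<^sub>R g - \<nu>"] by (simp add: inner_diff_left)
  also have "\<dots> \<le> \<tau> * m" using \<tau> m by (intro mult_left_mono) auto
  also have "\<dots> = (\<nu> \<bullet> n) / 2" using m by (simp add: \<tau>_def)
  finally show False using \<nu> by simp
qed

lemma reflection_inner: "norm \<nu> = 1 \<Longrightarrow> reflection \<nu> l x \<bullet> \<nu> = 2 * l - x \<bullet> \<nu>"
  by (simp add: reflection_def inner_add_left dot_square_norm algebra_simps)

lemma reflection_reflection: "norm \<nu> = 1 \<Longrightarrow> reflection \<nu> l (reflection \<nu> l x) = x"
  unfolding reflection_def[of \<nu> l "reflection \<nu> l x"] reflection_inner
  by (simp add: reflection_def scaleR_add_left[symmetric])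

lemma reflection_fixed: "x \<bullet> \<nu> = l \<Longrightarrow> reflection \<nu> l x = x"
  by (simp add: reflection_def)

lemma tendsto_reflection:
  assumes "(L \<longlongrightarrow> l) F" "(X \<longlongrightarrow> x) F"
  shows "((\<lambda>n. reflection \<nu> (L n) (X n)) \<longlongrightarrow> reflection \<nu> l x) F"
  unfolding reflection_def by (intro tendsto_intros assms)

lemma continuous_on_reflection: "continuous_on S (reflection \<nu> l)"
  unfolding reflection_def by (intro continuous_intros)

text \<open>The linear part of \<open>reflection\<close>, the same for all levels \<open>l\<close>;
  it acts on gradients and on fluxes.\<close>

definition mirror :: "'a::euclidean_space \<Rightarrow> 'a \<Rightarrow> 'a" where
  "mirror \<nu> z = z - (2 * (z \<bullet> \<nu>)) *\<^sub>R \<nu>"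

lemma norm_mirror:
  assumes "norm \<nu> = 1"
  shows "norm (mirror \<nu> z) = norm z"
proof -
  have "\<nu> \<bullet> \<nu> = 1" using assms by (simp add: dot_square_norm)
  then have "mirror \<nu> z \<bullet> mirror \<nu> z = z \<bullet> z"
    by (simp add: mirror_def inner_diff_left inner_diff_right inner_commute[of \<nu> z])
  then show ?thesis by (simp add: norm_eq_sqrt_inner)
qed

lemma bounded_subsequence:
  fixes X :: "nat \<Rightarrow> 'a::euclidean_space"
  assumes "bounded S" "\<And>n. X n \<in> S"
  shows "\<exists>r x. strict_mono (r :: nat \<Rightarrow> nat) \<and> x \<in> closure S \<and> (X \<circ> r) \<longlonglongrightarrow> x"
proof -
  have "seq_compact (closure S)" using assms(1) compact_closure compact_imp_seq_compact by blast
  moreover have "\<forall>n. X n \<in> closure S" using assms(2) closure_subset by blast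
  ultimately show ?thesis unfolding seq_compact_def by blast
qed

text \<open>The continuation argument for an arbitrary property: \<open>b\<close> is the infimum of
  the bad levels, and compactness lets bad points at levels tending to \<open>b\<close> converge.
  The case \<open>b = a\<close> is included, so the start of the procedure is not separated from its
  continuation.\<close>

lemma first_bad_point:
  fixes Bad :: "real \<Rightarrow> 'a::euclidean_space \<Rightarrow> bool"
  assumes "bounded S" "a < l0" "l0 < \<mu>" "y0 \<in> S" "Bad l0 y0"
  obtains b x L X where "a \<le> b" "b < \<mu>" "x \<in> closure S"
    "\<And>l y. a < l \<Longrightarrow> l < b \<Longrightarrow> y \<in> S \<Longrightarrow> \<not> Bad l y"
    "L \<longlonglongrightarrow> b" "X \<longlonglongrightarrow> x"
    "\<And>n::nat. X n \<in> S" "\<And>n. a < L n" "\<And>n. L n < \<mu>" "\<And>n. Bad (L n) (X n)"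
proof -
  define A where "A = {l. a < l \<and> l < \<mu> \<and> (\<exists>y\<in>S. Bad l y)}"
  have A: "l0 \<in> A" "bdd_below A" using assms by (auto simp: A_def intro: bdd_belowI[of _ a])
  define b where "b = Inf A"
  have ab: "a \<le> b" unfolding b_def using A(1) by (intro cInf_greatest) (auto simp: A_def)
  have "b \<le> l0" unfolding b_def using A by (intro cInf_lower)
  then have b\<mu>: "b < \<mu>" using assms(3) by simp
  have good: "\<not> Bad l y" if "a < l" "l < b" "y \<in> S" for l y
  proof
    assume "Bad l y"
    then have "l \<in> A" using that b\<mu> by (auto simp: A_def)
    then have "b \<le> l" unfolding b_def using A by (intro cInf_lower)
    then show False using that by simp
  qed
  have "\<exists>l\<in>A. l < b + 1 / real (Suc n)" for n
    using cInf_lessD[of A "b + 1 / real (Suc n)"] A(1) by (auto simp: b_def)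
  then obtain L where L: "\<And>n. L n \<in> A" "\<And>n. L n < b + 1 / real (Suc n)" by metis
  have bL: "b \<le> L n" for n unfolding b_def using A L by (intro cInf_lower)
  have L_lim: "L \<longlonglongrightarrow> b"
  proof (rule tendsto_sandwich[of "\<lambda>n. b" _ _ "\<lambda>n. b + 1 / real (Suc n)"])
    show "(\<lambda>n. b + 1 / real (Suc n)) \<longlonglongrightarrow> b"
      using tendsto_add[OF tendsto_const LIMSEQ_Suc[OF lim_1_over_n], of b] by simp
    show "\<forall>\<^sub>F n in sequentially. L n \<le> b + 1 / real (Suc n)"
      using less_imp_le[OF L(2)] by (intro always_eventually allI)
  qed (use bL in auto)
  have "\<forall>n. \<exists>y. y \<in> S \<and> Bad (L n) y" using L(1) unfolding A_def by blast
  from choice[OF this] obtain X where X: "\<And>n. X n \<in> S" "\<And>n. Bad (L n) (X n)" by blast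
  obtain r x where r: "strict_mono (r :: nat \<Rightarrow> nat)" "x \<in> closure S" "(X \<circ> r) \<longlonglongrightarrow> x"
    using bounded_subsequence[of S X, OF assms(1) X(1)] by blast
  show ?thesis
  proof (rule that[OF ab b\<mu> r(2) good _ r(3)])
    show "(L \<circ> r) \<longlonglongrightarrow> b" using LIMSEQ_subseq_LIMSEQ[OF L_lim r(1)] .
  qed (use X L in \<open>auto simp: A_def\<close>)
qed

text \<open>\<open>G\<close> is the gradient inside \<Omega> together with its continuous extension
  to the closure; at boundary points the extension takes the place of a derivative. Both unknowns
  satisfy these assumptions.\<close>

locale positive_C1_0 =
  fixes \<Omega> :: "'a::euclidean_space set" and v :: "'a \<Rightarrow> real" and G :: "'a \<Rightarrow> 'a"
  assumes dom: "bounded_domain \<Omega>"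
    and contv: "continuous_on (closure \<Omega>) v" and contG: "continuous_on (closure \<Omega>) G"
    and der: "\<And>x. x \<in> \<Omega> \<Longrightarrow> GDERIV v x :> G x"
    and zero: "\<And>x. x \<in> frontier \<Omega> \<Longrightarrow> v x = 0"
    and pos: "\<And>x. x \<in> \<Omega> \<Longrightarrow> 0 < v x"
begin

lemma domain: "open \<Omega>" "bounded \<Omega>" "\<Omega> \<noteq> {}"
  using dom by (auto simp: bounded_domain_def)

lemma frontier_iff: "x \<in> frontier \<Omega> \<longleftrightarrow> x \<in> closure \<Omega> \<and> x \<notin> \<Omega>"
  using domain(1) by (simp add: frontier_def interior_open)

lemma in_closure: "x \<in> \<Omega> \<Longrightarrow> x \<in> closure \<Omega>"
  using closure_subset by blast

lemma nonneg: "x \<in> closure \<Omega> \<Longrightarrow> 0 \<le> v x"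
  using pos[of x] zero[of x] frontier_iff[of x] by force

text \<open>While the path stays in \<Omega>, \<open>v\<close> grows along it at rate at least
  \<kappa>. At a first exit point \<open>v\<close> would vanish, although it started positive and
  has grown; so the path does not leave. The rate does not depend on \<open>y\<close>, and therefore
  survives a passage to boundary points.\<close>

lemma cone_interior:
  assumes x: "x \<in> closure \<Omega>" and d: "0 < d \<bullet> G x"
  shows "\<exists>\<delta>>0. \<exists>\<kappa>>0. \<forall>y\<in>\<Omega>. dist x y < \<delta> \<longrightarrow> (\<forall>t. 0 < t \<and> t < \<delta> \<longrightarrow>
    y + t *\<^sub>R d \<in> \<Omega> \<and> v y + \<kappa> * t \<le> v (y + t *\<^sub>R d))"
proof -
  define \<kappa> where "\<kappa> = d \<bullet> G x / 2"
  have \<kappa>: "\<kappa> > 0" using d by (simp add: \<kappa>_def)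
  have "continuous_on (closure \<Omega>) (\<lambda>z. d \<bullet> G z)" by (intro continuous_intros contG)
  then obtain e where e: "0 < e" "\<And>z. z \<in> closure \<Omega> \<Longrightarrow> dist z x < e \<Longrightarrow> dist (d \<bullet> G z) (d \<bullet> G x) < \<kappa>"
    unfolding continuous_on_iff using x \<kappa> by metis
  have ge: "\<kappa> \<le> d \<bullet> G z" if "z \<in> closure \<Omega>" "dist z x < e" for z
    using e(2)[OF that] unfolding dist_real_def \<kappa>_def by linarith
  define \<delta> where "\<delta> = e / (norm d + 2)"
  have nd: "norm d + 2 > 0" by (simp add: add_nonneg_pos)
  have \<delta>: "\<delta> > 0" using e nd by (simp add: \<delta>_def)
  have near: "dist (y + s *\<^sub>R d) x < e" if "dist x y < \<delta>" "0 \<le> s" "s < \<delta>" for y s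
  proof -
    have "dist (y + s *\<^sub>R d) x \<le> dist (y + s *\<^sub>R d) y + dist y x" by (rule dist_triangle)
    also have "dist (y + s *\<^sub>R d) y = s * norm d" using that by (simp add: dist_norm)
    also have "s * norm d \<le> \<delta> * norm d" using that by (intro mult_right_mono) auto
    also have "\<delta> * norm d + dist y x < \<delta> * norm d + \<delta> * 2" using that \<delta> by (simp add: dist_commute)
    also have "\<dots> = \<delta> * (norm d + 2)" by (simp add: algebra_simps)
    also have "\<dots> = e" using nd by (simp add: \<delta>_def)
    finally show ?thesis by simp
  qed
  have inc: "y + s *\<^sub>R d \<in> closure \<Omega> \<and> v y + \<kappa> * s \<le> v (y + s *\<^sub>R d)"
    if y: "dist x y < \<delta>" and s: "0 < s" "s < \<delta>" and sub: "\<And>r. 0 \<le> r \<Longrightarrow> r < s \<Longrightarrow> y + r *\<^sub>R d \<in> \<Omega>" for y s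
  proof -
    have "((\<lambda>r. y + r *\<^sub>R d) \<longlongrightarrow> y + s *\<^sub>R d) (at_left s)" by (intro tendsto_intros)
    moreover have "\<forall>\<^sub>F r in at_left s. y + r *\<^sub>R d \<in> closure \<Omega>"
      using eventually_at_left_real[OF s(1)] by eventually_elim (use sub in \<open>auto intro: in_closure\<close>)
    ultimately have cl: "y + s *\<^sub>R d \<in> closure \<Omega>"
      using Lim_in_closed_set[OF closed_closure _ trivial_limit_at_left_real] by fast
    have "\<exists>r. 0 < r \<and> r < 1 \<and> v (y + s *\<^sub>R d) - v y = (s *\<^sub>R d) \<bullet> G (y + r *\<^sub>R s *\<^sub>R d)"
    proof (rule gderiv_mvt)
      show "GDERIV v (y + r *\<^sub>R s *\<^sub>R d) :> G (y + r *\<^sub>R s *\<^sub>R d)" if "0 < r" "r < 1" for r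
        using der[OF sub[of "r * s"]] that s by simp
      show "continuous_on {0..1} (\<lambda>r. v (y + r *\<^sub>R s *\<^sub>R d))"
      proof (intro continuous_on_compose2[OF contv] continuous_intros image_subsetI)
        fix r :: real assume "r \<in> {0..1}"
        then show "y + r *\<^sub>R s *\<^sub>R d \<in> closure \<Omega>"
          using in_closure[OF sub[of "r * s"]] s cl by (cases "r = 1") auto
      qed
    qed
    then obtain r where r: "0 < r" "r < 1" "v (y + s *\<^sub>R d) - v y = s * (d \<bullet> G (y + (r * s) *\<^sub>R d))" by auto
    have rs: "0 \<le> r * s" "r * s < s" using r s by auto
    have "\<kappa> \<le> d \<bullet> G (y + (r * s) *\<^sub>R d)"
      using rs(1) rs(2) less_trans[OF rs(2) s(2)] by (intro ge in_closure sub near y)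
    then have "s * \<kappa> \<le> s * (d \<bullet> G (y + (r * s) *\<^sub>R d))" using s by (intro mult_left_mono) auto
    then show ?thesis using cl r(3) by (simp add: mult.commute)
  qed
  have mem: "y + t *\<^sub>R d \<in> \<Omega>" if y: "y \<in> \<Omega>" "dist x y < \<delta>" and t: "0 \<le> t" "t < \<delta>" for y t
  proof (rule ccontr)
    assume out: "y + t *\<^sub>R d \<notin> \<Omega>"
    define C where "C = {s \<in> {0..t}. y + s *\<^sub>R d \<in> - \<Omega>}"
    have "closed C" unfolding C_def
      using continuous_closed_preimage[of "{0..t}" "\<lambda>s. y + s *\<^sub>R d" "- \<Omega>"] domain(1)
      by (simp add: vimage_def Int_def closed_Compl continuous_intros)
    moreover have "bounded C" unfolding C_def by (rule bounded_subset[OF bounded_closed_interval]) auto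
    moreover have "t \<in> C" using out t by (simp add: C_def)
    ultimately obtain s where s: "s \<in> C" "\<And>s'. s' \<in> C \<Longrightarrow> s \<le> s'"
      using compact_attains_inf[of C] compact_eq_bounded_closed by blast
    have "s \<noteq> 0" using s(1) y(1) by (auto simp: C_def)
    then have s0: "0 < s" "s < \<delta>" using s(1) t by (auto simp: C_def)
    have "y + r *\<^sub>R d \<in> \<Omega>" if "0 \<le> r" "r < s" for r
      using s(1) s(2)[of r] that by (force simp: C_def)
    from inc[OF y(2) s0 this] have "y + s *\<^sub>R d \<in> closure \<Omega>" "v y + \<kappa> * s \<le> v (y + s *\<^sub>R d)" by auto
    moreover have "y + s *\<^sub>R d \<notin> \<Omega>" using s(1) by (simp add: C_def)
    ultimately have "v y + \<kappa> * s \<le> 0" using zero[of "y + s *\<^sub>R d"] frontier_iff by auto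
    moreover have "0 < \<kappa> * s" using \<kappa> s0 by simp
    ultimately show False using pos[OF y(1)] by simp
  qed
  show ?thesis
    using mem inc \<delta> \<kappa> by (intro exI[of _ \<delta>] conjI exI[of _ \<kappa>]) auto
qed

text \<open>Points of the closure are limits of interior ones. The gain \<open>\<kappa> * t\<close>
  persists in the limit, so \<open>v\<close> is positive at \<open>y + t *\<^sub>R d\<close>, which
  is therefore not a boundary point.\<close>

lemma cone:
  assumes x: "x \<in> closure \<Omega>" and d: "0 < d \<bullet> G x"
  obtains \<delta> where "\<delta> > 0"
    "\<And>y t. y \<in> closure \<Omega> \<Longrightarrow> dist x y < \<delta> \<Longrightarrow> 0 < t \<Longrightarrow> t < \<delta> \<Longrightarrow> y + t *\<^sub>R d \<in> \<Omega> \<and> v y < v (y + t *\<^sub>R d)"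
proof -
  obtain \<delta> \<kappa> where \<delta>: "\<delta> > 0" "\<kappa> > 0" and *: "\<And>y t. y \<in> \<Omega> \<Longrightarrow> dist x y < \<delta> \<Longrightarrow> 0 < t \<Longrightarrow> t < \<delta> \<Longrightarrow>
      y + t *\<^sub>R d \<in> \<Omega> \<and> v y + \<kappa> * t \<le> v (y + t *\<^sub>R d)"
    using cone_interior[OF assms] by blast
  have "y + t *\<^sub>R d \<in> \<Omega> \<and> v y < v (y + t *\<^sub>R d)"
    if y: "y \<in> closure \<Omega>" "dist x y < \<delta>" and t: "0 < t" "t < \<delta>" for y t
  proof -
    obtain Y where Y: "\<And>n. Y n \<in> \<Omega>" "Y \<longlonglongrightarrow> y" using closure_seqE[OF y(1)] by blast
    have "(\<lambda>n. dist x (Y n)) \<longlonglongrightarrow> dist x y" by (intro tendsto_intros Y)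
    then have "\<forall>\<^sub>F n in sequentially. dist x (Y n) < \<delta>" using y(2) by (rule order_tendstoD)
    then obtain N where N: "\<And>n. n \<ge> N \<Longrightarrow> dist x (Y n) < \<delta>" by (auto simp: eventually_sequentially)
    define Z where "Z = (\<lambda>n. Y (n + N))"
    have Z: "\<And>n. Z n \<in> \<Omega>" "\<And>n. dist x (Z n) < \<delta>" "Z \<longlonglongrightarrow> y"
      using Y N LIMSEQ_ignore_initial_segment[OF Y(2)] by (auto simp: Z_def)
    have lim: "(\<lambda>n. Z n + t *\<^sub>R d) \<longlonglongrightarrow> y + t *\<^sub>R d" by (intro tendsto_intros Z)
    have mem: "Z n + t *\<^sub>R d \<in> closure \<Omega>" for n using *[OF Z(1,2) t] in_closure by blast
    have cl: "y + t *\<^sub>R d \<in> closure \<Omega>" using closure_seqI[OF mem lim] .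
    have "(\<lambda>n. v (Z n + t *\<^sub>R d)) \<longlonglongrightarrow> v (y + t *\<^sub>R d)" by (rule continuous_on_seq[OF contv cl mem lim])
    moreover have "(\<lambda>n. v (Z n) + \<kappa> * t) \<longlonglongrightarrow> v y + \<kappa> * t"
      by (intro tendsto_intros continuous_on_seq[OF contv y(1) in_closure[OF Z(1)] Z(3)])
    ultimately have ge: "v y + \<kappa> * t \<le> v (y + t *\<^sub>R d)"
      using *[OF Z(1,2) t] by (intro LIMSEQ_le) auto
    have "0 < \<kappa> * t" using \<delta> t by simp
    then show ?thesis using ge nonneg[OF y(1)] zero[of "y + t *\<^sub>R d"] frontier_iff[of "y + t *\<^sub>R d"] cl by force
  qed
  then show ?thesis using that \<delta>(1) by blast
qed

text \<open>The reflection moves \<open>X n\<close> by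
  \<open>2 * (L n - X n \<bullet> \<nu>)\<close> along \<nu>, a positive length tending to 0, so
  \<open>cone\<close> applies. This excludes bad points that accumulate on the plane.\<close>

lemma near_plane:
  assumes \<nu>: "norm \<nu> = 1" and x: "x \<in> closure \<Omega>" "x \<bullet> \<nu> = b" "0 < \<nu> \<bullet> G x"
    and X: "X \<longlonglongrightarrow> x" "L \<longlonglongrightarrow> b" "\<And>n::nat. X n \<in> \<Omega>" "\<And>n. X n \<bullet> \<nu> < L n"
  shows "\<exists>n. reflection \<nu> (L n) (X n) \<in> \<Omega> \<and> v (X n) < v (reflection \<nu> (L n) (X n))"
proof -
  obtain \<delta> where \<delta>: "\<delta> > 0"
    "\<And>y t. y \<in> closure \<Omega> \<Longrightarrow> dist x y < \<delta> \<Longrightarrow> 0 < t \<Longrightarrow> t < \<delta> \<Longrightarrow> y + t *\<^sub>R \<nu> \<in> \<Omega> \<and> v y < v (y + t *\<^sub>R \<nu>)"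
    using cone[OF x(1,3)] by blast
  have "(\<lambda>n. dist x (X n)) \<longlonglongrightarrow> dist x x" by (intro tendsto_intros X)
  then have 1: "\<forall>\<^sub>F n in sequentially. dist x (X n) < \<delta>" by (rule order_tendstoD) (use \<delta> in simp)
  have "(\<lambda>n. 2 * (L n - X n \<bullet> \<nu>)) \<longlonglongrightarrow> 2 * (b - x \<bullet> \<nu>)" by (intro tendsto_intros X)
  then have 2: "\<forall>\<^sub>F n in sequentially. 2 * (L n - X n \<bullet> \<nu>) < \<delta>" by (rule order_tendstoD) (use \<delta> x in simp)
  obtain n where "dist x (X n) < \<delta>" "2 * (L n - X n \<bullet> \<nu>) < \<delta>"
    using eventually_happens[OF eventually_conj[OF 1 2]] by auto
  then show ?thesis
    using \<delta>(2)[OF in_closure[OF X(3)], of n "2 * (L n - X n \<bullet> \<nu>)"] X(4)[of n]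
    by (intro exI[of _ n]) (simp add: reflection_def)
qed

end

locale nondegenerate_C1_0 = positive_C1_0 +
  assumes hopf: "\<And>x. x \<in> frontier \<Omega> \<Longrightarrow> G x \<noteq> 0"
begin

text \<open>If a point just behind \<open>x\<close> belonged to the closure, \<open>cone\<close>
  would carry it forward to \<open>x\<close> and place \<open>x\<close> in \<Omega>.\<close>

lemma frontier_cone:
  assumes "x \<in> frontier \<Omega>" "0 < d \<bullet> G x"
  obtains \<delta> where "\<delta> > 0" "\<And>t. 0 < t \<Longrightarrow> t < \<delta> \<Longrightarrow> x + t *\<^sub>R d \<in> \<Omega>"
    "\<And>t. 0 < t \<Longrightarrow> t < \<delta> \<Longrightarrow> x - t *\<^sub>R d \<notin> closure \<Omega>"
proof -
  have x: "x \<in> closure \<Omega>" "x \<notin> \<Omega>" using assms(1) frontier_iff by auto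
  obtain \<delta> where \<delta>: "\<delta> > 0"
    "\<And>y t. y \<in> closure \<Omega> \<Longrightarrow> dist x y < \<delta> \<Longrightarrow> 0 < t \<Longrightarrow> t < \<delta> \<Longrightarrow> y + t *\<^sub>R d \<in> \<Omega> \<and> v y < v (y + t *\<^sub>R d)"
    using cone[OF x(1) assms(2)] by blast
  define \<delta>' where "\<delta>' = \<delta> / (norm d + 1)"
  have nd: "norm d + 1 > 0" by (simp add: add_nonneg_pos)
  have \<delta>': "0 < \<delta>'" "\<delta>' \<le> \<delta>" using \<delta>(1) nd by (auto simp: \<delta>'_def divide_simps)
  have "x - t *\<^sub>R d \<notin> closure \<Omega>" if t: "0 < t" "t < \<delta>'" for t
  proof
    assume *: "x - t *\<^sub>R d \<in> closure \<Omega>"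
    have "t * norm d \<le> t * (norm d + 1)" using t by simp
    also have "\<dots> < \<delta>" using t nd by (simp add: \<delta>'_def pos_less_divide_eq)
    finally have "dist x (x - t *\<^sub>R d) < \<delta>" using t by (simp add: dist_norm)
    from \<delta>(2)[OF * this t(1)] show False using t \<delta>' x by simp
  qed
  then show ?thesis using that[of \<delta>'] \<delta>' \<delta>(2)[OF x(1)] \<delta>(1) by simp
qed

text \<open>Slits are impossible, since moving backwards along \<open>G x\<close> from a boundary
  point leaves the closure. This serves to turn inclusion of an open set in the closure into
  inclusion in \<Omega>.\<close>

lemma interior_closure: "interior (closure \<Omega>) = \<Omega>"
proof
  show "interior (closure \<Omega>) \<subseteq> \<Omega>"
  proof
    fix x assume x: "x \<in> interior (closure \<Omega>)"
    show "x \<in> \<Omega>"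
    proof (rule ccontr)
      assume "x \<notin> \<Omega>"
      then have fr: "x \<in> frontier \<Omega>" using x interior_subset frontier_iff by blast
      then have "0 < G x \<bullet> G x" using hopf by simp
      then obtain \<delta> where \<delta>: "\<delta> > 0" "\<And>t. 0 < t \<Longrightarrow> t < \<delta> \<Longrightarrow> x - t *\<^sub>R G x \<notin> closure \<Omega>"
        using frontier_cone[OF fr] by metis
      have "((\<lambda>t. x - t *\<^sub>R G x) \<longlongrightarrow> x - 0 *\<^sub>R G x) (at_right 0)" by (intro tendsto_intros)
      then have "\<forall>\<^sub>F t in at_right 0. x - t *\<^sub>R G x \<in> interior (closure \<Omega>)"
        using x by (intro topological_tendstoD) auto
      then have "\<forall>\<^sub>F t in at_right (0::real). False"
        using eventually_at_right_real[OF \<delta>(1)]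
        by eventually_elim (use \<delta>(2) interior_subset in \<open>fastforce\<close>)
      then show False by (simp add: trivial_limit_at_right_real)
    qed
  qed
  show "\<Omega> \<subseteq> interior (closure \<Omega>)" using domain(1) by (simp add: interior_maximal closure_subset)
qed

text \<open>Directions \<open>d\<close> with \<open>0 < d \<bullet> G x\<close> enter \<Omega>,
  whereas those with \<open>d \<bullet> n < 0\<close> leave it to first order, so one half-space
  lies in the other. This links the classical normal in \<open>Lambda1\<close> to the gradient of
  \<open>v\<close>.\<close>

lemma inward_normal_sign:
  assumes x: "x \<in> frontier \<Omega>" and n: "inward_unit_normal \<Omega> x n" and \<nu>: "0 < \<nu> \<bullet> n"
  shows "0 < \<nu> \<bullet> G x"
proof (rule halfspace_sign[OF hopf[OF x] _ \<nu>])
  fix d assume d: "0 < d \<bullet> G x"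
  show "0 \<le> d \<bullet> n"
  proof (rule ccontr)
    assume dn: "\<not> 0 \<le> d \<bullet> n"
    have d0: "norm d > 0" using d by auto
    \<comment> \<open>Half the cosine of the angle between \<open>- d\<close> and \<open>n\<close>,
      so that a displacement along \<open>d\<close> falls strictly below the tolerance.\<close>
    define e where "e = - (d \<bullet> n) / (2 * norm d)"
    have e: "e > 0" using dn d0 by (simp add: e_def divide_neg_pos)
    obtain \<delta>1 where \<delta>1: "\<delta>1 > 0" "\<And>t. 0 < t \<Longrightarrow> t < \<delta>1 \<Longrightarrow> x + t *\<^sub>R d \<in> \<Omega>"
      using frontier_cone[OF x d] by metis
    obtain \<delta>2 where \<delta>2: "\<delta>2 > 0" "\<And>y. y \<in> ball x \<delta>2 \<Longrightarrow> (y - x) \<bullet> n < - (e * norm (y - x)) \<Longrightarrow> y \<notin> \<Omega>"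
      using n e unfolding inward_unit_normal_def by meson
    define t where "t = min \<delta>1 (\<delta>2 / norm d) / 2"
    have "min a b / 2 < a" "min a b / 2 < b" if "0 < a" "0 < b" for a b :: real
      using that by auto
    moreover have "0 < \<delta>2 / norm d" using \<delta>2(1) d0 by simp
    ultimately have t: "0 < t" "t < \<delta>1" "t < \<delta>2 / norm d"
      using \<delta>1(1) unfolding t_def by (blast intro: divide_pos_pos zero_less_numeral min_less_iff_conj[THEN iffD2])+
    have "x + t *\<^sub>R d \<in> ball x \<delta>2" using t d0 by (simp add: dist_norm pos_less_divide_eq)
    moreover have "e * norm (x + t *\<^sub>R d - x) = t * (- (d \<bullet> n) / 2)" using t d0 by (simp add: e_def)
    moreover have "t * (d \<bullet> n) < t * (d \<bullet> n / 2)" using t dn by (intro mult_strict_left_mono) auto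
    ultimately have "x + t *\<^sub>R d \<notin> \<Omega>" by (intro \<delta>2(2)) auto
    then show False using \<delta>1(2) t by blast
  qed
qed

section \<open>Caps and their reflections in a fixed direction\<close>

context
  fixes \<nu> :: 'a assumes \<nu>: "norm \<nu> = 1"
begin

lemma a_inf_le: "x \<in> closure \<Omega> \<Longrightarrow> a_inf \<Omega> \<nu> \<le> x \<bullet> \<nu>"
proof -
  obtain B where "\<And>x. x \<in> \<Omega> \<Longrightarrow> norm x \<le> B" using domain(2) by (auto simp: bounded_iff)
  then have "- B \<le> x \<bullet> \<nu>" if "x \<in> \<Omega>" for x
    using Cauchy_Schwarz_ineq2[of x \<nu>] \<nu> that by fastforce
  then have "bdd_below ((\<lambda>x. x \<bullet> \<nu>) ` \<Omega>)" by (intro bdd_belowI2)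
  then have "\<Omega> \<subseteq> {x. a_inf \<Omega> \<nu> \<le> x \<bullet> \<nu>}" unfolding a_inf_def by (auto intro: cINF_lower)
  then have "closure \<Omega> \<subseteq> {x. a_inf \<Omega> \<nu> \<le> x \<bullet> \<nu>}"
    by (rule closure_minimal) (simp add: closed_halfspace_component_ge closed_Collect_le continuous_intros)
  then show "x \<in> closure \<Omega> \<Longrightarrow> a_inf \<Omega> \<nu> \<le> x \<bullet> \<nu>" by blast
qed

lemma a_inf_less:
  assumes "x \<in> \<Omega>" shows "a_inf \<Omega> \<nu> < x \<bullet> \<nu>"
proof -
  obtain e where e: "0 < e" "ball x e \<subseteq> \<Omega>" using domain(1) assms openE by blast
  have "x - (e / 2) *\<^sub>R \<nu> \<in> \<Omega>" using e \<nu> by (intro subsetD[OF e(2)]) (simp add: dist_norm)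
  then have "a_inf \<Omega> \<nu> \<le> (x - (e / 2) *\<^sub>R \<nu>) \<bullet> \<nu>" using a_inf_le in_closure by blast
  then show ?thesis using e \<nu> by (simp add: inner_diff_left dot_square_norm)
qed

text \<open>At a lowest point every direction into \<Omega> has a nonnegative component along \<nu>,
  so \<open>halfspace_sign\<close> applies with \<nu> in the place of the normal. This is what
  starts the moving plane.\<close>

lemma gradient_at_minimum:
  assumes "x \<in> closure \<Omega>" "x \<bullet> \<nu> = a_inf \<Omega> \<nu>"
  shows "0 < \<nu> \<bullet> G x"
proof -
  have x: "x \<in> frontier \<Omega>" using assms a_inf_less frontier_iff by fastforce
  show ?thesis
  proof (rule halfspace_sign[OF hopf[OF x]])
    fix d assume "0 < d \<bullet> G x"
    then obtain \<delta> where \<delta>: "\<delta> > 0" "\<And>t. 0 < t \<Longrightarrow> t < \<delta> \<Longrightarrow> x + t *\<^sub>R d \<in> \<Omega>"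
      using frontier_cone[OF x] by metis
    then have "x + (\<delta> / 2) *\<^sub>R d \<in> \<Omega>" by simp
    from a_inf_less[OF this] have "0 < \<delta> / 2 * (d \<bullet> \<nu>)" using assms(2) by (simp add: inner_add_left)
    then show "0 \<le> d \<bullet> \<nu>" using \<delta>(1) by (simp add: zero_less_mult_iff)
  qed (use \<nu> in \<open>simp add: dot_square_norm\<close>)
qed

lemma closure_cap_reflection:
  assumes "reflected_cap \<Omega> \<nu> l \<subseteq> \<Omega>" "x \<in> closure (cap \<Omega> \<nu> l)"
  shows "reflection \<nu> l x \<in> closure \<Omega>"
proof -
  obtain X where X: "\<And>n. X n \<in> cap \<Omega> \<nu> l" "X \<longlonglongrightarrow> x" using closure_seqE[OF assms(2)] by blast
  show ?thesis
  proof (rule closure_seqI)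
    show "(\<lambda>n. reflection \<nu> l (X n)) \<longlonglongrightarrow> reflection \<nu> l x" by (intro tendsto_reflection tendsto_const X)
    show "reflection \<nu> l (X n) \<in> closure \<Omega>" for n
      using assms(1) X(1)[of n] in_closure by (auto simp: reflected_cap_def)
  qed
qed

lemma closure_in_closure_cap:
  assumes "x \<in> closure \<Omega>" "x \<bullet> \<nu> < l"
  shows "x \<in> closure (cap \<Omega> \<nu> l)"
proof -
  have "open {x. x \<bullet> \<nu> < l}" by (intro open_Collect_less continuous_intros)
  then have "closure \<Omega> \<inter> {x. x \<bullet> \<nu> < l} \<subseteq> closure (\<Omega> \<inter> {x. x \<bullet> \<nu> < l})"
    using open_Int_closure_subset[of "{x. x \<bullet> \<nu> < l}" \<Omega>] by (simp add: Int_commute)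
  then show ?thesis using assms by (auto simp: cap_def Int_def)
qed

text \<open>A reflected boundary point outside \<Omega> would lie on the boundary of \<Omega> and on
  that of the reflected cap, off the plane: a forbidden tangency.\<close>

lemma frontier_reflection:
  assumes sub: "reflected_cap \<Omega> \<nu> l \<subseteq> \<Omega>"
    and tangent: "\<nexists>p. p \<notin> hyperplane \<nu> l \<and> internally_tangent_at (reflected_cap \<Omega> \<nu> l) \<Omega> p"
    and x: "x \<in> frontier \<Omega>" "x \<bullet> \<nu> < l"
  shows "reflection \<nu> l x \<in> \<Omega>"
proof (rule ccontr)
  assume out: "reflection \<nu> l x \<notin> \<Omega>"
  have clx: "x \<in> closure (cap \<Omega> \<nu> l)"
    using x closure_in_closure_cap frontier_iff by blast
  then obtain X where X: "\<And>n. X n \<in> cap \<Omega> \<nu> l" "X \<longlonglongrightarrow> x" using closure_seqE by blast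
  have "reflection \<nu> l x \<in> closure (reflected_cap \<Omega> \<nu> l)"
  proof (rule closure_seqI)
    show "(\<lambda>n. reflection \<nu> l (X n)) \<longlonglongrightarrow> reflection \<nu> l x" by (intro tendsto_reflection tendsto_const X)
    show "reflection \<nu> l (X n) \<in> closure (reflected_cap \<Omega> \<nu> l)" for n
      unfolding reflected_cap_def using X(1) by (intro subsetD[OF closure_subset] imageI)
  qed
  moreover have "reflection \<nu> l x \<notin> interior (reflected_cap \<Omega> \<nu> l)"
    using out sub interior_subset by blast
  ultimately have "reflection \<nu> l x \<in> frontier (reflected_cap \<Omega> \<nu> l)" by (simp add: frontier_def)
  moreover have "reflection \<nu> l x \<in> frontier \<Omega>"
    using closure_cap_reflection[OF sub clx] out frontier_iff by blast
  moreover have "reflection \<nu> l x \<notin> hyperplane \<nu> l"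
    using x(2) by (simp add: hyperplane_def reflection_inner[OF \<nu>])
  ultimately show False using tangent sub unfolding internally_tangent_at_def by blast
qed

text \<open>The condition on the normal only gives \<open>n \<bullet> \<nu> \<noteq> 0\<close>; the
  sign comes from the reflected caps at lower levels. If \<open>v\<close> decreased at
  \<open>x\<close> in direction \<nu>, points just below \<open>x\<close> would be in \<Omega> and
  points just above it outside, and a slightly lower plane would reflect a point of \<Omega> out of
  \<Omega>.\<close>

lemma frontier_on_plane:
  assumes al: "a_inf \<Omega> \<nu> < l" and sub: "\<And>l'. a_inf \<Omega> \<nu> < l' \<Longrightarrow> l' < l \<Longrightarrow> reflected_cap \<Omega> \<nu> l' \<subseteq> \<Omega>"
    and normal: "\<forall>x\<in>frontier \<Omega> \<inter> hyperplane \<nu> l. \<exists>n. inward_unit_normal \<Omega> x n \<and> n \<bullet> \<nu> \<noteq> 0"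
    and x: "x \<in> frontier \<Omega>" "x \<bullet> \<nu> = l"
  shows "0 < \<nu> \<bullet> G x"
proof -
  obtain n where n: "inward_unit_normal \<Omega> x n" "n \<bullet> \<nu> \<noteq> 0"
    using normal x by (auto simp: hyperplane_def)
  have "\<not> 0 < (- \<nu>) \<bullet> G x"
  proof
    assume "0 < (- \<nu>) \<bullet> G x"
    then obtain \<delta> where \<delta>: "\<delta> > 0" "\<And>t. 0 < t \<Longrightarrow> t < \<delta> \<Longrightarrow> x + t *\<^sub>R (- \<nu>) \<in> \<Omega>"
      "\<And>t. 0 < t \<Longrightarrow> t < \<delta> \<Longrightarrow> x - t *\<^sub>R (- \<nu>) \<notin> closure \<Omega>"
      using frontier_cone[OF x(1)] by metis
    \<comment> \<open>The point \<open>3 * s\<close> below \<open>x\<close>, reflected in the plane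
      at level \<open>l - s\<close>, lands \<open>s\<close> above \<open>x\<close>. The bounds keep
      both points within reach of the cone and the plane above level
      \<open>a_inf \<Omega> \<nu>\<close>.\<close>
    define s where "s = min (\<delta> / 4) ((l - a_inf \<Omega> \<nu>) / 2)"
    have s: "0 < s" "3 * s < \<delta>" "s < \<delta>" "a_inf \<Omega> \<nu> < l - s" using \<delta>(1) al by (auto simp: s_def min_def field_simps)
    define y where "y = x + (3 * s) *\<^sub>R (- \<nu>)"
    have y: "y \<in> \<Omega>" "y \<bullet> \<nu> = l - 3 * s"
      using \<delta>(2)[of "3 * s"] s x(2) \<nu> by (auto simp: y_def inner_diff_left dot_square_norm)
    then have "reflection \<nu> (l - s) y \<in> \<Omega>"
      using sub[of "l - s"] s by (auto simp: reflected_cap_def cap_def)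
    moreover have "reflection \<nu> (l - s) y = x - s *\<^sub>R (- \<nu>)"
      by (simp add: reflection_def y(2)) (simp add: y_def scaleR_left_diff_distrib[symmetric] algebra_simps scaleR_add_left[symmetric])
    ultimately show False using \<delta>(3) s in_closure by metis
  qed
  then have "\<not> 0 < (- \<nu>) \<bullet> n" using inward_normal_sign[OF x(1) n(1), of "- \<nu>"] by blast
  then have "0 < \<nu> \<bullet> n" using n(2) by (simp add: inner_commute)
  then show ?thesis by (rule inward_normal_sign[OF x(1) n(1)])
qed

context
  fixes \<mu> assumes \<mu>: "\<mu> \<in> Lambda1 \<Omega> \<nu>"
begin

lemma Lambda1D:
  assumes "a_inf \<Omega> \<nu> < l" "l < \<mu>"
  shows "\<nexists>p. p \<notin> hyperplane \<nu> l \<and> internally_tangent_at (reflected_cap \<Omega> \<nu> l) \<Omega> p"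
    "\<forall>x\<in>frontier \<Omega> \<inter> hyperplane \<nu> l. \<exists>n. inward_unit_normal \<Omega> x n \<and> n \<bullet> \<nu> \<noteq> 0"
  using \<mu> assms unfolding Lambda1_def by blast+

text \<open>Inclusion in \<Omega> is built into internal tangency and is not a separate clause of
  \<open>Lambda1\<close>, so it has to be propagated from low levels. Bad points cannot accumulate
  on the plane at level \<open>b\<close>, by \<open>near_plane\<close>, nor below it, by inclusion
  at \<open>b\<close> and the absence of tangency.\<close>

lemma reflected_cap_subset:
  assumes l: "a_inf \<Omega> \<nu> < l" "l < \<mu>"
  shows "reflected_cap \<Omega> \<nu> l \<subseteq> \<Omega>"
proof (rule ccontr)
  assume "\<not> reflected_cap \<Omega> \<nu> l \<subseteq> \<Omega>"
  then obtain y0 where "y0 \<in> \<Omega>" "y0 \<bullet> \<nu> < l \<and> reflection \<nu> l y0 \<notin> \<Omega>"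
    by (auto simp: reflected_cap_def cap_def)
  from first_bad_point[where Bad = "\<lambda>l y. y \<bullet> \<nu> < l \<and> reflection \<nu> l y \<notin> \<Omega>", OF domain(2) l this]
  obtain b x L X where b: "a_inf \<Omega> \<nu> \<le> b" "b < \<mu>" and x: "x \<in> closure \<Omega>"
    and good: "\<And>l y. a_inf \<Omega> \<nu> < l \<Longrightarrow> l < b \<Longrightarrow> y \<in> \<Omega> \<Longrightarrow> \<not> (y \<bullet> \<nu> < l \<and> reflection \<nu> l y \<notin> \<Omega>)"
    and lim: "L \<longlonglongrightarrow> b" "X \<longlonglongrightarrow> x"
    and X: "\<And>n::nat. X n \<in> \<Omega>" "\<And>n. X n \<bullet> \<nu> < L n \<and> reflection \<nu> (L n) (X n) \<notin> \<Omega>"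
    by metis
  have sub: "reflected_cap \<Omega> \<nu> l \<subseteq> \<Omega>" if "a_inf \<Omega> \<nu> < l" "l < b" for l
    using good[OF that] by (auto simp: reflected_cap_def cap_def)
  have "(\<lambda>n. reflection \<nu> (L n) (X n)) \<longlonglongrightarrow> reflection \<nu> b x" by (intro tendsto_reflection lim)
  then have out: "reflection \<nu> b x \<notin> \<Omega>"
    using closed_sequentially[OF closed_Compl[OF domain(1)], of "\<lambda>n. reflection \<nu> (L n) (X n)"] X(2) by auto
  have "(\<lambda>n. X n \<bullet> \<nu>) \<longlonglongrightarrow> x \<bullet> \<nu>" by (intro tendsto_intros lim)
  then have xb: "x \<bullet> \<nu> \<le> b" using X(2) lim(1) by (intro LIMSEQ_le) (auto intro: less_imp_le)
  show False
  proof (cases "x \<bullet> \<nu> = b")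
    case True
    have "0 < \<nu> \<bullet> G x"
    proof (cases "b = a_inf \<Omega> \<nu>")
      case False
      then have ab: "a_inf \<Omega> \<nu> < b" using b by simp
      have "x \<in> frontier \<Omega>" using out x frontier_iff reflection_fixed[OF True] by simp
      then show ?thesis using frontier_on_plane[OF ab sub Lambda1D(2)[OF ab b(2)]] True by blast
    qed (use gradient_at_minimum x True in simp)
    then show False using near_plane[OF \<nu> x True _ lim(2,1) X(1)] X(2) by blast
  next
    case False
    then have ab: "a_inf \<Omega> \<nu> < b" and xb': "x \<bullet> \<nu> < b" using xb a_inf_le[OF x] by auto
    \<comment> \<open>Levels below \<open>b\<close> give the inclusion at \<open>b\<close> only up
      to closure; the reflected cap is open, so \<open>interior_closure\<close> removes the
      closure.\<close>
    have "reflected_cap \<Omega> \<nu> b \<subseteq> closure \<Omega>"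
    proof
      fix z assume "z \<in> reflected_cap \<Omega> \<nu> b"
      then obtain y where y: "y \<in> \<Omega>" "y \<bullet> \<nu> < b" "z = reflection \<nu> b y"
        by (auto simp: reflected_cap_def cap_def)
      have "((\<lambda>l. reflection \<nu> l y) \<longlongrightarrow> z) (at_left b)"
        unfolding y(3) by (intro tendsto_reflection tendsto_intros)
      moreover have "\<forall>\<^sub>F l in at_left b. reflection \<nu> l y \<in> closure \<Omega>"
        using eventually_at_left_real[OF y(2)]
      proof eventually_elim
        case (elim l)
        then show ?case
          using good[of l y] a_inf_less[OF y(1)] y in_closure by auto
      qed
      ultimately show "z \<in> closure \<Omega>"
        using Lim_in_closed_set[OF closed_closure _ trivial_limit_at_left_real] by fast
    qed
    moreover have "open (reflected_cap \<Omega> \<nu> b)"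
    proof -
      have "reflected_cap \<Omega> \<nu> b = reflection \<nu> b -` cap \<Omega> \<nu> b"
        unfolding reflected_cap_def
      proof (intro set_eqI iffI)
        fix y assume "y \<in> reflection \<nu> b -` cap \<Omega> \<nu> b"
        then have "reflection \<nu> b (reflection \<nu> b y) \<in> reflection \<nu> b ` cap \<Omega> \<nu> b" by blast
        then show "y \<in> reflection \<nu> b ` cap \<Omega> \<nu> b" by (simp only: reflection_reflection[OF \<nu>])
      qed (auto simp: reflection_reflection[OF \<nu>])
      moreover have "open (cap \<Omega> \<nu> b)"
        unfolding cap_def using domain(1) by (intro open_Collect_conj open_Collect_less continuous_intros) auto
      ultimately show ?thesis
        using open_vimage[of "cap \<Omega> \<nu> b" "reflection \<nu> b"] continuous_on_reflection[of UNIV \<nu> b]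
        by simp
    qed
    ultimately have subb: "reflected_cap \<Omega> \<nu> b \<subseteq> \<Omega>"
      using interior_maximal interior_closure by metis
    show False
    proof (cases "x \<in> \<Omega>")
      case True
      then show False using subb xb' out by (auto simp: reflected_cap_def cap_def)
    next
      case False
      then have "x \<in> frontier \<Omega>" using x frontier_iff by blast
      then show False using frontier_reflection[OF subb Lambda1D(1)[OF ab b(2)]] xb' out by blast
    qed
  qed
qed

lemma reflection_in_domain:
  assumes "a_inf \<Omega> \<nu> < l" "l < \<mu>" "x \<in> closure \<Omega>" "x \<bullet> \<nu> < l"
  shows "reflection \<nu> l x \<in> \<Omega>"
proof (cases "x \<in> \<Omega>")
  case True
  then show ?thesis using reflected_cap_subset[OF assms(1,2)] assms(4) by (auto simp: reflected_cap_def cap_def)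
next
  case False
  then have "x \<in> frontier \<Omega>" using assms(3) frontier_iff by blast
  then show ?thesis
    using frontier_reflection[OF reflected_cap_subset Lambda1D(1)] assms by blast
qed

lemma gradient_at_frontier:
  assumes "a_inf \<Omega> \<nu> < l" "l < \<mu>" "x \<in> frontier \<Omega>" "x \<bullet> \<nu> = l"
  shows "0 < \<nu> \<bullet> G x"
  by (rule frontier_on_plane[OF assms(1) reflected_cap_subset Lambda1D(2)[OF assms(1,2)] assms(3,4)])
    (use assms in auto)

end

end

end

section \<open>Moving the plane\<close>

lemma C1c_zero_outside:
  assumes "C1c U \<phi> D" "x \<notin> U"
  shows "\<phi> x = 0"
proof -
  obtain K where "K \<subseteq> U" "\<And>x. x \<notin> K \<Longrightarrow> \<phi> x = 0" using C1cE[OF assms(1)] by metis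
  then show ?thesis using assms(2) by blast
qed

lemma reflection_eq_mirror: "reflection \<nu> l x = (2 * l) *\<^sub>R \<nu> + mirror \<nu> x"
  by (simp add: reflection_def mirror_def scaleR_diff_left algebra_simps)

lemma linear_mirror: "linear (mirror \<nu>)"
  unfolding mirror_def by (rule linearI) (auto simp: inner_add_left algebra_simps)

lemma mirror_mirror: "norm \<nu> = 1 \<Longrightarrow> mirror \<nu> (mirror \<nu> z) = z"
  by (simp add: mirror_def inner_diff_left dot_square_norm algebra_simps)

lemma inner_mirror: "mirror \<nu> a \<bullet> b = a \<bullet> mirror \<nu> b"
  by (simp add: mirror_def inner_diff_left inner_diff_right inner_commute[of \<nu>] mult_ac)

lemma p_flux_mirror: "norm \<nu> = 1 \<Longrightarrow> p_flux p (mirror \<nu> z) = mirror \<nu> (p_flux p z)"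
  by (simp add: p_flux_def norm_mirror linear_scale[OF linear_mirror])

lemma integral_reflection:
  fixes f :: "'a::euclidean_space \<Rightarrow> real"
  assumes \<nu>: "norm \<nu> = 1" and f[measurable]: "f \<in> borel_measurable borel"
  shows "(\<integral>x. f (reflection \<nu> l x) \<partial>lborel) = (\<integral>x. f x \<partial>lborel)"
proof -
  have [measurable]: "mirror \<nu> \<in> borel_measurable borel"
    by (intro borel_measurable_continuous_onI linear_continuous_on linear_conv_bounded_linear[THEN iffD1] linear_mirror)
  have "(\<integral>x. f (reflection \<nu> l x) \<partial>lborel) = (\<integral>x. f ((2 * l) *\<^sub>R \<nu> + x) \<partial>distr lborel borel (mirror \<nu>))"
    by (subst integral_distr) (auto simp: reflection_eq_mirror)
  also have "\<dots> = (\<integral>x. f ((2 * l) *\<^sub>R \<nu> + x) \<partial>lborel)"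
    by (simp add: distr_lborel_linear_isometry[OF linear_mirror norm_mirror[OF \<nu>] mirror_mirror[OF \<nu>]])
  also have "\<dots> = (\<integral>x. f x \<partial>lborel)" by (rule integral_shift[OF f])
  finally show ?thesis .
qed

lemma GDERIV_reflection:
  assumes "GDERIV v (reflection \<nu> l x) :> g"
  shows "GDERIV (\<lambda>x. v (reflection \<nu> l x)) x :> mirror \<nu> g"
proof -
  have "(reflection \<nu> l has_derivative mirror \<nu>) (at x)"
    unfolding reflection_def mirror_def
    by (auto intro!: derivative_eq_intros simp: algebra_simps)
  from has_derivative_compose[OF this assms[unfolded gderiv_def]]
  show ?thesis by (simp add: gderiv_def inner_mirror)
qed

lemma continuous_on_mirror: "continuous_on S f \<Longrightarrow> continuous_on S (\<lambda>x. mirror \<nu> (f x))"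
  unfolding mirror_def by (intro continuous_intros)

lemma C1c_reflection:
  assumes \<nu>: "norm \<nu> = 1" and \<phi>: "C1c U \<phi> D" and sub: "reflection \<nu> l ` U \<subseteq> V"
  shows "C1c V (\<lambda>x. \<phi> (reflection \<nu> l x)) (\<lambda>x. mirror \<nu> (D (reflection \<nu> l x)))"
  unfolding C1c_def
proof (intro conjI allI GDERIV_reflection C1cD(1)[OF \<phi>])
  show "continuous_on UNIV (\<lambda>x. mirror \<nu> (D (reflection \<nu> l x)))"
    by (intro continuous_on_mirror continuous_on_compose2[OF C1cD(2)[OF \<phi>] continuous_on_reflection]) auto
  obtain K where K: "compact K" "K \<subseteq> U" "\<And>x. x \<notin> K \<Longrightarrow> \<phi> x = 0" using C1cE[OF \<phi>] by metis
  show "\<exists>K. compact K \<and> K \<subseteq> V \<and> (\<forall>x. x \<notin> K \<longrightarrow> \<phi> (reflection \<nu> l x) = 0)"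
  proof (intro exI[of _ "reflection \<nu> l ` K"] conjI allI impI)
    show "compact (reflection \<nu> l ` K)" by (intro compact_continuous_image continuous_on_reflection K)
    fix x assume "x \<notin> reflection \<nu> l ` K"
    then have "reflection \<nu> l x \<notin> K" using reflection_reflection[OF \<nu>] by (metis imageI)
    then show "\<phi> (reflection \<nu> l x) = 0" by (rule K(3))
  qed (use K sub in blast)
qed

text \<open>The equation is tested with the reflected function, whose support lies in
  \<open>V\<close>, and the integrals are transformed back. Since \<open>mirror \<nu>\<close> is
  self-adjoint, it moves from the gradient to the flux.\<close>

lemma weak_form_reflection:
  assumes \<nu>: "norm \<nu> = 1" and F: "continuous_on V F" and h: "continuous_on V h"
    and weak: "\<And>\<phi> D. C1c V \<phi> D \<Longrightarrow> (\<integral>x. F x \<bullet> D x \<partial>lborel) = (\<integral>x. h x * \<phi> x \<partial>lborel)"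
    and \<phi>: "C1c U \<phi> D" and sub: "reflection \<nu> l ` U \<subseteq> V"
  shows "(\<integral>x. mirror \<nu> (F (reflection \<nu> l x)) \<bullet> D x \<partial>lborel) = (\<integral>x. h (reflection \<nu> l x) * \<phi> x \<partial>lborel)"
proof -
  let ?R = "reflection \<nu> l"
  note \<psi> = C1c_reflection[OF \<nu> \<phi> sub]
  have m1: "(\<lambda>y. F y \<bullet> mirror \<nu> (D (?R y))) \<in> borel_measurable borel"
    and m2: "(\<lambda>y. h y * \<phi> (?R y)) \<in> borel_measurable borel"
    using borel_measurable_integrable[OF integrable_C1c(1)[OF \<psi> F]] borel_measurable_integrable[OF integrable_C1c(2)[OF \<psi> h]]
    by simp_all
  have "(\<integral>x. mirror \<nu> (F (?R x)) \<bullet> D x \<partial>lborel) = (\<integral>x. F (?R x) \<bullet> mirror \<nu> (D (?R (?R x))) \<partial>lborel)"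
    by (simp add: inner_mirror reflection_reflection[OF \<nu>])
  also have "\<dots> = (\<integral>y. F y \<bullet> mirror \<nu> (D (?R y)) \<partial>lborel)"
    by (rule integral_reflection[OF \<nu> m1])
  also have "\<dots> = (\<integral>y. h y * \<phi> (?R y) \<partial>lborel)" by (rule weak[OF \<psi>])
  also have "\<dots> = (\<integral>x. h (?R x) * \<phi> (?R (?R x)) \<partial>lborel)"
    by (rule integral_reflection[OF \<nu> m2, symmetric])
  also have "\<dots> = (\<integral>x. h (?R x) * \<phi> x \<partial>lborel)" by (simp add: reflection_reflection[OF \<nu>])
  finally show ?thesis .
qed

text \<open>The nonvanishing boundary gradient belongs to \<open>v\<close> alone; \<open>u\<close>
  enters through comparison only, so no Hopf lemma for the nonlinear operator is called for.\<close>

locale cooperative_system =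
  U: positive_C1_0 \<Omega> u Gu + V: nondegenerate_C1_0 \<Omega> v Gv
  for \<Omega> :: "'a::euclidean_space set" and u v Gu Gv +
  fixes p :: real and f g :: "real \<Rightarrow> real"
  assumes p: "1 < p"
    and mono: "mono_on {0..} f" "mono_on {0..} g"
    and cont: "continuous_on UNIV f" "continuous_on UNIV g"
    and weak_u: "\<And>\<phi> D. C1c \<Omega> \<phi> D \<Longrightarrow>
      (\<integral>x. p_flux p (Gu x) \<bullet> D x \<partial>lborel) = (\<integral>x. f (v x) * \<phi> x \<partial>lborel)"
    and weak_v: "\<And>\<phi> D. C1c \<Omega> \<phi> D \<Longrightarrow>
      (\<integral>x. Gv x \<bullet> D x \<partial>lborel) = (\<integral>x. g (u x) * \<phi> x \<partial>lborel)"
begin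

lemma continuous_on_domain:
  "continuous_on \<Omega> u" "continuous_on \<Omega> v" "continuous_on \<Omega> Gu" "continuous_on \<Omega> Gv"
  "continuous_on \<Omega> (\<lambda>x. f (v x))" "continuous_on \<Omega> (\<lambda>x. g (u x))" "continuous_on \<Omega> (\<lambda>x. p_flux p (Gu x))"
proof -
  show *: "continuous_on \<Omega> u" "continuous_on \<Omega> v" "continuous_on \<Omega> Gu" "continuous_on \<Omega> Gv"
    using U.contv V.contv U.contG V.contG continuous_on_subset[OF _ closure_subset] by blast+
  show "continuous_on \<Omega> (\<lambda>x. f (v x))" "continuous_on \<Omega> (\<lambda>x. g (u x))" "continuous_on \<Omega> (\<lambda>x. p_flux p (Gu x))"
    using continuous_on_compose2[OF cont(1) *(2)] continuous_on_compose2[OF cont(2) *(1)]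
      continuous_on_compose2[OF continuous_p_flux[OF p] *(3)] by auto
qed

section \<open>Comparison for a single position of the plane\<close>

context
  fixes \<nu> \<mu> l
  assumes \<nu>: "norm \<nu> = 1" and \<mu>: "\<mu> \<in> Lambda1 \<Omega> \<nu>" and l: "a_inf \<Omega> \<nu> < l" "l < \<mu>"
begin

abbreviation "C \<equiv> cap \<Omega> \<nu> l"
abbreviation "R \<equiv> reflection \<nu> l"

lemma cap_domain: "x \<in> C \<longleftrightarrow> x \<in> \<Omega> \<and> x \<bullet> \<nu> < l" "open C" "bounded C" "C \<subseteq> \<Omega>"
proof -
  show "x \<in> C \<longleftrightarrow> x \<in> \<Omega> \<and> x \<bullet> \<nu> < l" "C \<subseteq> \<Omega>" by (auto simp: cap_def)
  show "bounded C" using V.domain(2) by (rule bounded_subset) (auto simp: cap_def)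
  show "open C"
    unfolding cap_def using V.domain(1) by (intro open_Collect_conj open_Collect_less continuous_intros) auto
qed

lemma R_C: "R ` C \<subseteq> \<Omega>"
  using V.reflected_cap_subset[OF \<nu> \<mu> l] by (simp add: reflected_cap_def)

lemma R_closure: "x \<in> closure C \<Longrightarrow> R x \<in> closure \<Omega>"
  using V.closure_cap_reflection[OF \<nu> V.reflected_cap_subset[OF \<nu> \<mu> l]] .

lemma closure_C: "x \<in> closure C \<Longrightarrow> x \<in> closure \<Omega> \<and> x \<bullet> \<nu> \<le> l"
proof -
  have "closure C \<subseteq> {x. x \<bullet> \<nu> \<le> l}"
    by (rule closure_minimal) (auto simp: cap_def intro!: closed_Collect_le continuous_intros)
  then show "x \<in> closure C \<Longrightarrow> x \<in> closure \<Omega> \<and> x \<bullet> \<nu> \<le> l" using closure_mono[OF cap_domain(4)] by blast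
qed

lemma frontier_C: "x \<in> frontier C \<Longrightarrow> x \<bullet> \<nu> = l \<or> (x \<in> frontier \<Omega> \<and> x \<bullet> \<nu> < l)"
proof -
  assume "x \<in> frontier C"
  then have "x \<in> closure C" "x \<notin> C" using cap_domain(2) by (auto simp: frontier_def interior_open)
  then show ?thesis using closure_C[of x] V.frontier_iff[of x] cap_domain(1)[of x] by auto
qed

lemma continuous_on_reflected:
  assumes "continuous_on (closure \<Omega>) w"
  shows "continuous_on (closure C) (\<lambda>x. w (R x))"
  by (rule continuous_on_compose2[OF assms continuous_on_reflection]) (use R_closure in auto)

lemma continuous_on_C: "continuous_on (closure \<Omega>) w \<Longrightarrow> continuous_on (closure C) w"
  using continuous_on_subset closure_mono[OF cap_domain(4)] by blast

lemma continuous_on_open_C: "continuous_on (closure C) w \<Longrightarrow> continuous_on C w"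
  using continuous_on_subset closure_subset by blast

lemma der_reflected:
  assumes "x \<in> C"
  shows "GDERIV (\<lambda>x. u (R x)) x :> mirror \<nu> (Gu (R x))" "GDERIV (\<lambda>x. v (R x)) x :> mirror \<nu> (Gv (R x))"
  using R_C assms U.der V.der by (auto intro!: GDERIV_reflection)

context
  assumes v_le: "\<And>x. x \<in> C \<Longrightarrow> v x \<le> v (R x)"
begin

text \<open>The boundary inequality is immediate: \<open>R\<close> fixes the plane, and on the rest
  of the frontier of the cap \<open>u\<close> is 0 at the point and positive at its image. The
  right-hand sides are ordered because \<open>v\<close> is positive in the cap, where monotonicity
  of \<open>f\<close> is available.\<close>

lemma u_le:
  assumes "x \<in> C"
  shows "u x \<le> u (R x)"
proof (rule weak_comparison[OF p cap_domain(2,3) _ _ _ der_reflected(1) _ _ _ _ assms])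
  show "continuous_on (closure C) u" "continuous_on (closure C) (\<lambda>x. u (R x))"
    using continuous_on_C continuous_on_reflected U.contv by auto
  show "GDERIV u x :> Gu x" if "x \<in> C" for x using U.der cap_domain(4) that by blast
  show "continuous_on C Gu" by (intro continuous_on_open_C continuous_on_C U.contG)
  show "continuous_on C (\<lambda>x. mirror \<nu> (Gu (R x)))"
    by (intro continuous_on_mirror continuous_on_open_C continuous_on_reflected U.contG)
  show "u x \<le> u (R x)" if "x \<in> frontier C" for x
    using frontier_C[OF that]
  proof
    assume "x \<bullet> \<nu> = l"
    then show ?thesis by (simp add: reflection_fixed)
  next
    assume x: "x \<in> frontier \<Omega> \<and> x \<bullet> \<nu> < l"
    then have "R x \<in> \<Omega>" using V.reflection_in_domain[OF \<nu> \<mu> l] V.frontier_iff by blast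
    then show ?thesis using U.zero U.pos x by fastforce
  qed
  fix \<phi> D assume \<phi>: "C1c C \<phi> D" and \<phi>0: "\<And>x. 0 \<le> \<phi> x"
  have 1: "(\<integral>x. p_flux p (Gu x) \<bullet> D x \<partial>lborel) = (\<integral>x. f (v x) * \<phi> x \<partial>lborel)"
    by (rule weak_u[OF C1c_mono[OF \<phi> cap_domain(4)]])
  have 2: "(\<integral>x. p_flux p (mirror \<nu> (Gu (R x))) \<bullet> D x \<partial>lborel) = (\<integral>x. f (v (R x)) * \<phi> x \<partial>lborel)"
    unfolding p_flux_mirror[OF \<nu>]
    by (rule weak_form_reflection[OF \<nu> continuous_on_domain(7,5) weak_u \<phi> R_C])
  have "(\<integral>x. f (v x) * \<phi> x \<partial>lborel) \<le> (\<integral>x. f (v (R x)) * \<phi> x \<partial>lborel)"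
  proof (rule integral_mono)
    show "integrable lborel (\<lambda>x. f (v x) * \<phi> x)"
      by (rule integrable_C1c(2)[OF \<phi> continuous_on_subset[OF continuous_on_domain(5) cap_domain(4)]])
    show "integrable lborel (\<lambda>x. f (v (R x)) * \<phi> x)"
      by (rule integrable_C1c(2)[OF \<phi> continuous_on_compose2[OF continuous_on_domain(5) continuous_on_reflection R_C]])
    fix x
    show "f (v x) * \<phi> x \<le> f (v (R x)) * \<phi> x"
    proof (cases "x \<in> C")
      case True
      then have "0 < v x" "v x \<le> v (R x)" using v_le V.pos cap_domain(4) by auto
      then have "f (v x) \<le> f (v (R x))" by (intro mono_onD[OF mono(1)]) auto
      then show ?thesis using \<phi>0 by (rule mult_right_mono)
    next
      case False
      then have "\<phi> x = 0" using C1c_zero_outside[OF \<phi>] by blast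
      then show ?thesis by simp
    qed
  qed
  then show "(\<integral>x. p_flux p (Gu x) \<bullet> D x \<partial>lborel) \<le> (\<integral>x. p_flux p (mirror \<nu> (Gu (R x))) \<bullet> D x \<partial>lborel)"
    unfolding 1 2 .
qed

abbreviation "w \<equiv> \<lambda>x. v (R x) - v x"
abbreviation "W \<equiv> \<lambda>x. mirror \<nu> (Gv (R x)) - Gv x"

lemma difference: "x \<in> C \<Longrightarrow> GDERIV w x :> W x" "continuous_on (closure C) w" "continuous_on (closure C) W"
proof -
  show "x \<in> C \<Longrightarrow> GDERIV w x :> W x" using GDERIV_diff[OF der_reflected(2) V.der] cap_domain(4) by blast
  show "continuous_on (closure C) w" "continuous_on (closure C) W"
    by (intro continuous_intros continuous_on_mirror continuous_on_reflected continuous_on_C V.contv V.contG)+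
qed

lemma superharmonic_w: "superharmonic_gradient C W"
  unfolding superharmonic_gradient_def
proof (intro allI impI)
  fix \<phi> D assume \<phi>: "C1c C \<phi> D" and \<phi>0: "\<forall>x. 0 \<le> \<phi> x"
  have c1: "continuous_on C (\<lambda>x. mirror \<nu> (Gv (R x)))" "continuous_on C Gv"
    by (intro continuous_on_open_C continuous_on_mirror continuous_on_reflected continuous_on_C V.contG)+
  have c2: "continuous_on C (\<lambda>x. g (u (R x)))" "continuous_on C (\<lambda>x. g (u x))"
    using continuous_on_compose2[OF continuous_on_domain(6) continuous_on_reflection R_C]
      continuous_on_subset[OF continuous_on_domain(6) cap_domain(4)] by auto
  have "(\<integral>x. W x \<bullet> D x \<partial>lborel) = (\<integral>x. mirror \<nu> (Gv (R x)) \<bullet> D x \<partial>lborel) - (\<integral>x. Gv x \<bullet> D x \<partial>lborel)"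
    unfolding inner_diff_left
    by (rule Bochner_Integration.integral_diff[OF integrable_C1c(1)[OF \<phi> c1(1)] integrable_C1c(1)[OF \<phi> c1(2)]])
  also have "\<dots> = (\<integral>x. g (u (R x)) * \<phi> x \<partial>lborel) - (\<integral>x. g (u x) * \<phi> x \<partial>lborel)"
    using weak_form_reflection[OF \<nu> continuous_on_domain(4,6) weak_v \<phi> R_C] weak_v[OF C1c_mono[OF \<phi> cap_domain(4)]] by simp
  also have "\<dots> = (\<integral>x. g (u (R x)) * \<phi> x - g (u x) * \<phi> x \<partial>lborel)"
    by (rule Bochner_Integration.integral_diff[OF integrable_C1c(2)[OF \<phi> c2(1)] integrable_C1c(2)[OF \<phi> c2(2)], symmetric])
  also have "\<dots> \<ge> 0"
  proof (rule Bochner_Integration.integral_nonneg)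
    fix x
    show "0 \<le> g (u (R x)) * \<phi> x - g (u x) * \<phi> x"
    proof (cases "x \<in> C")
      case True
      then have "0 < u x" "u x \<le> u (R x)" using u_le U.pos cap_domain(4) by auto
      then have "g (u x) \<le> g (u (R x))" by (intro mono_onD[OF mono(2)]) auto
      then have "g (u x) * \<phi> x \<le> g (u (R x)) * \<phi> x" using \<phi>0 by (intro mult_right_mono) auto
      then show ?thesis by simp
    next
      case False
      then have "\<phi> x = 0" using C1c_zero_outside[OF \<phi>] by blast
      then show ?thesis by simp
    qed
  qed
  finally show "0 \<le> (\<integral>x. W x \<bullet> D x \<partial>lborel)" .
qed

text \<open>Zeros of \<open>w\<close> are not propagated through the cap, which may be disconnected.
  Instead, take a lowest point \<open>y\<close> of the closure of the zero set; it is below the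
  plane because \<open>x\<close> is. If \<open>y\<close> is in \<Omega>, the strong maximum
  principle yields a ball of zeros, hence lower ones; if \<open>y\<close> is on the boundary, then
  \<open>v y = 0\<close> while \<open>R y\<close> is in \<Omega>, so \<open>w y > 0\<close>.\<close>

lemma v_less:
  assumes "x \<in> C"
  shows "v x < v (R x)"
proof (rule ccontr)
  assume "\<not> v x < v (R x)"
  define Z where "Z = {x \<in> C. w x = 0}"
  have "x \<in> Z" using \<open>\<not> v x < v (R x)\<close> v_le[OF assms] assms by (simp add: Z_def)
  have "bounded Z" using cap_domain(3) by (rule bounded_subset) (auto simp: Z_def)
  then have "compact (closure Z)" by (simp add: compact_closure)
  moreover have "continuous_on (closure Z) (\<lambda>x. x \<bullet> \<nu>)" by (intro continuous_intros)
  moreover have "closure Z \<noteq> {}" using \<open>x \<in> Z\<close> by auto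
  ultimately obtain y where y: "y \<in> closure Z" "\<And>z. z \<in> closure Z \<Longrightarrow> y \<bullet> \<nu> \<le> z \<bullet> \<nu>"
    using continuous_attains_inf[of "closure Z" "\<lambda>x. x \<bullet> \<nu>"] by blast
  have yl: "y \<bullet> \<nu> < l" using y(2)[OF subsetD[OF closure_subset \<open>x \<in> Z\<close>]] cap_domain(1)[of x] assms by simp
  obtain Y where Y: "\<And>n. Y n \<in> Z" "Y \<longlonglongrightarrow> y" using closure_seqE[OF y(1)] by blast
  have yC: "y \<in> closure C" using y(1) closure_mono[of Z C] by (auto simp: Z_def)
  have "(\<lambda>n. w (Y n)) \<longlonglongrightarrow> w y"
    by (rule continuous_on_seq[OF difference(2) yC _ Y(2)]) (use Y(1) closure_subset in \<open>auto simp: Z_def\<close>)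
  moreover have "(\<lambda>n. w (Y n)) = (\<lambda>n. 0)" using Y(1) by (simp add: Z_def)
  ultimately have wy: "w y = 0" using LIMSEQ_unique[OF _ tendsto_const] by metis
  show False
  proof (cases "y \<in> \<Omega>")
    case True
    then have "y \<in> C" using yl cap_domain(1) by blast
    from strong_maximum_principle[OF cap_domain(2) difference(1) continuous_on_open_C[OF difference(3)] superharmonic_w _ this wy]
    obtain e where e: "0 < e" "\<And>z. z \<in> ball y e \<Longrightarrow> w z = 0" using v_le by auto
    obtain e' where e': "0 < e'" "ball y e' \<subseteq> C" using cap_domain(2) \<open>y \<in> C\<close> openE by blast
    define z where "z = y - (min e e' / 2) *\<^sub>R \<nu>"
    have "dist y z < e" "dist y z < e'" using e(1) e'(1) \<nu> by (auto simp: z_def dist_norm)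
    then have "z \<in> Z" using e(2)[of z] e'(2) by (auto simp: Z_def)
    then have "y \<bullet> \<nu> \<le> z \<bullet> \<nu>" using y(2) closure_subset by blast
    moreover have "z \<bullet> \<nu> = y \<bullet> \<nu> - min e e' / 2" using \<nu> by (simp add: z_def inner_diff_left dot_square_norm)
    ultimately show False using e(1) e'(1) by linarith
  next
    case False
    then have "y \<in> frontier \<Omega>" using closure_C[OF yC] V.frontier_iff by blast
    moreover have "R y \<in> \<Omega>" using V.reflection_in_domain[OF \<nu> \<mu> l] closure_C[OF yC] yl by blast
    ultimately show False using wy V.zero V.pos by fastforce
  qed
qed

text \<open>The Hopf lemma is applied to \<open>w\<close> in a ball inside the cap that touches the
  plane at \<open>x\<close>. There \<open>W x\<close> equals
  \<open>(- 2 * (\<nu> \<bullet> Gv x)) *\<^sub>R \<nu>\<close>, since \<open>R\<close> fixes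
  \<open>x\<close> and \<open>mirror \<nu>\<close> reverses the component along \<nu> only.\<close>

lemma gradient_positive:
  assumes x: "x \<in> \<Omega>" "x \<bullet> \<nu> = l"
  shows "0 < \<nu> \<bullet> Gv x"
proof -
  obtain e where e: "0 < e" "ball x e \<subseteq> \<Omega>" using V.domain(1) x(1) openE by blast
  \<comment> \<open>A third of the radius keeps the touching ball, of diameter \<open>2 * r\<close>,
    inside \<open>ball x e\<close>.\<close>
  define r where "r = e / 3"
  have r: "0 < r" "3 * r = e" using e by (auto simp: r_def)
  define c where "c = x - r *\<^sub>R \<nu>"
  have cx: "dist c x = r" using r \<nu> by (simp add: c_def dist_norm)
  have ball: "ball c r \<subseteq> C"
  proof
    fix y assume y: "y \<in> ball c r"
    have "dist x y < e" using dist_triangle[of x y c] y cx r by (simp add: dist_commute)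
    then have "y \<in> \<Omega>" using e(2) by auto
    moreover have "(y - c) \<bullet> \<nu> < r"
      using norm_cauchy_schwarz[of "y - c" \<nu>] \<nu> y by (simp add: dist_norm norm_minus_commute)
    then have "y \<bullet> \<nu> < l" using x(2) \<nu> by (simp add: c_def inner_diff_left inner_add_left dot_square_norm)
    ultimately show "y \<in> C" by (simp add: cap_domain(1))
  qed
  have cball: "cball c r \<subseteq> closure C"
    using closure_mono[OF ball] r by (simp add: closure_ball)
  have "0 < (c - x) \<bullet> W x"
  proof (rule hopf_gradient[OF r(1) cball difference(2,3) _ superharmonic_gradient_subset[OF superharmonic_w ball] _ cx])
    show "GDERIV w y :> W y" if "y \<in> ball c r" for y using difference(1) ball that by blast
    show "0 < w y" if "y \<in> ball c r" for y using v_less ball that by fastforce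
    show "w x = 0" using reflection_fixed[OF x(2)] by simp
    show "0 \<le> w y" if "y \<in> sphere c r" for y
    proof -
      have "y \<in> closure C" using cball that by auto
      then obtain Y where Y: "\<And>n. Y n \<in> C" "Y \<longlonglongrightarrow> y" using closure_seqE by blast
      have "(\<lambda>n. w (Y n)) \<longlonglongrightarrow> w y"
        by (rule continuous_on_seq[OF difference(2) \<open>y \<in> closure C\<close> _ Y(2)]) (use Y(1) closure_subset in auto)
      then show ?thesis by (rule LIMSEQ_le_const) (use Y(1) v_le in auto)
    qed
  qed
  also have "(c - x) \<bullet> W x = 2 * r * (\<nu> \<bullet> Gv x)"
    using \<nu> by (simp add: c_def reflection_fixed[OF x(2)] mirror_def inner_diff_right dot_square_norm inner_commute)
  finally show ?thesis using r by (simp add: zero_less_mult_iff)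
qed

end

end

text \<open>A limit point \<open>x\<close> on the plane at level \<open>b\<close> satisfies
  \<open>0 < \<nu> \<bullet> Gv x\<close>, against \<open>near_plane\<close>: by the Hopf lemma if
  it is in \<Omega>, by the condition on the normal if it is on the boundary, by minimality if
  \<open>b = a_inf \<Omega> \<nu>\<close>. Below the plane the inequality at \<open>b\<close> is
  strict, whereas a limit of bad points satisfies the reverse one.\<close>

lemma v_le_reflection:
  assumes \<nu>: "norm \<nu> = 1" and \<mu>: "\<mu> \<in> Lambda1 \<Omega> \<nu>" and l: "a_inf \<Omega> \<nu> < l" "l < \<mu>"
    and y: "y \<in> cap \<Omega> \<nu> l"
  shows "v y \<le> v (reflection \<nu> l y)"
proof (rule ccontr)
  assume "\<not> v y \<le> v (reflection \<nu> l y)"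
  then have "y \<in> \<Omega>" "y \<bullet> \<nu> < l \<and> v (reflection \<nu> l y) < v y" using y by (auto simp: cap_def)
  from first_bad_point[where Bad = "\<lambda>l y. y \<bullet> \<nu> < l \<and> v (reflection \<nu> l y) < v y", OF V.domain(2) l this]
  obtain b x L X where b: "a_inf \<Omega> \<nu> \<le> b" "b < \<mu>" and x: "x \<in> closure \<Omega>"
    and good: "\<And>l y. a_inf \<Omega> \<nu> < l \<Longrightarrow> l < b \<Longrightarrow> y \<in> \<Omega> \<Longrightarrow> \<not> (y \<bullet> \<nu> < l \<and> v (reflection \<nu> l y) < v y)"
    and lim: "L \<longlonglongrightarrow> b" "X \<longlonglongrightarrow> x"
    and X: "\<And>n::nat. X n \<in> \<Omega>" "\<And>n. a_inf \<Omega> \<nu> < L n" "\<And>n. L n < \<mu>"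
      "\<And>n. X n \<bullet> \<nu> < L n \<and> v (reflection \<nu> (L n) (X n)) < v (X n)"
    by metis
  have RX: "reflection \<nu> (L n) (X n) \<in> \<Omega>" for n
    using V.reflection_in_domain[OF \<nu> \<mu> X(2,3) V.in_closure[OF X(1)]] X(4) by blast
  have limR: "(\<lambda>n. reflection \<nu> (L n) (X n)) \<longlonglongrightarrow> reflection \<nu> b x" by (intro tendsto_reflection lim)
  have Rx: "reflection \<nu> b x \<in> closure \<Omega>" by (rule closure_seqI[OF V.in_closure[OF RX] limR])
  have "(\<lambda>n. v (reflection \<nu> (L n) (X n))) \<longlonglongrightarrow> v (reflection \<nu> b x)" "(\<lambda>n. v (X n)) \<longlonglongrightarrow> v x"
    using continuous_on_seq[OF V.contv Rx V.in_closure[OF RX] limR] continuous_on_seq[OF V.contv x V.in_closure[OF X(1)] lim(2)] .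
  then have ge: "v (reflection \<nu> b x) \<le> v x"
    by (rule LIMSEQ_le) (use X(4) in \<open>auto intro: less_imp_le\<close>)
  have "(\<lambda>n. X n \<bullet> \<nu>) \<longlonglongrightarrow> x \<bullet> \<nu>" by (intro tendsto_intros lim)
  then have xb: "x \<bullet> \<nu> \<le> b" using X(4) lim(1) by (intro LIMSEQ_le) (auto intro: less_imp_le)
  \<comment> \<open>The inequality at level \<open>b\<close> itself follows by letting
    \<open>l\<close> increase to \<open>b\<close> with \<open>y\<close> fixed; it is the hypothesis
    of \<open>gradient_positive\<close> and \<open>v_less\<close>.\<close>
  have b_le: "v y \<le> v (reflection \<nu> b y)" if ab: "a_inf \<Omega> \<nu> < b" and y: "y \<in> cap \<Omega> \<nu> b" for y
  proof -
    have yb: "y \<in> \<Omega>" "y \<bullet> \<nu> < b" using y by (auto simp: cap_def)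
    have "reflection \<nu> b y \<in> \<Omega>"
      using V.reflection_in_domain[OF \<nu> \<mu> ab b(2) V.in_closure] yb by blast
    then have "isCont v (reflection \<nu> b y)"
      using V.der has_derivative_continuous unfolding gderiv_def by blast
    then have "((\<lambda>l. v (reflection \<nu> l y)) \<longlongrightarrow> v (reflection \<nu> b y)) (at_left b)"
      by (rule isCont_tendsto_compose) (intro tendsto_reflection tendsto_intros)
    moreover have "\<forall>\<^sub>F l in at_left b. v y \<le> v (reflection \<nu> l y)"
      using eventually_at_left_real[OF yb(2)]
    proof eventually_elim
      case (elim l)
      then show ?case using good[of l y] V.a_inf_less[OF \<nu> yb(1)] yb by auto
    qed
    ultimately show ?thesis
      by (intro tendsto_lowerbound[OF _ _ trivial_limit_at_left_real])
  qed
  show False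
  proof (cases "x \<bullet> \<nu> = b")
    case True
    have "0 < \<nu> \<bullet> Gv x"
    proof (cases "b = a_inf \<Omega> \<nu>")
      case False
      then have ab: "a_inf \<Omega> \<nu> < b" using b by simp
      show ?thesis
      proof (cases "x \<in> \<Omega>")
        case True
        then show ?thesis using gradient_positive[OF \<nu> \<mu> ab b(2) b_le[OF ab]] \<open>x \<bullet> \<nu> = b\<close> by blast
      next
        case False
        then show ?thesis
          using V.gradient_at_frontier[OF \<nu> \<mu> ab b(2) _ \<open>x \<bullet> \<nu> = b\<close>] x V.frontier_iff by blast
      qed
    qed (use V.gradient_at_minimum[OF \<nu> x] True in simp)
    then obtain n where "v (X n) < v (reflection \<nu> (L n) (X n))"
      using V.near_plane[OF \<nu> x True _ lim(2,1) X(1)] X(4) by blast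
    then show False using X(4)[of n] by simp
  next
    case False
    then have ab: "a_inf \<Omega> \<nu> < b" and xb': "x \<bullet> \<nu> < b" using xb V.a_inf_le[OF \<nu> x] by auto
    show False
    proof (cases "x \<in> \<Omega>")
      case True
      then have "v x < v (reflection \<nu> b x)"
        using v_less[OF \<nu> \<mu> ab b(2) b_le[OF ab]] xb' by (simp add: cap_def)
      then show False using ge by simp
    next
      case False
      then have "v x = 0" using x V.frontier_iff V.zero by blast
      moreover have "0 < v (reflection \<nu> b x)"
        using V.pos V.reflection_in_domain[OF \<nu> \<mu> ab b(2) x xb'] by blast
      ultimately show False using ge by simp
    qed
  qed
qed

text \<open>The endpoint \<open>lambda1 \<Omega> \<nu>\<close> need not be below any element of
  \<open>Lambda1 \<Omega> \<nu>\<close>, so the level is approached from below. The limit of the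
  reflected points is known to lie in the closure, where \<open>u\<close> and \<open>v\<close> are
  continuous.\<close>

lemma le_reflection_closed:
  assumes \<nu>: "norm \<nu> = 1" and l: "a_inf \<Omega> \<nu> < l" "ereal l \<le> lambda1 \<Omega> \<nu>" and x: "x \<in> cap \<Omega> \<nu> l"
  shows "u x \<le> u (reflection \<nu> l x)" "v x \<le> v (reflection \<nu> l x)"
proof -
  have x': "x \<in> \<Omega>" "x \<bullet> \<nu> < l" using x by (auto simp: cap_def)
  \<comment> \<open>With this \<open>d\<close> every \<open>L n\<close> is at least the midpoint of
    \<open>x \<bullet> \<nu>\<close> and \<open>l\<close>, so \<open>x\<close> stays in all the
    caps.\<close>
  define d where "d = (l - x \<bullet> \<nu>) / 2"
  define L where "L = (\<lambda>n. l - d / real (Suc n))"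
  have d: "0 < d" "x \<bullet> \<nu> = l - 2 * d" using x' by (auto simp: d_def field_simps)
  have "d / real (Suc n) \<le> d" for n
    using d divide_left_mono[of 1 "real (Suc n)" d] by simp
  moreover have "0 < d / real (Suc n)" for n using d by simp
  ultimately have Ll: "x \<bullet> \<nu> < L n" "L n < l" for n
    unfolding L_def d(2) using d(1) by (smt (verit))+
  have "(\<lambda>n. d / real (Suc n)) \<longlonglongrightarrow> 0"
    using LIMSEQ_Suc[OF lim_const_over_n[of d]] .
  then have lim: "L \<longlonglongrightarrow> l" unfolding L_def using tendsto_diff[OF tendsto_const, of _ 0 _ l] by simp
  have limR: "(\<lambda>n. reflection \<nu> (L n) x) \<longlonglongrightarrow> reflection \<nu> l x"
    by (intro tendsto_reflection tendsto_const lim)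
  have *: "reflection \<nu> (L n) x \<in> \<Omega> \<and> u x \<le> u (reflection \<nu> (L n) x) \<and> v x \<le> v (reflection \<nu> (L n) x)" for n
  proof -
    have "ereal (L n) < lambda1 \<Omega> \<nu>" using Ll(2)[of n] l(2) by (metis ereal_less(2) less_le_trans ereal_less_eq(3) less_ereal.simps(1))
    then obtain \<mu> where \<mu>: "\<mu> \<in> Lambda1 \<Omega> \<nu>" "L n < \<mu>" unfolding lambda1_def less_SUP_iff by auto
    have aL: "a_inf \<Omega> \<nu> < L n" using Ll(1)[of n] V.a_inf_less[OF \<nu> x'(1)] by simp
    have xc: "x \<in> cap \<Omega> \<nu> (L n)" using x' Ll by (simp add: cap_def)
    show ?thesis
      using V.reflection_in_domain[OF \<nu> \<mu>(1) aL \<mu>(2) V.in_closure[OF x'(1)] Ll(1)]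
        u_le[OF \<nu> \<mu>(1) aL \<mu>(2) v_le_reflection[OF \<nu> \<mu>(1) aL \<mu>(2)] xc]
        v_le_reflection[OF \<nu> \<mu>(1) aL \<mu>(2) xc] by blast
  qed
  have mem: "reflection \<nu> (L n) x \<in> closure \<Omega>" for n using * V.in_closure by blast
  have cl: "reflection \<nu> l x \<in> closure \<Omega>" by (rule closure_seqI[OF mem limR])
  show "u x \<le> u (reflection \<nu> l x)"
    by (rule LIMSEQ_le_const[OF continuous_on_seq[OF U.contv cl mem limR]]) (use * in blast)
  show "v x \<le> v (reflection \<nu> l x)"
    by (rule LIMSEQ_le_const[OF continuous_on_seq[OF V.contv cl mem limR]]) (use * in blast)
qed

text \<open>Each point lies on the plane at its own level \<open>x \<bullet> \<nu>\<close>, where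
  \<open>gradient_positive\<close> applies.\<close>

lemma directional_derivative_positive:
  assumes \<nu>: "norm \<nu> = 1" and l: "ereal l < lambda1 \<Omega> \<nu>" and x: "x \<in> cap \<Omega> \<nu> l"
  shows "0 < directional_derivative v \<nu> x"
proof -
  obtain \<mu> where \<mu>: "\<mu> \<in> Lambda1 \<Omega> \<nu>" "l < \<mu>" using l unfolding lambda1_def less_SUP_iff by auto
  have x': "x \<in> \<Omega>" "x \<bullet> \<nu> < l" using x by (auto simp: cap_def)
  have a: "a_inf \<Omega> \<nu> < x \<bullet> \<nu>" "x \<bullet> \<nu> < \<mu>" using V.a_inf_less[OF \<nu> x'(1)] x'(2) \<mu>(2) by auto
  have pos: "0 < \<nu> \<bullet> Gv x"
    using gradient_positive[OF \<nu> \<mu>(1) a v_le_reflection[OF \<nu> \<mu>(1) a] x'(1) refl] .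
  have 1: "((\<lambda>t. x + t *\<^sub>R \<nu>) has_derivative (\<lambda>t. t *\<^sub>R \<nu>)) (at 0)"
    by (auto intro!: derivative_eq_intros)
  have "GDERIV v (x + 0 *\<^sub>R \<nu>) :> Gv x" using V.der[OF x'(1)] by simp
  from has_derivative_compose[OF 1 this[unfolded gderiv_def]]
  have "((\<lambda>t. v (x + t *\<^sub>R \<nu>)) has_real_derivative \<nu> \<bullet> Gv x) (at 0)"
    unfolding has_field_derivative_def by (rule has_derivative_eq_rhs) (simp add: fun_eq_iff)
  then show ?thesis
    using pos unfolding directional_derivative_def by (simp add: DERIV_imp_deriv)
qed

end

section \<open>Reduction of the theorem to the abstract system\<close>

lemma locally_lipschitz_continuous: "locally_lipschitz f \<Longrightarrow> continuous_on UNIV f"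
proof -
  assume f: "locally_lipschitz f"
  have "isCont f s" for s
  proof -
    obtain e L where e: "e > 0" "L-lipschitz_on (cball s e) f" using f unfolding locally_lipschitz_def by blast
    have "continuous_on (ball s e) f"
      using lipschitz_on_continuous_on[OF e(2)] continuous_on_subset ball_subset_cball by blast
    then show ?thesis using e(1) by (simp add: continuous_on_eq_continuous_at)
  qed
  then show ?thesis by (simp add: continuous_on_eq_continuous_at)
qed

theorem theorem1p1:
  fixes \<Omega> :: "(real ^ 'n) set"
    and p1 :: real
    and f g :: "real \<Rightarrow> real"
    and u v :: "real ^ 'n \<Rightarrow> real"
  assumes "bounded_domain \<Omega>"
    and "interior_sphere_condition \<Omega>"
    and "1 < p1"
    and "\<forall>s. 0 \<le> f s" and "\<forall>s. 0 \<le> g s"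
    and "mono_on {0..} f" and "mono_on {0..} g"
    and "locally_lipschitz f" and "locally_lipschitz g"
    and "u \<in> C1_0 \<Omega>" and "v \<in> C1_0 \<Omega>"
    and "weak_solution \<Omega> p1 2 f g u v"
    and "\<forall>x\<in>\<Omega>. 0 < u x" and "\<forall>x\<in>\<Omega>. 0 < v x"
  shows "\<forall>\<nu>. norm \<nu> = 1 \<longrightarrow>
    (\<forall>l. a_inf \<Omega> \<nu> < l \<and> ereal l \<le> lambda1 \<Omega> \<nu> \<longrightarrow>
       (\<forall>x\<in>cap \<Omega> \<nu> l. u x \<le> u (reflection \<nu> l x) \<and> v x \<le> v (reflection \<nu> l x))) \<and>
    (\<forall>l. ereal l < lambda1 \<Omega> \<nu> \<longrightarrow>
       (\<forall>x\<in>cap \<Omega> \<nu> l. 0 < directional_derivative v \<nu> x))"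
proof -
  obtain Gu where Gu: "continuous_on (closure \<Omega>) Gu" "\<And>x. x \<in> \<Omega> \<Longrightarrow> GDERIV u x :> Gu x"
    using assms(10) unfolding C1_0_def C1_closure_def by blast
  obtain Gv where Gv: "continuous_on (closure \<Omega>) Gv" "\<And>x. x \<in> \<Omega> \<Longrightarrow> GDERIV v x :> Gv x"
    using assms(11) unfolding C1_0_def C1_closure_def by blast
  interpret U: positive_C1_0 \<Omega> u Gu
    using assms(1,10,13) Gu by unfold_locales (auto simp: C1_0_def C1_closure_def)
  interpret V: positive_C1_0 \<Omega> v Gv
    using assms(1,11,14) Gv by unfold_locales (auto simp: C1_0_def C1_closure_def)
  have cont: "continuous_on UNIV f" "continuous_on UNIV g"
    using assms(8,9) locally_lipschitz_continuous by auto
  have cu: "continuous_on \<Omega> u" "continuous_on \<Omega> v" "continuous_on \<Omega> Gu" "continuous_on \<Omega> Gv"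
    using U.contv V.contv Gu(1) Gv(1) continuous_on_subset[OF _ closure_subset] by blast+
  have weak_u: "(\<integral>x. p_flux p1 (Gu x) \<bullet> D x \<partial>lborel) = (\<integral>x. f (v x) * \<phi> x \<partial>lborel)"
    if "C1c \<Omega> \<phi> D" for \<phi> D
  proof (rule weak_form_C1c[OF U.domain(1) _ _ _ that])
    show "continuous_on \<Omega> (\<lambda>x. p_flux p1 (Gu x))"
      using continuous_on_compose2[OF continuous_p_flux[OF assms(3)] cu(3)] by simp
    show "continuous_on \<Omega> (\<lambda>x. f (v x))" using continuous_on_compose2[OF cont(1) cu(2)] by simp
    show "(LINT x:\<Omega>|lborel. p_flux p1 (Gu x) \<bullet> gradient \<psi> x) = (LINT x:\<Omega>|lborel. f (v x) * \<psi> x)"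
      if "\<psi> \<in> test_functions \<Omega>" for \<psi>
    proof -
      have "(LINT x:\<Omega>|lborel. p_flux p1 (Gu x) \<bullet> gradient \<psi> x) = (LINT x:\<Omega>|lborel. p_flux p1 (gradient u x) \<bullet> gradient \<psi> x)"
        unfolding set_lebesgue_integral_def
        by (intro Bochner_Integration.integral_cong) (auto simp: indicator_def gradient_eq[OF Gu(2)])
      then show ?thesis using assms(12) that unfolding weak_solution_def by simp
    qed
  qed
  have weak_v: "(\<integral>x. Gv x \<bullet> D x \<partial>lborel) = (\<integral>x. g (u x) * \<phi> x \<partial>lborel)"
    if "C1c \<Omega> \<phi> D" for \<phi> D
  proof (rule weak_form_C1c[OF U.domain(1) cu(4) _ _ that])
    show "continuous_on \<Omega> (\<lambda>x. g (u x))" using continuous_on_compose2[OF cont(2) cu(1)] by simp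
    show "(LINT x:\<Omega>|lborel. Gv x \<bullet> gradient \<psi> x) = (LINT x:\<Omega>|lborel. g (u x) * \<psi> x)"
      if "\<psi> \<in> test_functions \<Omega>" for \<psi>
    proof -
      have "(LINT x:\<Omega>|lborel. Gv x \<bullet> gradient \<psi> x) = (LINT x:\<Omega>|lborel. p_flux 2 (gradient v x) \<bullet> gradient \<psi> x)"
        unfolding set_lebesgue_integral_def p_flux_2
        by (intro Bochner_Integration.integral_cong) (auto simp: indicator_def gradient_eq[OF Gv(2)])
      then show ?thesis using assms(12) that unfolding weak_solution_def by simp
    qed
  qed
  \<comment> \<open>Nonnegativity of \<open>g\<close> makes \<open>v\<close> superharmonic in all of
    \<Omega>, which is what the Hopf lemma asks for in the touching balls.\<close>
  have sup: "superharmonic_gradient \<Omega> Gv"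
    unfolding superharmonic_gradient_def
    using weak_v assms(5) by (auto intro!: Bochner_Integration.integral_nonneg)
  interpret V: nondegenerate_C1_0 \<Omega> v Gv
  proof
    fix x assume x: "x \<in> frontier \<Omega>"
    then obtain c r where c: "0 < r" "ball c r \<subseteq> \<Omega>" "x \<in> sphere c r"
      using assms(2) unfolding interior_sphere_condition_def by blast
    have cb: "cball c r \<subseteq> closure \<Omega>" using closure_mono[OF c(2)] c(1) by (simp add: closure_ball)
    \<comment> \<open>The centre of the touching ball supplies a direction in which the extended
      gradient is positive at the boundary point.\<close>
    have "0 < (c - x) \<bullet> Gv x"
    proof (rule hopf_gradient[OF c(1) cb V.contv Gv(1) _ superharmonic_gradient_subset[OF sup c(2)]])
      show "GDERIV v y :> Gv y" "0 < v y" if "y \<in> ball c r" for y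
        using Gv(2) V.pos c(2) that by auto
      show "0 \<le> v y" if "y \<in> sphere c r" for y using V.nonneg cb that by auto
      show "dist c x = r" "v x = 0" using c(3) V.zero[OF x] by auto
    qed
    then show "Gv x \<noteq> 0" by auto
  qed
  interpret cooperative_system \<Omega> u v Gu Gv p1 f g
    by unfold_locales (use assms(3,6,7) cont weak_u weak_v in auto)
  show ?thesis
    using le_reflection_closed directional_derivative_positive by blast
qed

end
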